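(* Let $N$ be a paraquaternionic CR-submanifold of a paraquaternionic K\"ahler manifold $(M,\sigma,g)$ and let $(M',\sigma',g')$ be an almost paraquaternionic hermitian manifold. If $\pi:N\to M'$ is a paraquaternionic CR-submersion, then $(M',\sigma',g')$ is a paraquaternionic K\"ahler manifold.
   Context: Everything is smooth. Put $\epsilon_1=1$, $\epsilon_2=\epsilon_3=-1$; indices $\alpha\in\{1,2,3\}$ are taken modulo 3. An almost paraquaternionic structure on $M$ is a rank-3 subbundle $\sigma\subset \mathrm{End}(TM)$ admitting on coordinate neighborhoods $U$ a canonical local basis $\{J_1,J_2,J_3\}$ with $J_\alpha^2=-\epsilon_\alpha \mathrm{Id}$ and $J_\alpha J_{\alpha+1}=-J_{\alpha+1}J_\alpha=\epsilon_{\alpha+2}J_{\alpha+2}$; on overlaps two canonical local bases are related by an $SO(2,1)$-valued matrix of functions. $(M,\sigma,g)$ is almost paraquaternionic hermitian if $g$ is a semi-Riemannian metric with $g(J_\alpha X,J_\alpha Y)=\epsilon_\alpha g(X,Y)$ for all $\alpha$ and all canonical local bases. It is paraquaternionic K\"ahler if moreover $\sigma$ is parallel with respect to the Levi-Civita connection $\overline\nabla$ of $g$; equivalently there are local 1-forms $\omega_1,\omega_2,\omega_3$ with $\overline\nabla_XJ_\alpha=-\epsilon_\alpha[\omega_{\alpha+2}(X)J_{\alpha+1}-\omega_{\alpha+1}(X)J_{\alpha+2}]$. A non-degenerate (immersed) submanifold $N$ of $M$ is one on which the induced metric, again denoted $g$, is non-degenerate. It is a paraquaternionic CR-submanifold if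 there is a non-degenerate distribution $\mathcal{D}\subset TN$ such that, for every canonical local basis on $U$ and $x\in U\cap N$, $J_\alpha\mathcal{D}_x=\mathcal{D}_x$ and $J_\alpha\mathcal{D}^\perp_x\subset T_x^\perp N$ for $\alpha\in\{1,2,3\}$, where $\mathcal{D}^\perp$ is the orthogonal complement of $\mathcal{D}$ in $TN$. A semi-Riemannian submersion $\pi:(N,g)\to(M',g')$ between connected semi-Riemannian manifolds is a smooth surjective map such that each $\pi_{*|p}$ is onto, the fibres are semi-Riemannian submanifolds, and $\pi_*$ preserves scalar products of vectors normal to the fibres. The vertical distribution $\mathcal{V}$ consists of vectors tangent to fibres, the horizontal distribution $\mathcal{H}$ of vectors normal to fibres. With $N$ and $(M',\sigma',g')$ as in the claim, a semi-Riemannian submersion $\pi:N\to M'$ is a paraquaternionic CR-submersion if (i) $\mathcal{V}=\mathcal{D}^\perp$ (so $\mathcal{H}=\mathcal{D}$), and (ii) for each $p\in N$, $\pi_*:\mathcal{D}_p\to T_{\pi(p)}M'$ is an isometry with respect to each complex and product structure of $\mathcal{D}_p$ and $T_{\pi(p)}M'$; that is, it is a linear isometry and for any canonical local basis $\{J'_1,J'_2,J'_3\}$ of $\sigma'$ there is a corresponding canonical local basis $\{J_1,J_2,J_3\}$ of $\sigma$ with $\pi_*\circ J_\alpha=J'_\alpha\circ\pi_*$ on $\mathcal{D}$, $\alpha\in\{1,2,3\}$. *)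

theory Defs
  imports "HOL-Analysis.Analysis" "HOL-Library.Function_Algebras" "HOL-Library.Numeral_Type"
begin

section \<open>Functions into a real vector space\<close>

instantiation "fun" :: (type, real_vector) real_vector
begin

definition scaleR_fun :: "real \<Rightarrow> ('a \<Rightarrow> 'b) \<Rightarrow> 'a \<Rightarrow> 'b"
  where "scaleR_fun a f = (\<lambda>x. a *\<^sub>R f x)"

instance
  by standard (auto simp: scaleR_fun_def fun_eq_iff plus_fun_def scaleR_add_right scaleR_add_left)

end

section \<open>Smooth manifolds\<close>

text \<open>Only used for open sets \<open>S\<close>.\<close>

primrec diff_order_on ::
  "nat \<Rightarrow> 'a::euclidean_space set \<Rightarrow> ('a \<Rightarrow> 'b::real_normed_vector) \<Rightarrow> bool"
  where
    "diff_order_on 0 S f \<longleftrightarrow> continuous_on S f"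
  | "diff_order_on (Suc k) S f \<longleftrightarrow> (\<forall>x\<in>S. f differentiable (at x)) \<and>
       (\<forall>v. diff_order_on k S (\<lambda>x. frechet_derivative f (at x) v))"

definition smooth_on :: "'a::euclidean_space set \<Rightarrow> ('a \<Rightarrow> 'b::real_normed_vector) \<Rightarrow> bool"
  where "smooth_on S f \<longleftrightarrow> (\<forall>k. diff_order_on k S f)"

text \<open>The points of a manifold are the elements of a Hausdorff second countable type.
  A chart is a pair of its domain and its coordinate map; the values of the coordinate map outside
  the domain play no role. Atlases need not be maximal: an atlas and the maximal atlas containing
  it determine the same smooth structure, and the notions below depend only on the latter (up to
  the canonical identification of their tangent spaces).\<close>

type_synonym ('m, 'e) chart = "'m set \<times> ('m \<Rightarrow> 'e)"

definition chart_inv :: "('m, 'e) chart \<Rightarrow> 'e \<Rightarrow> 'm"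
  where "chart_inv c = inv_into (fst c) (snd c)"

definition is_chart :: "('m::topological_space, 'e::euclidean_space) chart \<Rightarrow> bool"
  where "is_chart c \<longleftrightarrow> open (fst c) \<and> open (snd c ` fst c) \<and>
    homeomorphism (fst c) (snd c ` fst c) (snd c) (chart_inv c)"

definition smooth_atlas ::
  "('m::{t2_space, second_countable_topology}, 'e::euclidean_space) chart set \<Rightarrow> bool"
  where "smooth_atlas A \<longleftrightarrow> (\<forall>c\<in>A. is_chart c) \<and> (\<Union>c\<in>A. fst c) = UNIV \<and>
    (\<forall>c\<in>A. \<forall>d\<in>A. smooth_on (snd c ` (fst c \<inter> fst d)) (snd d \<circ> chart_inv c))"

definition charts_at :: "('m, 'e) chart set \<Rightarrow> 'm \<Rightarrow> ('m, 'e) chart set"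
  where "charts_at A p = {c \<in> A. p \<in> fst c}"

definition smooth_map ::
  "('m::topological_space, 'e::euclidean_space) chart set \<Rightarrow>
   ('n::topological_space, 'f::euclidean_space) chart set \<Rightarrow> ('m \<Rightarrow> 'n) \<Rightarrow> bool"
  where "smooth_map A B f \<longleftrightarrow> continuous_on UNIV f \<and>
    (\<forall>c\<in>A. \<forall>d\<in>B. smooth_on (snd c ` (fst c \<inter> f -` fst d)) (snd d \<circ> f \<circ> chart_inv c))"

definition smooth_function_on ::
  "('m, 'e::euclidean_space) chart set \<Rightarrow> 'm set \<Rightarrow> ('m \<Rightarrow> real) \<Rightarrow> bool"
  where "smooth_function_on A U f \<longleftrightarrow>
    (\<forall>c\<in>A. smooth_on (snd c ` (fst c \<inter> U)) (f \<circ> chart_inv c))"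

section \<open>Tangent vectors and vector fields\<close>

text \<open>A tangent vector at \<open>p\<close> is the family of its components in all the charts around \<open>p\<close>,
  which transform by the derivatives of the transition maps; the family is zero at
  all other charts.\<close>

type_synonym ('m, 'e) tvec = "('m, 'e) chart \<Rightarrow> 'e"

definition tangent_space ::
  "('m, 'e::euclidean_space) chart set \<Rightarrow> 'm \<Rightarrow> ('m, 'e) tvec set"
  where "tangent_space A p = {v. (\<forall>c. c \<notin> charts_at A p \<longrightarrow> v c = 0) \<and>
    (\<forall>c\<in>charts_at A p. \<forall>d\<in>charts_at A p.
       v d = frechet_derivative (snd d \<circ> chart_inv c) (at (snd c p)) (v c))}"

text \<open>In the next two definitions the result does not depend on the chart chosen around \<open>p\<close>.\<close>

definition differential ::
  "('m, 'e::euclidean_space) chart set \<Rightarrow> ('n, 'f::euclidean_space) chart set \<Rightarrow>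
   ('m \<Rightarrow> 'n) \<Rightarrow> 'm \<Rightarrow> ('m, 'e) tvec \<Rightarrow> ('n, 'f) tvec"
  where "differential A B f p v = (\<lambda>d. if d \<in> charts_at B (f p)
    then let c = (SOME c. c \<in> charts_at A p)
         in frechet_derivative (snd d \<circ> f \<circ> chart_inv c) (at (snd c p)) (v c)
    else 0)"

definition dir_deriv ::
  "('m, 'e::euclidean_space) chart set \<Rightarrow> 'm \<Rightarrow> ('m, 'e) tvec \<Rightarrow> ('m \<Rightarrow> real) \<Rightarrow> real"
  where "dir_deriv A p v f = (let c = (SOME c. c \<in> charts_at A p)
    in frechet_derivative (f \<circ> chart_inv c) (at (snd c p)) (v c))"

definition vector_field_on ::
  "('m, 'e::euclidean_space) chart set \<Rightarrow> 'm set \<Rightarrow> ('m \<Rightarrow> ('m, 'e) tvec) \<Rightarrow> bool"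
  where "vector_field_on A U X \<longleftrightarrow> (\<forall>p\<in>U. X p \<in> tangent_space A p) \<and>
    (\<forall>c\<in>A. smooth_on (snd c ` (fst c \<inter> U)) (\<lambda>x. X (chart_inv c x) c))"

definition lie_bracket ::
  "('m, 'e::euclidean_space) chart set \<Rightarrow> ('m \<Rightarrow> ('m, 'e) tvec) \<Rightarrow> ('m \<Rightarrow> ('m, 'e) tvec) \<Rightarrow>
   'm \<Rightarrow> ('m, 'e) tvec"
  where "lie_bracket A X Y p = (\<lambda>c. if c \<in> charts_at A p
    then frechet_derivative (\<lambda>x. Y (chart_inv c x) c) (at (snd c p)) (X p c)
       - frechet_derivative (\<lambda>x. X (chart_inv c x) c) (at (snd c p)) (Y p c)
    else 0)"

definition distribution ::
  "('m::topological_space, 'e::euclidean_space) chart set \<Rightarrow>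
   ('m \<Rightarrow> ('m, 'e) tvec set) \<Rightarrow> bool"
  where "distribution A D \<longleftrightarrow> (\<exists>r::nat. \<forall>p. \<exists>U X. open U \<and> p \<in> U \<and>
    (\<forall>i<r. vector_field_on A U (X i)) \<and>
    (\<forall>q\<in>U. D q = span ((\<lambda>i. X i q) ` {..<r}) \<and> dim (D q) = r))"

section \<open>Semi-Riemannian metrics\<close>

definition sym_bilinear_on :: "'v::real_vector set \<Rightarrow> ('v \<Rightarrow> 'v \<Rightarrow> real) \<Rightarrow> bool"
  where "sym_bilinear_on V b \<longleftrightarrow> (\<forall>u\<in>V. \<forall>v\<in>V. b u v = b v u) \<and>
    (\<forall>u\<in>V. \<forall>v\<in>V. \<forall>w\<in>V. \<forall>a. b (a *\<^sub>R u + v) w = a * b u w + b v w)"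

definition nondegenerate_on :: "'v::real_vector set \<Rightarrow> ('v \<Rightarrow> 'v \<Rightarrow> real) \<Rightarrow> bool"
  where "nondegenerate_on V b \<longleftrightarrow> (\<forall>v\<in>V. (\<forall>w\<in>V. b v w = 0) \<longrightarrow> v = 0)"

definition index_on :: "'v::real_vector set \<Rightarrow> ('v \<Rightarrow> 'v \<Rightarrow> real) \<Rightarrow> nat"
  where "index_on V b =
    Max (dim ` {W. subspace W \<and> W \<subseteq> V \<and> (\<forall>w\<in>W. w \<noteq> 0 \<longrightarrow> b w w < 0)})"

definition orthogonal_in :: "'v::real_vector set \<Rightarrow> ('v \<Rightarrow> 'v \<Rightarrow> real) \<Rightarrow> 'v set \<Rightarrow> 'v set"
  where "orthogonal_in V b W = {v \<in> V. \<forall>w\<in>W. b v w = 0}"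

type_synonym ('m, 'e) metric_tensor = "'m \<Rightarrow> ('m, 'e) tvec \<Rightarrow> ('m, 'e) tvec \<Rightarrow> real"

text \<open>Only the values of \<open>g p\<close> on tangent vectors at \<open>p\<close> matter. Smoothness of a tensor field is
  expressed by its action on smooth local vector fields.\<close>

definition semi_riemannian_metric ::
  "('m::topological_space, 'e::euclidean_space) chart set \<Rightarrow> ('m, 'e) metric_tensor \<Rightarrow> bool"
  where "semi_riemannian_metric A g \<longleftrightarrow>
    (\<forall>p. sym_bilinear_on (tangent_space A p) (g p) \<and> nondegenerate_on (tangent_space A p) (g p)) \<and>
    (\<exists>k. \<forall>p. index_on (tangent_space A p) (g p) = k) \<and>
    (\<forall>U X Y. open U \<longrightarrow> vector_field_on A U X \<longrightarrow> vector_field_on A U Y \<longrightarrow>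
       smooth_function_on A U (\<lambda>p. g p (X p) (Y p)))"

text \<open>Connections are regarded as operators on smooth vector fields over arbitrary open sets, which
  are represented by total functions; the locality condition says that the result on \<open>U\<close> depends
  only on the restrictions of the fields to \<open>U\<close>, and makes restriction to smaller open sets
  automatic.\<close>

definition affine_connection ::
  "('m::topological_space, 'e::euclidean_space) chart set \<Rightarrow>
   (('m \<Rightarrow> ('m, 'e) tvec) \<Rightarrow> ('m \<Rightarrow> ('m, 'e) tvec) \<Rightarrow> 'm \<Rightarrow> ('m, 'e) tvec) \<Rightarrow> bool"
  where "affine_connection A nab \<longleftrightarrow>
    (\<forall>U X Y. open U \<longrightarrow> vector_field_on A U X \<longrightarrow> vector_field_on A U Y \<longrightarrow>
       vector_field_on A U (nab X Y) \<and>
       (\<forall>X' Y'. (\<forall>p\<in>U. X' p = X p \<and> Y' p = Y p) \<longrightarrow> (\<forall>p\<in>U. nab X' Y' p = nab X Y p)) \<and>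
       (\<forall>Z f. vector_field_on A U Z \<longrightarrow> smooth_function_on A U f \<longrightarrow>
          (\<forall>p\<in>U. nab (\<lambda>q. f q *\<^sub>R X q + Z q) Y p = f p *\<^sub>R nab X Y p + nab Z Y p) \<and>
          (\<forall>p\<in>U. nab X (\<lambda>q. f q *\<^sub>R Y q + Z q) p =
             dir_deriv A p (X p) f *\<^sub>R Y p + f p *\<^sub>R nab X Y p + nab X Z p)))"

definition levi_civita_connection ::
  "('m::topological_space, 'e::euclidean_space) chart set \<Rightarrow> ('m, 'e) metric_tensor \<Rightarrow>
   (('m \<Rightarrow> ('m, 'e) tvec) \<Rightarrow> ('m \<Rightarrow> ('m, 'e) tvec) \<Rightarrow> 'm \<Rightarrow> ('m, 'e) tvec) \<Rightarrow> bool"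
  where "levi_civita_connection A g nab \<longleftrightarrow> affine_connection A nab \<and>
    (\<forall>U X Y. open U \<longrightarrow> vector_field_on A U X \<longrightarrow> vector_field_on A U Y \<longrightarrow>
       (\<forall>p\<in>U. nab X Y p - nab Y X p = lie_bracket A X Y p) \<and>
       (\<forall>Z. vector_field_on A U Z \<longrightarrow> (\<forall>p\<in>U.
          dir_deriv A p (X p) (\<lambda>q. g q (Y q) (Z q)) = g p (nab X Y p) (Z p) + g p (Y p) (nab X Z p))))"

section \<open>Almost paraquaternionic structures\<close>

text \<open>Endomorphisms of the tangent space at \<open>p\<close> are extended by zero outside the tangent space, so
  that they form a real vector space under the pointwise operations.\<close>

definition tangent_endo ::
  "('m, 'e::euclidean_space) chart set \<Rightarrow> 'm \<Rightarrow> (('m, 'e) tvec \<Rightarrow> ('m, 'e) tvec) set"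
  where "tangent_endo A p = {F. (\<forall>v\<in>tangent_space A p. F v \<in> tangent_space A p) \<and>
    (\<forall>u\<in>tangent_space A p. \<forall>v\<in>tangent_space A p. \<forall>a. F (a *\<^sub>R u + v) = a *\<^sub>R F u + F v) \<and>
    (\<forall>v. v \<notin> tangent_space A p \<longrightarrow> F v = 0)}"

type_synonym ('m, 'e) endo_field = "'m \<Rightarrow> ('m, 'e) tvec \<Rightarrow> ('m, 'e) tvec"

definition endo_field_on ::
  "('m::topological_space, 'e::euclidean_space) chart set \<Rightarrow> 'm set \<Rightarrow>
   ('m, 'e) endo_field \<Rightarrow> bool"
  where "endo_field_on A U J \<longleftrightarrow> (\<forall>p\<in>U. J p \<in> tangent_endo A p) \<and>
    (\<forall>V X. open V \<longrightarrow> V \<subseteq> U \<longrightarrow> vector_field_on A V X \<longrightarrow> vector_field_on A V (\<lambda>p. J p (X p)))"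

text \<open>The indices are the elements of the type \<open>3\<close> of integers modulo 3, in which \<open>3 = 0\<close>.\<close>

definition eps :: "3 \<Rightarrow> real"
  where "eps \<alpha> = (if \<alpha> = 1 then 1 else -1)"

definition canonical_local_basis ::
  "('m::topological_space, 'e::euclidean_space) chart set \<Rightarrow>
   ('m \<Rightarrow> (('m, 'e) tvec \<Rightarrow> ('m, 'e) tvec) set) \<Rightarrow> 'm set \<Rightarrow> (3 \<Rightarrow> ('m, 'e) endo_field) \<Rightarrow> bool"
  where "canonical_local_basis A \<sigma> U J \<longleftrightarrow> open U \<and>
    (\<forall>\<alpha>. endo_field_on A U (J \<alpha>)) \<and>
    (\<forall>p\<in>U. \<sigma> p = span (range (\<lambda>\<alpha>. J \<alpha> p)) \<and> dim (\<sigma> p) = 3 \<and>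
      (\<forall>\<alpha>. \<forall>v\<in>tangent_space A p.
         J \<alpha> p (J \<alpha> p v) = - eps \<alpha> *\<^sub>R v \<and>
         J \<alpha> p (J (\<alpha> + 1) p v) = eps (\<alpha> + 2) *\<^sub>R J (\<alpha> + 2) p v \<and>
         - J (\<alpha> + 1) p (J \<alpha> p v) = eps (\<alpha> + 2) *\<^sub>R J (\<alpha> + 2) p v))"

text \<open>\<open>SO(2,1)\<close> is the special orthogonal group of the form \<open>diag(\<epsilon>\<^sub>1, \<epsilon>\<^sub>2, \<epsilon>\<^sub>3)\<close>.\<close>

definition SO21 :: "(real ^ 3 ^ 3) set"
  where "SO21 = (let \<eta> = (\<chi> i j. if i = j then eps i else 0) in
    {a. transpose a ** \<eta> ** a = \<eta> \<and> det a = 1})"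

definition almost_paraquaternionic ::
  "('m::topological_space, 'e::euclidean_space) chart set \<Rightarrow>
   ('m \<Rightarrow> (('m, 'e) tvec \<Rightarrow> ('m, 'e) tvec) set) \<Rightarrow> bool"
  where "almost_paraquaternionic A \<sigma> \<longleftrightarrow>
    (\<forall>p. \<exists>U J. p \<in> U \<and> canonical_local_basis A \<sigma> U J) \<and>
    (\<forall>U J V K. canonical_local_basis A \<sigma> U J \<longrightarrow> canonical_local_basis A \<sigma> V K \<longrightarrow>
       (\<exists>a :: 'm \<Rightarrow> real ^ 3 ^ 3.
          (\<forall>\<alpha> \<beta>. smooth_function_on A (U \<inter> V) (\<lambda>p. a p $ \<alpha> $ \<beta>)) \<and>
          (\<forall>p\<in>U \<inter> V. a p \<in> SO21 \<and> (\<forall>\<alpha>. K \<alpha> p = (\<Sum>\<beta>\<in>UNIV. a p $ \<alpha> $ \<beta> *\<^sub>R J \<beta> p)))))"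

definition almost_paraquaternionic_hermitian ::
  "('m::{t2_space, second_countable_topology}, 'e::euclidean_space) chart set \<Rightarrow>
   ('m \<Rightarrow> (('m, 'e) tvec \<Rightarrow> ('m, 'e) tvec) set) \<Rightarrow> ('m, 'e) metric_tensor \<Rightarrow> bool"
  where "almost_paraquaternionic_hermitian A \<sigma> g \<longleftrightarrow>
    smooth_atlas A \<and> almost_paraquaternionic A \<sigma> \<and> semi_riemannian_metric A g \<and>
    (\<forall>U J. canonical_local_basis A \<sigma> U J \<longrightarrow>
       (\<forall>\<alpha>. \<forall>p\<in>U. \<forall>v\<in>tangent_space A p. \<forall>w\<in>tangent_space A p.
          g p (J \<alpha> p v) (J \<alpha> p w) = eps \<alpha> * g p v w))"

definition section_on ::
  "('m::topological_space, 'e::euclidean_space) chart set \<Rightarrow>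
   ('m \<Rightarrow> (('m, 'e) tvec \<Rightarrow> ('m, 'e) tvec) set) \<Rightarrow> 'm set \<Rightarrow> ('m, 'e) endo_field \<Rightarrow> bool"
  where "section_on A \<sigma> U J \<longleftrightarrow> endo_field_on A U J \<and> (\<forall>p\<in>U. J p \<in> \<sigma> p)"

text \<open>\<open>S\<close> is the covariant derivative of the endomorphism field \<open>J\<close> in the direction of \<open>X\<close>.\<close>

definition covariant_derivative_endo_on ::
  "('m::topological_space, 'e::euclidean_space) chart set \<Rightarrow>
   (('m \<Rightarrow> ('m, 'e) tvec) \<Rightarrow> ('m \<Rightarrow> ('m, 'e) tvec) \<Rightarrow> 'm \<Rightarrow> ('m, 'e) tvec) \<Rightarrow>
   'm set \<Rightarrow> ('m \<Rightarrow> ('m, 'e) tvec) \<Rightarrow> ('m, 'e) endo_field \<Rightarrow> ('m, 'e) endo_field \<Rightarrow> bool"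
  where "covariant_derivative_endo_on A nab U X J S \<longleftrightarrow> endo_field_on A U S \<and>
    (\<forall>V Y. open V \<longrightarrow> V \<subseteq> U \<longrightarrow> vector_field_on A V Y \<longrightarrow>
       (\<forall>p\<in>V. S p (Y p) = nab X (\<lambda>q. J q (Y q)) p - J p (nab X Y p)))"

definition parallel_bundle ::
  "('m::topological_space, 'e::euclidean_space) chart set \<Rightarrow>
   (('m \<Rightarrow> ('m, 'e) tvec) \<Rightarrow> ('m \<Rightarrow> ('m, 'e) tvec) \<Rightarrow> 'm \<Rightarrow> ('m, 'e) tvec) \<Rightarrow>
   ('m \<Rightarrow> (('m, 'e) tvec \<Rightarrow> ('m, 'e) tvec) set) \<Rightarrow> bool"
  where "parallel_bundle A nab \<sigma> \<longleftrightarrow>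
    (\<forall>U X J. open U \<longrightarrow> vector_field_on A U X \<longrightarrow> section_on A \<sigma> U J \<longrightarrow>
       (\<exists>S. covariant_derivative_endo_on A nab U X J S \<and> section_on A \<sigma> U S))"

definition paraquaternionic_kahler ::
  "('m::{t2_space, second_countable_topology}, 'e::euclidean_space) chart set \<Rightarrow>
   ('m \<Rightarrow> (('m, 'e) tvec \<Rightarrow> ('m, 'e) tvec) set) \<Rightarrow> ('m, 'e) metric_tensor \<Rightarrow> bool"
  where "paraquaternionic_kahler A \<sigma> g \<longleftrightarrow> almost_paraquaternionic_hermitian A \<sigma> g \<and>
    (\<exists>nab. levi_civita_connection A g nab \<and> parallel_bundle A nab \<sigma>)"

section \<open>CR-submanifolds and CR-submersions\<close>

text \<open>An immersed submanifold of \<open>M\<close> is a manifold \<open>N\<close> together with an immersion \<open>\<iota>\<close> into \<open>M\<close>.\<close>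

definition immersion ::
  "('n::topological_space, 'f::euclidean_space) chart set \<Rightarrow>
   ('m::topological_space, 'e::euclidean_space) chart set \<Rightarrow> ('n \<Rightarrow> 'm) \<Rightarrow> bool"
  where "immersion B A \<iota> \<longleftrightarrow> smooth_map B A \<iota> \<and>
    (\<forall>x. inj_on (differential B A \<iota> x) (tangent_space B x))"

definition induced_metric ::
  "('n, 'f::euclidean_space) chart set \<Rightarrow> ('m, 'e::euclidean_space) chart set \<Rightarrow>
   ('n \<Rightarrow> 'm) \<Rightarrow> ('m, 'e) metric_tensor \<Rightarrow> ('n, 'f) metric_tensor"
  where "induced_metric B A \<iota> g x v w =
    g (\<iota> x) (differential B A \<iota> x v) (differential B A \<iota> x w)"

definition nondegenerate_submanifold ::
  "('n::{t2_space, second_countable_topology}, 'f::euclidean_space) chart set \<Rightarrow>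
   ('m::{t2_space, second_countable_topology}, 'e::euclidean_space) chart set \<Rightarrow>
   ('n \<Rightarrow> 'm) \<Rightarrow> ('m, 'e) metric_tensor \<Rightarrow> bool"
  where "nondegenerate_submanifold B A \<iota> g \<longleftrightarrow> smooth_atlas B \<and> immersion B A \<iota> \<and>
    (\<forall>x. nondegenerate_on (tangent_space B x) (induced_metric B A \<iota> g x))"

definition ortho_distribution ::
  "('n, 'f::euclidean_space) chart set \<Rightarrow> ('n, 'f) metric_tensor \<Rightarrow>
   ('n \<Rightarrow> ('n, 'f) tvec set) \<Rightarrow> 'n \<Rightarrow> ('n, 'f) tvec set"
  where "ortho_distribution B h D x = orthogonal_in (tangent_space B x) (h x) (D x)"

definition paraquaternionic_CR_submanifold ::
  "('n::{t2_space, second_countable_topology}, 'f::euclidean_space) chart set \<Rightarrow>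
   ('m::{t2_space, second_countable_topology}, 'e::euclidean_space) chart set \<Rightarrow>
   ('n \<Rightarrow> 'm) \<Rightarrow> ('m \<Rightarrow> (('m, 'e) tvec \<Rightarrow> ('m, 'e) tvec) set) \<Rightarrow> ('m, 'e) metric_tensor \<Rightarrow>
   ('n \<Rightarrow> ('n, 'f) tvec set) \<Rightarrow> bool"
  where "paraquaternionic_CR_submanifold B A \<iota> \<sigma> g D \<longleftrightarrow>
    nondegenerate_submanifold B A \<iota> g \<and>
    distribution B D \<and> (\<forall>x. nondegenerate_on (D x) (induced_metric B A \<iota> g x)) \<and>
    (\<forall>U J. canonical_local_basis A \<sigma> U J \<longrightarrow> (\<forall>x. \<iota> x \<in> U \<longrightarrow> (\<forall>\<alpha>.
       J \<alpha> (\<iota> x) ` differential B A \<iota> x ` D x = differential B A \<iota> x ` D x \<and>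
       J \<alpha> (\<iota> x) ` differential B A \<iota> x ` ortho_distribution B (induced_metric B A \<iota> g) D x
         \<subseteq> orthogonal_in (tangent_space A (\<iota> x)) (g (\<iota> x))
             (differential B A \<iota> x ` tangent_space B x))))"

definition vertical_space ::
  "('n, 'f::euclidean_space) chart set \<Rightarrow> ('k, 'h::euclidean_space) chart set \<Rightarrow>
   ('n \<Rightarrow> 'k) \<Rightarrow> 'n \<Rightarrow> ('n, 'f) tvec set"
  where "vertical_space B A' \<pi> x = {v \<in> tangent_space B x. differential B A' \<pi> x v = 0}"

text \<open>As the differential of \<open>\<pi>\<close> is onto everywhere, the fibres are closed embedded submanifolds whose tangent
  spaces are the vertical spaces; being semi-Riemannian means that the metric restricts
  to a nondegenerate form of constant index along each of them.\<close>

definition semi_riemannian_submersion ::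
  "('n::{t2_space, second_countable_topology}, 'f::euclidean_space) chart set \<Rightarrow>
   ('n, 'f) metric_tensor \<Rightarrow>
   ('k::{t2_space, second_countable_topology}, 'h::euclidean_space) chart set \<Rightarrow>
   ('k, 'h) metric_tensor \<Rightarrow> ('n \<Rightarrow> 'k) \<Rightarrow> bool"
  where "semi_riemannian_submersion B h A' g' \<pi> \<longleftrightarrow>
    smooth_atlas B \<and> semi_riemannian_metric B h \<and> connected (UNIV :: 'n set) \<and>
    smooth_atlas A' \<and> semi_riemannian_metric A' g' \<and> connected (UNIV :: 'k set) \<and>
    smooth_map B A' \<pi> \<and> surj \<pi> \<and>
    (\<forall>x. differential B A' \<pi> x ` tangent_space B x = tangent_space A' (\<pi> x)) \<and>
    (\<forall>y. (\<forall>x\<in>\<pi> -` {y}. nondegenerate_on (vertical_space B A' \<pi> x) (h x)) \<and>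
         (\<exists>k. \<forall>x\<in>\<pi> -` {y}. index_on (vertical_space B A' \<pi> x) (h x) = k)) \<and>
    (\<forall>x. \<forall>v \<in> ortho_distribution B h (vertical_space B A' \<pi>) x.
         \<forall>w \<in> ortho_distribution B h (vertical_space B A' \<pi>) x.
           g' (\<pi> x) (differential B A' \<pi> x v) (differential B A' \<pi> x w) = h x v w)"

text \<open>Vectors of \<open>D\<close> are tangent to \<open>N\<close>, whereas the \<open>J\<close>'s act on vectors tangent to \<open>M\<close>; hence in
  the last clause \<open>\<pi>\<^sub>* (J v) = J' (\<pi>\<^sub>* v)\<close> is spelled out with the vector \<open>w\<close> of \<open>D\<close> that
  represents \<open>J v\<close>; it is unique since \<open>\<iota>\<close> is an immersion. The clause is required in a
  neighbourhood \<open>W\<close> of each point of \<open>N\<close>, because \<open>\<iota>\<close> need not be an embedding.\<close>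

definition paraquaternionic_CR_submersion ::
  "('n::{t2_space, second_countable_topology}, 'f::euclidean_space) chart set \<Rightarrow>
   ('m::{t2_space, second_countable_topology}, 'e::euclidean_space) chart set \<Rightarrow>
   ('n \<Rightarrow> 'm) \<Rightarrow> ('m \<Rightarrow> (('m, 'e) tvec \<Rightarrow> ('m, 'e) tvec) set) \<Rightarrow> ('m, 'e) metric_tensor \<Rightarrow>
   ('n \<Rightarrow> ('n, 'f) tvec set) \<Rightarrow>
   ('k::{t2_space, second_countable_topology}, 'h::euclidean_space) chart set \<Rightarrow>
   ('k \<Rightarrow> (('k, 'h) tvec \<Rightarrow> ('k, 'h) tvec) set) \<Rightarrow> ('k, 'h) metric_tensor \<Rightarrow>
   ('n \<Rightarrow> 'k) \<Rightarrow> bool"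
  where "paraquaternionic_CR_submersion B A \<iota> \<sigma> g D A' \<sigma>' g' \<pi> \<longleftrightarrow>
    (let h = induced_metric B A \<iota> g; d\<iota> = differential B A \<iota>; d\<pi> = differential B A' \<pi> in
      semi_riemannian_submersion B h A' g' \<pi> \<and>
      (\<forall>x. vertical_space B A' \<pi> x = ortho_distribution B h D x) \<and>
      (\<forall>x. bij_betw (d\<pi> x) (D x) (tangent_space A' (\<pi> x)) \<and>
         (\<forall>v\<in>D x. \<forall>w\<in>D x. g' (\<pi> x) (d\<pi> x v) (d\<pi> x w) = h x v w)) \<and>
      (\<forall>x U' J'. canonical_local_basis A' \<sigma>' U' J' \<longrightarrow> \<pi> x \<in> U' \<longrightarrow>
         (\<exists>U J W. canonical_local_basis A \<sigma> U J \<and> open W \<and> x \<in> W \<and> \<iota> ` W \<subseteq> U \<and> \<pi> ` W \<subseteq> U' \<and>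
           (\<forall>q\<in>W. \<forall>\<alpha>. \<forall>v\<in>D q. \<exists>w\<in>D q.
              d\<iota> q w = J \<alpha> (\<iota> q) (d\<iota> q v) \<and> d\<pi> q w = J' \<alpha> (\<pi> q) (d\<pi> q v)))))"

end

theory Submission
  imports Defs
begin

text \<open>
  All tensors are computed in charts, so that fields along \<open>\<iota>\<close> and \<open>\<pi>\<close> are functions between
  Euclidean spaces and no extension of fields from \<open>N\<close> to \<open>M\<close> is needed. Let \<open>\<nabla>\<close> and \<open>\<nabla>'\<close> denote the
  Levi-Civita derivatives of fields along \<open>\<iota>\<close> and along \<open>\<pi>\<close>. For sections \<open>X\<close>, \<open>Y\<close>, \<open>Z\<close> of \<open>D\<close>, the
  difference \<open>g (\<nabla>\<^sub>X d\<iota> Y, d\<iota> Z) - g' (\<nabla>'\<^sub>X d\<pi> Y, d\<pi> Z)\<close> is symmetric in \<open>X\<close>, \<open>Y\<close>, because the bracket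
  of \<open>X\<close> and \<open>Y\<close> differs from a vector of \<open>D\<close> by a vertical one, which is orthogonal to \<open>D\<close>; and it is
  antisymmetric in \<open>Y\<close>, \<open>Z\<close>, because \<open>d\<pi>\<close> is isometric on \<open>D\<close>. Hence it vanishes. Applied to
  \<open>J\<^sub>\<alpha> d\<iota> Y\<close> and \<open>J'\<^sub>\<alpha> d\<pi> Y\<close>, this carries \<open>\<nabla> J\<^sub>\<alpha> = \<Sum>\<^sub>\<beta> \<omega>\<^sub>\<beta> J\<^sub>\<beta>\<close> over to \<open>J'\<^sub>\<alpha>\<close> with the same
  coefficients. An arbitrary section of \<open>\<sigma>'\<close> is a combination of the \<open>J'\<^sub>\<alpha>\<close> whose coefficients are
  differentiable, since anticommutators with \<open>J'\<^sub>\<alpha>\<close> isolate them.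
\<close>

section \<open>Calculus of smooth functions\<close>

text \<open>The derivative of d\<iota> Y in M also has components outside d\<iota> D, about which
  \<pi> says nothing. They are never seen: every equation is tested against d\<iota> Z with Z in D,
  and where some J stands in front of the derivative, skew-symmetry moves it to Z, and J d\<iota> Z
  lies in d\<iota> D again.

  \<open>paraquaternionic_kahler\<close> asks for a connection, so one has to be built on M'. It
  comes from the Koszul formula in single charts. Its uniqueness has two uses: it shows that
  different charts give the same derivative, and it identifies the abstract connection given on M
  with the chart formula. Smoothness of the Christoffel symbols is obtained from smooth dependence
  of the solution of a linear system on parameters.

  The coefficients \<omega> are found point by point only. This suffices: the derivative of a
  section is a smooth endomorphism field by its own construction, and what remains is that it lies
  in \<sigma>' at each single point.\<close>

abbreviation fder :: "('a::real_normed_vector \<Rightarrow> 'b::real_normed_vector) \<Rightarrow> 'a \<Rightarrow> 'a \<Rightarrow> 'b"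
  where "fder f x \<equiv> frechet_derivative f (at x)"

lemma has_derivative_imp_fder: "(f has_derivative f') (at x) \<Longrightarrow> fder f x = f'"
  using frechet_derivative_at by metis

lemma fder_works: "f differentiable (at x) \<Longrightarrow> (f has_derivative fder f x) (at x)"
  by (simp add: frechet_derivative_works)

lemma has_derivative_cong_open:
  assumes "open S" "x \<in> S" "\<And>y. y \<in> S \<Longrightarrow> f y = g y"
  shows "(f has_derivative f') (at x) \<longleftrightarrow> (g has_derivative f') (at x)"
proof
  show "(g has_derivative f') (at x)" if "(f has_derivative f') (at x)"
    by (rule has_derivative_transform_within_open[OF that assms])
  show "(f has_derivative f') (at x)" if "(g has_derivative f') (at x)"
    by (rule has_derivative_transform_within_open[OF that assms(1,2)]) (simp add: assms(3))
qed

text \<open>Both derivatives are chosen by \<open>SOME\<close> from the same predicate, so they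
  agree even at points where neither function is differentiable.\<close>

lemma fder_cong_open:
  assumes "open S" "x \<in> S" "\<And>y. y \<in> S \<Longrightarrow> f y = g y"
  shows "fder f x = fder g x"
  unfolding frechet_derivative_def by (subst has_derivative_cong_open[OF assms]) auto

lemma differentiable_cong_open:
  assumes "open S" "x \<in> S" "\<And>y. y \<in> S \<Longrightarrow> f y = g y"
  shows "f differentiable (at x) \<longleftrightarrow> g differentiable (at x)"
  unfolding differentiable_def by (subst has_derivative_cong_open[OF assms]) auto

lemma fder_compose:
  assumes "f differentiable (at x)" "g differentiable (at (f x))"
  shows "fder (\<lambda>y. g (f y)) x v = fder g (f x) (fder f x v)"
  using frechet_derivative_compose[OF assms] by (simp add: o_def fun_eq_iff)

text \<open>Reduces a derivative in a varying direction to finitely many fixed directions, the only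
  ones that \<open>diff_order_on\<close> speaks about.\<close>

lemma fder_sum_basis:
  fixes f :: "'a::euclidean_space \<Rightarrow> 'b::real_normed_vector"
  assumes "f differentiable (at x)"
  shows "fder f x v = (\<Sum>i\<in>Basis. (v \<bullet> i) *\<^sub>R fder f x i)"
proof -
  interpret linear "fder f x" by (rule linear_frechet_derivative[OF assms])
  show ?thesis
    by (subst euclidean_representation[of v, symmetric]) (simp only: sum scaleR)
qed

section \<open>Closure properties of differentiability of order k\<close>

lemma diff_order_on_cong:
  assumes "open S" "\<And>x. x \<in> S \<Longrightarrow> f x = g x"
  shows "diff_order_on k S f \<longleftrightarrow> diff_order_on k S g"
  using assms(2)
proof (induction k arbitrary: f g)
  case 0
  then show ?case using continuous_on_cong[OF refl, of S f g] by simp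
next
  case (Suc k)
  have "f differentiable (at x) \<longleftrightarrow> g differentiable (at x)" if "x \<in> S" for x
    by (rule differentiable_cong_open[OF assms(1) that Suc.prems])
  moreover have "fder f x = fder g x" if "x \<in> S" for x
    by (rule fder_cong_open[OF assms(1) that Suc.prems])
  then have "diff_order_on k S (\<lambda>x. fder f x v) \<longleftrightarrow> diff_order_on k S (\<lambda>x. fder g x v)" for v
    by (intro Suc.IH) simp
  ultimately show ?case by simp
qed

lemma diff_order_on_subset:
  "diff_order_on k S f \<Longrightarrow> T \<subseteq> S \<Longrightarrow> diff_order_on k T f"
  by (induction k arbitrary: f) (auto intro: continuous_on_subset)

lemma diff_order_on_Suc_imp:
  "diff_order_on (Suc k) S f \<Longrightarrow> diff_order_on k S f"
proof (induction k arbitrary: f)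
  case 0
  then show ?case
    by (auto intro!: continuous_at_imp_continuous_on differentiable_imp_continuous_within)
next
  case (Suc k)
  then have "diff_order_on k S (\<lambda>x. fder f x v)" for v
    using diff_order_on.simps(2)[of "Suc k" S f] by blast
  then show ?case using Suc.prems diff_order_on.simps(2)[of k S f]
      diff_order_on.simps(2)[of "Suc k" S f] by blast
qed

lemma diff_order_on_const: "diff_order_on k S (\<lambda>x. c)"
  by (induction k arbitrary: c) auto

lemma diff_order_on_add:
  assumes "open S" "diff_order_on k S f" "diff_order_on k S g"
  shows "diff_order_on k S (\<lambda>x. f x + g x)"
  using assms(2,3)
proof (induction k arbitrary: f g)
  case 0
  then show ?case by (auto intro: continuous_on_add)
next
  case (Suc k)
  have "fder (\<lambda>x. f x + g x) x v = fder f x v + fder g x v" if "x \<in> S" for x v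
    using Suc.prems that
    by (subst has_derivative_imp_fder[OF has_derivative_add[OF fder_works fder_works]]) auto
  then have "diff_order_on k S (\<lambda>x. fder (\<lambda>x. f x + g x) x v)" for v
    using Suc by (subst diff_order_on_cong[OF assms(1)]) auto
  then show ?case using Suc.prems by auto
qed

text \<open>By the Leibniz rule the derivative is a sum of two terms of the same shape, in each of
  which one factor is differentiated; the other factor has order k by
  \<open>diff_order_on_Suc_imp\<close>, so the induction hypothesis covers both.\<close>

lemma diff_order_on_bilinear:
  assumes "open S" "bounded_bilinear b" "diff_order_on k S f" "diff_order_on k S g"
  shows "diff_order_on k S (\<lambda>x. b (f x) (g x))"
  using assms(3,4)
proof (induction k arbitrary: f g)
  case 0
  then show ?case using bounded_bilinear.continuous_on[OF assms(2)] by auto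
next
  case (Suc k)
  have d: "((\<lambda>x. b (f x) (g x)) has_derivative (\<lambda>v. b (f x) (fder g x v) + b (fder f x v) (g x))) (at x)"
    if "x \<in> S" for x
    using Suc.prems that
    by (intro bounded_bilinear.FDERIV[OF assms(2)] fder_works) auto
  have "diff_order_on k S (\<lambda>x. fder (\<lambda>x. b (f x) (g x)) x v)" for v
    using Suc diff_order_on_Suc_imp[OF Suc.prems(1)] diff_order_on_Suc_imp[OF Suc.prems(2)]
    by (subst diff_order_on_cong[OF assms(1)])
       (auto simp: has_derivative_imp_fder[OF d] intro!: diff_order_on_add assms)
  moreover have "(\<lambda>x. b (f x) (g x)) differentiable (at x)" if "x \<in> S" for x
    using d[OF that] unfolding differentiable_def by blast
  ultimately show ?case by simp
qed

lemma diff_order_on_sum: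
  assumes "open S" "\<And>i. i \<in> I \<Longrightarrow> diff_order_on k S (f i)"
  shows "diff_order_on k S (\<lambda>x. \<Sum>i\<in>I. f i x)"
proof (cases "finite I")
  case True
  then show ?thesis using assms(2)
    by (induction I rule: finite_induct) (auto intro: diff_order_on_const diff_order_on_add assms)
qed (auto intro: diff_order_on_const)

text \<open>The induction varies g and keeps f: by the chain rule the derivative is a combination of
  the functions \<open>fder g (f x) i\<close> with components of \<open>fder f x v\<close> as
  coefficients, and each partial derivative of g is again a function of order k composed with
  f.\<close>

lemma diff_order_on_compose:
  fixes f :: "'a::euclidean_space \<Rightarrow> 'b::euclidean_space"
  assumes "open S" "diff_order_on k S f" "diff_order_on k T g" "open T" "f ` S \<subseteq> T"
  shows "diff_order_on k S (\<lambda>x. g (f x))"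
  using assms(2,3)
proof (induction k arbitrary: g)
  case 0
  then show ?case using assms(5) by (auto intro: continuous_on_compose2)
next
  case (Suc k)
  have f: "f differentiable (at x)" and g: "g differentiable (at (f x))" if "x \<in> S" for x
    using Suc.prems that assms(5) by auto
  have gd: "(\<lambda>x. g (f x)) differentiable (at x)" if "x \<in> S" for x
    using differentiable_chain_at[OF f g] that by (simp add: o_def)
  have "diff_order_on k S (\<lambda>x. fder (\<lambda>x. g (f x)) x v)" for v
  proof (subst diff_order_on_cong[OF assms(1)])
    show "fder (\<lambda>x. g (f x)) x v = (\<Sum>i\<in>Basis. (fder f x v \<bullet> i) *\<^sub>R fder g (f x) i)" if "x \<in> S" for x
      using that by (simp add: fder_compose f g fder_sum_basis[symmetric])
    have "diff_order_on k S (\<lambda>x. fder f x v \<bullet> i)" for i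
      using Suc.prems
      by (intro diff_order_on_bilinear[OF assms(1) bounded_bilinear_inner] diff_order_on_const) auto
    then show "diff_order_on k S (\<lambda>x. \<Sum>i\<in>Basis. (fder f x v \<bullet> i) *\<^sub>R fder g (f x) i)"
      using Suc.prems Suc.IH[OF diff_order_on_Suc_imp[OF Suc.prems(1)], of "\<lambda>x. fder g x i" for i]
      by (intro diff_order_on_sum diff_order_on_bilinear[OF assms(1) bounded_bilinear_scaleR] assms) auto
  qed
  then show ?case using gd by auto
qed

lemma smooth_on_cong:
  assumes "open S" "\<And>x. x \<in> S \<Longrightarrow> f x = g x"
  shows "smooth_on S f \<longleftrightarrow> smooth_on S g"
  unfolding smooth_on_def by (simp add: diff_order_on_cong[OF assms])

lemma smooth_on_subset: "smooth_on S f \<Longrightarrow> T \<subseteq> S \<Longrightarrow> smooth_on T f"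
  unfolding smooth_on_def by (auto intro: diff_order_on_subset)

lemma smooth_on_const: "smooth_on S (\<lambda>x. c)"
  by (simp add: smooth_on_def diff_order_on_const)

lemma smooth_on_add:
  "open S \<Longrightarrow> smooth_on S f \<Longrightarrow> smooth_on S g \<Longrightarrow> smooth_on S (\<lambda>x. f x + g x)"
  by (simp add: smooth_on_def diff_order_on_add)

lemma smooth_on_bilinear:
  "open S \<Longrightarrow> bounded_bilinear b \<Longrightarrow> smooth_on S f \<Longrightarrow> smooth_on S g \<Longrightarrow> smooth_on S (\<lambda>x. b (f x) (g x))"
  by (simp add: smooth_on_def diff_order_on_bilinear)

lemmas smooth_on_scaleR = smooth_on_bilinear[OF _ bounded_bilinear_scaleR]
  and smooth_on_inner = smooth_on_bilinear[OF _ bounded_bilinear_inner]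
  and smooth_on_mult = smooth_on_bilinear[OF _ bounded_bilinear_mult]

lemma smooth_on_sum:
  "open S \<Longrightarrow> (\<And>i. i \<in> I \<Longrightarrow> smooth_on S (f i)) \<Longrightarrow> smooth_on S (\<lambda>x. \<Sum>i\<in>I. f i x)"
  by (simp add: smooth_on_def diff_order_on_sum)

lemma smooth_on_compose:
  fixes f :: "'a::euclidean_space \<Rightarrow> 'b::euclidean_space"
  assumes "open S" "smooth_on S f" "smooth_on T g" "open T" "f ` S \<subseteq> T"
  shows "smooth_on S (\<lambda>x. g (f x))"
  unfolding smooth_on_def
proof
  show "diff_order_on k S (\<lambda>x. g (f x))" for k
    by (rule diff_order_on_compose[OF assms(1) _ _ assms(4,5)]) (use assms(2,3) in \<open>auto simp: smooth_on_def\<close>)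
qed

lemma smooth_on_diff:
  fixes f g :: "'a::euclidean_space \<Rightarrow> 'b::real_normed_vector"
  assumes "open S" "smooth_on S f" "smooth_on S g"
  shows "smooth_on S (\<lambda>x. f x - g x)"
proof -
  have "smooth_on S (\<lambda>x. f x + (-1) *\<^sub>R g x)"
    by (intro smooth_on_add smooth_on_scaleR smooth_on_const assms)
  then show ?thesis by simp
qed

lemma smooth_on_fder:
  assumes "smooth_on S f"
  shows "smooth_on S (\<lambda>x. fder f x v)"
  unfolding smooth_on_def
proof
  fix k
  have "diff_order_on (Suc k) S f" using assms unfolding smooth_on_def by (rule spec)
  then show "diff_order_on k S (\<lambda>x. fder f x v)" by simp
qed

lemma smooth_on_imp_differentiable:
  assumes "smooth_on S f" "x \<in> S"
  shows "f differentiable (at x)"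
proof -
  have "diff_order_on (Suc 0) S f" using assms(1) unfolding smooth_on_def by (rule spec)
  then show ?thesis using assms(2) by simp
qed

lemma smooth_on_imp_continuous:
  assumes "smooth_on S f"
  shows "continuous_on S f"
proof -
  have "diff_order_on 0 S f" using assms unfolding smooth_on_def by (rule spec)
  then show ?thesis by simp
qed

lemma smooth_on_fder_apply:
  fixes f :: "'a::euclidean_space \<Rightarrow> 'b::real_normed_vector"
  assumes "open S" "smooth_on S f" "smooth_on S v"
  shows "smooth_on S (\<lambda>x. fder f x (v x))"
proof (subst smooth_on_cong[OF assms(1)])
  show "fder f x (v x) = (\<Sum>i\<in>Basis. (v x \<bullet> i) *\<^sub>R fder f x i)" if "x \<in> S" for x
    by (rule fder_sum_basis) (rule smooth_on_imp_differentiable[OF assms(2) that])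
  show "smooth_on S (\<lambda>x. \<Sum>i\<in>Basis. (v x \<bullet> i) *\<^sub>R fder f x i)"
    by (intro smooth_on_sum smooth_on_scaleR smooth_on_inner smooth_on_const smooth_on_fder assms)
qed

section \<open>Symmetry of second derivatives\<close>

lemma second_difference_mvt:
  fixes f :: "'a::euclidean_space \<Rightarrow> real"
  assumes s: "0 < s" and
    S: "\<And>a b. 0 \<le> a \<Longrightarrow> a \<le> s \<Longrightarrow> 0 \<le> b \<Longrightarrow> b \<le> s \<Longrightarrow> x + a *\<^sub>R u + b *\<^sub>R v \<in> S"
    and f: "smooth_on S f"
  shows "\<exists>a b. 0 \<le> a \<and> a \<le> s \<and> 0 \<le> b \<and> b \<le> s \<and>
    f (x + s *\<^sub>R u + s *\<^sub>R v) - f (x + s *\<^sub>R u) - f (x + s *\<^sub>R v) + f x =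
    s * s * fder (\<lambda>y. fder f y u) (x + a *\<^sub>R u + b *\<^sub>R v) v"
proof -
  \<comment> \<open>The second difference of f over the parallelogram is \<open>?h s - ?h 0\<close>.
    The mean value theorem in the direction u turns it into a first difference of
    \<open>fder f y u\<close> over s v.\<close>
  let ?h = "\<lambda>t. f (x + t *\<^sub>R u + s *\<^sub>R v) - f (x + t *\<^sub>R u)"
  have h': "(?h has_derivative
      (\<lambda>r. fder f (x + t *\<^sub>R u + s *\<^sub>R v) (r *\<^sub>R u) - fder f (x + t *\<^sub>R u) (r *\<^sub>R u))) (at t within {0..s})"
    if t: "0 \<le> t" "t \<le> s" for t
  proof -
    have 1: "f differentiable (at (x + t *\<^sub>R u + s *\<^sub>R v))" "f differentiable (at (x + t *\<^sub>R u))"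
      using S[OF t, of s] S[OF t, of 0] s by (auto intro!: smooth_on_imp_differentiable[OF f])
    have 2: "((\<lambda>t. x + t *\<^sub>R u + s *\<^sub>R v) has_derivative (\<lambda>r. r *\<^sub>R u)) (at t within {0..s})"
       "((\<lambda>t. x + t *\<^sub>R u) has_derivative (\<lambda>r. r *\<^sub>R u)) (at t within {0..s})"
      by (auto intro!: derivative_eq_intros)
    show ?thesis
      using has_derivative_diff[OF has_derivative_compose[OF 2(1) fder_works[OF 1(1)]]
          has_derivative_compose[OF 2(2) fder_works[OF 1(2)]]] .
  qed
  obtain a where "a \<in> {0<..<s}"
    "?h s - ?h 0 = fder f (x + a *\<^sub>R u + s *\<^sub>R v) ((s - 0) *\<^sub>R u) - fder f (x + a *\<^sub>R u) ((s - 0) *\<^sub>R u)"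
    using mvt_simple[of 0 s ?h "\<lambda>t r. fder f (x + t *\<^sub>R u + s *\<^sub>R v) (r *\<^sub>R u) - fder f (x + t *\<^sub>R u) (r *\<^sub>R u)", OF s h']
    by (auto simp del: scaleR_zero_left)
  then have a: "0 \<le> a" "a \<le> s" and
    "?h s - ?h 0 = fder f (x + a *\<^sub>R u + s *\<^sub>R v) (s *\<^sub>R u) - fder f (x + a *\<^sub>R u) (s *\<^sub>R u)"
    by auto
  moreover have "fder f (x + a *\<^sub>R u + s *\<^sub>R v) (s *\<^sub>R u) = s * fder f (x + a *\<^sub>R u + s *\<^sub>R v) u"
    "fder f (x + a *\<^sub>R u) (s *\<^sub>R u) = s * fder f (x + a *\<^sub>R u) u"
    using linear_scale[OF linear_frechet_derivative[OF smooth_on_imp_differentiable[OF f S[of a s]]]]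
      linear_scale[OF linear_frechet_derivative[OF smooth_on_imp_differentiable[OF f S[of a 0]]]] a s
    by simp_all
  ultimately have h: "?h s - ?h 0 = s * (fder f (x + a *\<^sub>R u + s *\<^sub>R v) u - fder f (x + a *\<^sub>R u) u)"
    by (simp add: right_diff_distrib)
  \<comment> \<open>Second use of the mean value theorem, now in the direction v.\<close>
  let ?k = "\<lambda>y. fder f y u"
  have ks: "smooth_on S ?k" by (rule smooth_on_fder[OF f])
  have k': "((\<lambda>t. ?k (x + a *\<^sub>R u + t *\<^sub>R v)) has_derivative
      (\<lambda>r. fder ?k (x + a *\<^sub>R u + t *\<^sub>R v) (r *\<^sub>R v))) (at t within {0..s})"
    if t: "0 \<le> t" "t \<le> s" for t
  proof -
    have 1: "?k differentiable (at (x + a *\<^sub>R u + t *\<^sub>R v))"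
      by (rule smooth_on_imp_differentiable[OF ks S[OF a t]])
    have 2: "((\<lambda>t. x + a *\<^sub>R u + t *\<^sub>R v) has_derivative (\<lambda>r. r *\<^sub>R v)) (at t within {0..s})"
      by (auto intro!: derivative_eq_intros)
    show ?thesis using has_derivative_compose[OF 2 fder_works[OF 1]] .
  qed
  obtain b where "b \<in> {0<..<s}"
    "?k (x + a *\<^sub>R u + s *\<^sub>R v) - ?k (x + a *\<^sub>R u + 0 *\<^sub>R v) = fder ?k (x + a *\<^sub>R u + b *\<^sub>R v) ((s - 0) *\<^sub>R v)"
    using mvt_simple[of 0 s "\<lambda>t. ?k (x + a *\<^sub>R u + t *\<^sub>R v)" "\<lambda>t r. fder ?k (x + a *\<^sub>R u + t *\<^sub>R v) (r *\<^sub>R v)", OF s k']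
    by (auto simp del: scaleR_zero_left)
  then have b: "0 \<le> b" "b \<le> s" and "?k (x + a *\<^sub>R u + s *\<^sub>R v) - ?k (x + a *\<^sub>R u) = fder ?k (x + a *\<^sub>R u + b *\<^sub>R v) (s *\<^sub>R v)"
    by auto
  moreover have "fder ?k (x + a *\<^sub>R u + b *\<^sub>R v) (s *\<^sub>R v) = s * fder ?k (x + a *\<^sub>R u + b *\<^sub>R v) v"
    using linear_scale[OF linear_frechet_derivative[OF smooth_on_imp_differentiable[OF ks S[of a b]]]]
      a b by simp
  ultimately show ?thesis using h a b by (intro exI[of _ a] exI[of _ b]) auto
qed

text \<open>The second difference is symmetric in u and v, so every small parallelogram at x has a
  point for each of the two mixed derivatives at which they take the same value. As both are
  continuous at x, a gap between them at x is impossible.\<close>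

lemma smooth_on_fder_commute_real:
  fixes f :: "'a::euclidean_space \<Rightarrow> real"
  assumes "open S" "smooth_on S f" "x \<in> S"
  shows "fder (\<lambda>y. fder f y u) x v = fder (\<lambda>y. fder f y v) x u"
proof (rule ccontr)
  let ?p = "\<lambda>y. fder (\<lambda>y. fder f y u) y v" and ?q = "\<lambda>y. fder (\<lambda>y. fder f y v) y u"
  assume ne: "?p x \<noteq> ?q x"
  define e where "e = \<bar>?p x - ?q x\<bar> / 2"
  have e: "e > 0" using ne by (simp add: e_def)
  have "isCont ?p x" "isCont ?q x"
    using assms smooth_on_imp_continuous[OF smooth_on_fder[OF smooth_on_fder[OF assms(2)]]]
    by (auto simp: continuous_on_eq_continuous_at)
  then have "\<forall>\<^sub>F y in nhds x. y \<in> S \<and> dist (?p y) (?p x) < e \<and> dist (?q y) (?q x) < e"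
    using e assms eventually_nhds_in_open[OF assms(1,3)]
    by (intro eventually_conj)
       (auto intro!: tendstoD[OF tendsto_at_iff_tendsto_nhds[THEN iffD1]] simp: continuous_at)
  then obtain d where d: "d > 0" and
    D: "\<And>y. dist y x < d \<Longrightarrow> y \<in> S \<and> dist (?p y) (?p x) < e \<and> dist (?q y) (?q x) < e"
    unfolding eventually_nhds_metric by blast
  \<comment> \<open>The summand 1 keeps N positive when u and v vanish. The parallelogram with sides
    s u and s v then stays within distance s N = d / 2 of x.\<close>
  define N where "N = norm u + norm v + 1"
  define s where "s = d / (2 * N)"
  have pos: "N > 0" unfolding N_def by (intro add_nonneg_pos add_nonneg_nonneg) auto
  have s: "s > 0" using d pos by (simp add: s_def)
  have ball: "dist (x + a *\<^sub>R u + b *\<^sub>R v) x < d" if "0 \<le> a" "a \<le> s" "0 \<le> b" "b \<le> s" for a b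
  proof -
    have "dist (x + a *\<^sub>R u + b *\<^sub>R v) x \<le> a * norm u + b * norm v"
      using norm_triangle_ineq[of "a *\<^sub>R u" "b *\<^sub>R v"] that by (simp add: dist_norm add.assoc)
    also have "\<dots> \<le> s * norm u + s * norm v" using that by (intro add_mono mult_right_mono) auto
    also have "\<dots> \<le> s * N" using s by (simp add: N_def algebra_simps)
    also have "\<dots> < 2 * (s * N)" using s pos by simp
    also have "\<dots> = d" using pos by (simp add: s_def)
    finally show ?thesis .
  qed
  obtain a b where 1: "0 \<le> a" "a \<le> s" "0 \<le> b" "b \<le> s"
    "f (x + s *\<^sub>R u + s *\<^sub>R v) - f (x + s *\<^sub>R u) - f (x + s *\<^sub>R v) + f x = s * s * ?p (x + a *\<^sub>R u + b *\<^sub>R v)"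
    using second_difference_mvt[OF s _ assms(2), of x u v] D ball by blast
  have ball': "x + a *\<^sub>R v + b *\<^sub>R u \<in> S" if "0 \<le> a" "a \<le> s" "0 \<le> b" "b \<le> s" for a b
    using D[OF ball[OF that(3,4,1,2)]] by (simp add: algebra_simps)
  obtain b' a' where 2: "0 \<le> b'" "b' \<le> s" "0 \<le> a'" "a' \<le> s"
    "f (x + s *\<^sub>R v + s *\<^sub>R u) - f (x + s *\<^sub>R v) - f (x + s *\<^sub>R u) + f x = s * s * ?q (x + b' *\<^sub>R v + a' *\<^sub>R u)"
    using second_difference_mvt[OF s _ assms(2), of x v u] ball' by blast
  have "s * s * ?p (x + a *\<^sub>R u + b *\<^sub>R v) = s * s * ?q (x + b' *\<^sub>R v + a' *\<^sub>R u)"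
    using 1(5) 2(5) by (simp add: algebra_simps)
  then have "?p (x + a *\<^sub>R u + b *\<^sub>R v) = ?q (x + a' *\<^sub>R u + b' *\<^sub>R v)"
    using s by (simp add: algebra_simps)
  moreover have "dist (?p (x + a *\<^sub>R u + b *\<^sub>R v)) (?p x) < e" using D[OF ball] 1 by blast
  moreover have "dist (?q (x + a' *\<^sub>R u + b' *\<^sub>R v)) (?q x) < e" using D[OF ball] 2 by blast
  ultimately have "dist (?p x) (?q x) < e + e"
    using dist_triangle_half_r[of "?p (x + a *\<^sub>R u + b *\<^sub>R v)" "?p x" "2 * e" "?q x"] by (simp add: dist_commute)
  then show False by (simp add: e_def dist_real_def)
qed

lemma smooth_on_fder_commute:
  fixes f :: "'a::euclidean_space \<Rightarrow> 'b::euclidean_space"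
  assumes "open S" "smooth_on S f" "x \<in> S"
  shows "fder (\<lambda>y. fder f y u) x v = fder (\<lambda>y. fder f y v) x u"
proof (rule euclidean_eqI)
  fix i :: 'b assume "i \<in> Basis"
  have *: "fder (\<lambda>y. h y \<bullet> i) y v = fder h y v \<bullet> i" if "smooth_on S h" "y \<in> S" for h :: "'a \<Rightarrow> 'b" and y v
    by (subst has_derivative_imp_fder[OF has_derivative_inner_left[OF fder_works]])
       (use smooth_on_imp_differentiable[OF that] in auto)
  have **: "fder (\<lambda>y. fder f y u) x v \<bullet> i = fder (\<lambda>y. fder (\<lambda>y. f y \<bullet> i) y u) x v" for u v
  proof -
    have "fder (\<lambda>y. fder f y u) x v \<bullet> i = fder (\<lambda>y. fder f y u \<bullet> i) x v"
      using *[OF smooth_on_fder[OF assms(2)] assms(3)] by simp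
    also have "\<dots> = fder (\<lambda>y. fder (\<lambda>y. f y \<bullet> i) y u) x v"
      using *[OF assms(2)] by (subst fder_cong_open[OF assms(1,3)]) auto
    finally show ?thesis .
  qed
  show "fder (\<lambda>y. fder f y u) x v \<bullet> i = fder (\<lambda>y. fder f y v) x u \<bullet> i"
    unfolding ** by (intro smooth_on_fder_commute_real[OF assms(1) _ assms(3)] smooth_on_inner smooth_on_const assms)
qed

section \<open>Linear systems that depend on a parameter\<close>

lemma linear_sum_basis:
  fixes f :: "'a::euclidean_space \<Rightarrow> 'b::real_vector"
  assumes "linear f"
  shows "f v = (\<Sum>i\<in>Basis. (v \<bullet> i) *\<^sub>R f i)"
  using linear_sum[OF assms, of "\<lambda>i. (v \<bullet> i) *\<^sub>R i" Basis]
  by (simp add: linear_scale[OF assms] euclidean_representation)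

text \<open>A perturbation argument that forms no inverse near x. With a left inverse L of
  \<open>A x\<close>, the difference w y - w x is L applied to b y - b x minus (A y - A x)(w y). The
  last term contains w y, whose size is not known in advance, but it is absorbed once
  \<open>A y\<close> is close enough to \<open>A x\<close>.\<close>

lemma continuous_linear_solve:
  fixes A :: "'a::t2_space \<Rightarrow> 'b::euclidean_space \<Rightarrow> 'b"
  assumes S: "open S" "x \<in> S"
    and A: "\<And>y. y \<in> S \<Longrightarrow> linear (A y)" "inj (A x)" "\<And>i. isCont (\<lambda>y. A y i) x"
    and b: "isCont b x" and w: "\<And>y. y \<in> S \<Longrightarrow> A y (w y) = b y"
  shows "isCont w x"
proof -
  obtain L where L: "linear L" "\<And>v. L (A x v) = v"
    using linear_injective_left_inverse[OF A(1)[OF S(2)] A(2)] by (auto simp: fun_eq_iff)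
  obtain K where K: "K > 0" "\<And>v. norm (L v) \<le> norm v * K"
    using bounded_linear.pos_bounded[OF linear_conv_bounded_linear[THEN iffD1, OF L(1)]] by auto
  define E where "E y = (\<Sum>i\<in>Basis. norm (A y i - A x i))" for y
  have E: "norm (A y v - A x v) \<le> E y * norm v" if "y \<in> S" for y v
  proof -
    have "A y v - A x v = (\<Sum>i\<in>Basis. (v \<bullet> i) *\<^sub>R (A y i - A x i))"
      by (simp add: linear_sum_basis[OF A(1)[OF that], of v] linear_sum_basis[OF A(1)[OF S(2)], of v]
        scaleR_diff_right sum_subtractf)
    then have "norm (A y v - A x v) \<le> (\<Sum>i\<in>Basis. norm ((v \<bullet> i) *\<^sub>R (A y i - A x i)))"
      using norm_sum[of "\<lambda>i. (v \<bullet> i) *\<^sub>R (A y i - A x i)" Basis] by (simp only:)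
    also have "\<dots> \<le> (\<Sum>i\<in>Basis. norm v * norm (A y i - A x i))"
      by (intro sum_mono) (auto intro!: mult_right_mono simp: Basis_le_norm)
    finally show ?thesis by (simp add: E_def sum_distrib_left sum_distrib_right mult.commute)
  qed
  have "((\<lambda>y. E y) \<longlongrightarrow> (\<Sum>i\<in>(Basis :: 'b set). norm (A x i - A x i))) (at x)"
    unfolding E_def using A(3) by (intro tendsto_intros) (auto simp: isCont_def)
  then have E0: "(E \<longlongrightarrow> 0) (at x)" by simp
  have b0: "((\<lambda>y. norm (b y - b x)) \<longlongrightarrow> 0) (at x)"
    using b unfolding isCont_def by (simp add: LIM_zero tendsto_norm_zero)
  have bnd: "norm (w y - w x) \<le> 2 * K * (norm (b y - b x) + E y * norm (w x))"
    if y: "y \<in> S" "E y < 1 / (2 * K)" for y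
  proof -
    have "A x (w y - w x) = (b y - b x) - (A y (w y) - A x (w y))"
      using w[OF y(1)] w[OF S(2)] linear_diff[OF A(1)[OF S(2)]] by simp
    then have "w y - w x = L ((b y - b x) - (A y (w y) - A x (w y)))"
      using L(2) by metis
    then have "norm (w y - w x) \<le> norm ((b y - b x) - (A y (w y) - A x (w y))) * K"
      using K(2) by simp
    also have "\<dots> \<le> (norm (b y - b x) + E y * norm (w y)) * K"
      using K(1) E[OF y(1), of "w y"] norm_triangle_ineq4[of "b y - b x" "A y (w y) - A x (w y)"]
      by (intro mult_right_mono) auto
    also have "\<dots> \<le> (norm (b y - b x) + E y * (norm (w x) + norm (w y - w x))) * K"
      using K(1) norm_triangle_sub[of "w y" "w x"]
      by (intro mult_right_mono add_left_mono mult_left_mono) (auto simp: E_def sum_nonneg)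
    finally have "norm (w y - w x) \<le>
        K * (norm (b y - b x) + E y * norm (w x)) + E y * K * norm (w y - w x)"
      by (simp add: algebra_simps)
    \<comment> \<open>As E y * K < 1 / 2, this term is at most half of the left side; moving it over
      produces the factor 2 in \<open>bnd\<close>.\<close>
    moreover have "E y * K * norm (w y - w x) \<le> 1 / 2 * norm (w y - w x)"
      using y(2) K(1) by (intro mult_right_mono) (auto simp: field_simps)
    ultimately show ?thesis by simp
  qed
  have "\<forall>\<^sub>F y in at x. y \<in> S" using eventually_at_in_open'[OF S] .
  moreover have "\<forall>\<^sub>F y in at x. E y < 1 / (2 * K)"
    using order_tendstoD(2)[OF E0, of "1 / (2 * K)"] K(1) by simp
  ultimately have "\<forall>\<^sub>F y in at x. norm (w y - w x) \<le> 2 * K * (norm (b y - b x) + E y * norm (w x))"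
    by eventually_elim (rule bnd)
  moreover have "((\<lambda>y. 2 * K * (norm (b y - b x) + E y * norm (w x))) \<longlongrightarrow> 2 * K * (0 + 0 * norm (w x))) (at x)"
    by (intro tendsto_intros b0 E0)
  then have "((\<lambda>y. 2 * K * (norm (b y - b x) + E y * norm (w x))) \<longlongrightarrow> 0) (at x)" by simp
  ultimately have "((\<lambda>y. w y - w x) \<longlongrightarrow> 0) (at x)" by (rule Lim_null_comparison)
  then show ?thesis unfolding isCont_def by (rule LIM_zero_cancel)
qed

text \<open>A product rule in which s is merely continuous: f vanishes at x, so the term with the
  derivative of s would vanish anyway. In \<open>differentiable_linear_solve\<close>, s is a
  component of the solution whose differentiability is still to be shown.\<close>

lemma has_derivative_scaleR_vanishing:
  fixes f :: "'a::real_normed_vector \<Rightarrow> 'b::real_normed_vector"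
  assumes f: "(f has_derivative f') (at x)" "f x = 0" and s: "isCont s x"
  shows "((\<lambda>y. s y *\<^sub>R f y) has_derivative (\<lambda>h. s x *\<^sub>R f' h)) (at x)"
  unfolding has_derivative_iff_norm
proof (intro conjI)
  have bl: "bounded_linear f'" using f(1) by (rule has_derivative_bounded_linear)
  then show "bounded_linear (\<lambda>h. s x *\<^sub>R f' h)" by (rule bounded_linear_const_scaleR)
  obtain K where K: "\<And>h. norm (f' h) \<le> norm h * K" using bounded_linear.bounded[OF bl] by auto
  let ?r = "\<lambda>y. norm (f y - f x - f' (y - x)) / norm (y - x)"
  have r: "(?r \<longlongrightarrow> 0) (at x)" using f(1) unfolding has_derivative_iff_norm by blast
  have s1: "((\<lambda>y. \<bar>s y\<bar>) \<longlongrightarrow> \<bar>s x\<bar>) (at x)" "((\<lambda>y. \<bar>s y - s x\<bar>) \<longlongrightarrow> \<bar>s x - s x\<bar>) (at x)"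
    using s unfolding isCont_def by (intro tendsto_intros; assumption)+
  have "norm (s y *\<^sub>R f y - s x *\<^sub>R f x - s x *\<^sub>R f' (y - x)) / norm (y - x) \<le> \<bar>s y\<bar> * ?r y + \<bar>s y - s x\<bar> * K"
    if "y \<noteq> x" for y
  proof -
    have "s y *\<^sub>R f y - s x *\<^sub>R f x - s x *\<^sub>R f' (y - x) =
      s y *\<^sub>R (f y - f x - f' (y - x)) + (s y - s x) *\<^sub>R f' (y - x)"
      by (simp add: f(2) algebra_simps)
    then have "norm (s y *\<^sub>R f y - s x *\<^sub>R f x - s x *\<^sub>R f' (y - x)) \<le>
      \<bar>s y\<bar> * norm (f y - f x - f' (y - x)) + \<bar>s y - s x\<bar> * norm (f' (y - x))"
      using norm_triangle_ineq[of "s y *\<^sub>R (f y - f x - f' (y - x))" "(s y - s x) *\<^sub>R f' (y - x)"] by simp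
    also have "\<dots> \<le> \<bar>s y\<bar> * norm (f y - f x - f' (y - x)) + \<bar>s y - s x\<bar> * (norm (y - x) * K)"
      by (intro add_left_mono mult_left_mono K) auto
    finally show ?thesis using that by (simp add: field_simps)
  qed
  then have "\<forall>\<^sub>F y in at x. norm (norm (s y *\<^sub>R f y - s x *\<^sub>R f x - s x *\<^sub>R f' (y - x)) / norm (y - x))
      \<le> \<bar>s y\<bar> * ?r y + \<bar>s y - s x\<bar> * K"
    by (auto simp: eventually_at_filter)
  moreover have "((\<lambda>y. \<bar>s y\<bar> * ?r y + \<bar>s y - s x\<bar> * K) \<longlongrightarrow> \<bar>s x\<bar> * 0 + \<bar>s x - s x\<bar> * K) (at x)"
    by (intro tendsto_add tendsto_mult s1 r tendsto_const)
  then have "((\<lambda>y. \<bar>s y\<bar> * ?r y + \<bar>s y - s x\<bar> * K) \<longlongrightarrow> 0) (at x)" by simp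
  ultimately show "((\<lambda>y. norm (s y *\<^sub>R f y - s x *\<^sub>R f x - s x *\<^sub>R f' (y - x)) / norm (y - x)) \<longlongrightarrow> 0) (at x)"
    by (rule Lim_null_comparison)
qed

text \<open>The solution satisfies w y = L (b y) - L ((A y - A x)(w y)). On the right, w occurs only
  as a factor of functions that vanish at x, so its continuity is enough.\<close>

lemma differentiable_linear_solve:
  fixes A :: "'a::real_normed_vector \<Rightarrow> 'b::euclidean_space \<Rightarrow> 'b"
  assumes S: "open S" "x \<in> S"
    and A: "\<And>y. y \<in> S \<Longrightarrow> linear (A y)" "inj (A x)" "\<And>i. (\<lambda>y. A y i) differentiable (at x)"
    and b: "b differentiable (at x)" and w: "\<And>y. y \<in> S \<Longrightarrow> A y (w y) = b y"
  shows "w differentiable (at x)"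
proof -
  have "isCont (\<lambda>y. A y i) x" "isCont b x" for i
    by (auto intro!: differentiable_imp_continuous_within A(3) b)
  then have "isCont w x" using continuous_linear_solve[where A=A and b=b and w=w, OF S A(1,2)] w by blast
  then have wi: "isCont (\<lambda>y. w y \<bullet> i) x" for i by (intro continuous_intros)
  obtain L where L: "linear L" "\<And>v. L (A x v) = v"
    using linear_injective_left_inverse[OF A(1)[OF S(2)] A(2)] by (auto simp: fun_eq_iff)
  have bL: "bounded_linear L" using L(1) linear_conv_bounded_linear by blast
  have "(\<lambda>y. (w y \<bullet> i) *\<^sub>R L (A y i - A x i)) differentiable (at x)" for i
    unfolding differentiable_def
    by (rule exI, rule has_derivative_scaleR_vanishing[OF bounded_linear.has_derivative[OF bL
          has_derivative_diff[OF fder_works[OF A(3)[of i]] has_derivative_const]] _ wi])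
       (simp add: linear_0[OF L(1)])
  moreover have "(\<lambda>y. L (b y)) differentiable (at x)"
    using b unfolding differentiable_def by (auto intro!: bounded_linear.has_derivative[OF bL])
  ultimately have "(\<lambda>y. L (b y) - (\<Sum>i\<in>Basis. (w y \<bullet> i) *\<^sub>R L (A y i - A x i))) differentiable (at x)"
    by (intro differentiable_diff differentiable_sum) auto
  moreover have "w y = L (b y) - (\<Sum>i\<in>Basis. (w y \<bullet> i) *\<^sub>R L (A y i - A x i))" if "y \<in> S" for y
  proof -
    have "(\<Sum>i\<in>Basis. (w y \<bullet> i) *\<^sub>R L (A y i - A x i)) = L (A y (w y) - A x (w y))"
      by (simp add: linear_sum_basis[OF A(1)[OF that], of "w y"] linear_sum_basis[OF A(1)[OF S(2)], of "w y"]
         linear_diff[OF L(1)] linear_sum[OF L(1)] linear_scale[OF L(1)] scaleR_diff_right sum_subtractf)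
    then show ?thesis using w[OF that] by (simp add: linear_diff[OF L(1)] L(2))
  qed
  ultimately show ?thesis by (subst differentiable_cong_open[OF S]) auto
qed

text \<open>Differentiating A w = b shows that \<open>fder w x v\<close> solves a system with the
  same operator A and a right side of one order less. Hence b and w are arbitrary in the induction
  and A is fixed.\<close>

lemma diff_order_on_linear_solve:
  fixes A :: "'a::euclidean_space \<Rightarrow> 'b::euclidean_space \<Rightarrow> 'b"
  assumes S: "open S" and A: "\<And>x. x \<in> S \<Longrightarrow> linear (A x)" "\<And>x. x \<in> S \<Longrightarrow> inj (A x)"
    and "\<And>i. diff_order_on k S (\<lambda>x. A x i)" "diff_order_on k S b" "\<And>x. x \<in> S \<Longrightarrow> A x (w x) = b x"
  shows "diff_order_on k S w"
  using assms(4-6)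
proof (induction k arbitrary: b w)
  case 0
  have "isCont w x" if "x \<in> S" for x
    using continuous_linear_solve[where A=A and b=b and w=w, OF S that A(1) A(2)[OF that]] 0 that S
    by (auto simp: continuous_on_eq_continuous_at)
  then show ?case by (simp add: continuous_at_imp_continuous_on)
next
  case (Suc k)
  have Ad: "(\<lambda>y. A y i) differentiable (at x)" and bd: "b differentiable (at x)" if "x \<in> S" for x i
    using Suc.prems(1)[of i] Suc.prems(2) that by auto
  have wd: "w differentiable (at x)" if "x \<in> S" for x
    using differentiable_linear_solve[where A=A and b=b and w=w, OF S that A(1) A(2)[OF that] Ad[OF that] bd[OF that]]
      Suc.prems(3) by blast
  have Ak: "diff_order_on k S (\<lambda>x. A x i)" for i by (rule diff_order_on_Suc_imp[OF Suc.prems(1)])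
  have bk: "diff_order_on k S b" by (rule diff_order_on_Suc_imp[OF Suc.prems(2)])
  \<comment> \<open>The right side of the differentiated system contains w itself, which therefore
    needs order k beforehand.\<close>
  have wk: "diff_order_on k S w" by (rule Suc.IH[OF Ak bk Suc.prems(3)])
  have eq: "A x (fder w x v) = fder b x v + (- 1) *\<^sub>R (\<Sum>i\<in>Basis. (w x \<bullet> i) *\<^sub>R fder (\<lambda>y. A y i) x v)"
    if x: "x \<in> S" for x v
  proof -
    have "((\<lambda>y. \<Sum>i\<in>Basis. (w y \<bullet> i) *\<^sub>R A y i) has_derivative
      (\<lambda>v. \<Sum>i\<in>Basis. (w x \<bullet> i) *\<^sub>R fder (\<lambda>y. A y i) x v + (fder w x v \<bullet> i) *\<^sub>R A x i)) (at x)"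
      by (intro has_derivative_sum has_derivative_scaleR has_derivative_inner_left fder_works wd Ad x)
    then have "fder (\<lambda>y. \<Sum>i\<in>Basis. (w y \<bullet> i) *\<^sub>R A y i) x v =
      (\<Sum>i\<in>Basis. (w x \<bullet> i) *\<^sub>R fder (\<lambda>y. A y i) x v) + A x (fder w x v)"
      by (simp add: has_derivative_imp_fder sum.distrib linear_sum_basis[OF A(1)[OF x], of "fder w x v"])
    moreover have "fder (\<lambda>y. \<Sum>i\<in>Basis. (w y \<bullet> i) *\<^sub>R A y i) x = fder b x"
      by (rule fder_cong_open[OF S x]) (simp add: Suc.prems(3)[symmetric] linear_sum_basis[OF A(1), symmetric])
    ultimately show ?thesis by (simp add: algebra_simps)
  qed
  have "diff_order_on k S (\<lambda>x. fder w x v)" for v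
  proof (rule Suc.IH[OF Ak _ eq])
    show "diff_order_on k S (\<lambda>x. fder b x v + (- 1) *\<^sub>R (\<Sum>i\<in>Basis. (w x \<bullet> i) *\<^sub>R fder (\<lambda>y. A y i) x v))"
      using Suc.prems(1,2)
      by (intro diff_order_on_add diff_order_on_sum diff_order_on_bilinear[OF S bounded_bilinear_scaleR]
          diff_order_on_bilinear[OF S bounded_bilinear_inner] diff_order_on_const wk S) auto
  qed
  then show ?case using wd by simp
qed

lemma smooth_on_linear_solve:
  fixes A :: "'a::euclidean_space \<Rightarrow> 'b::euclidean_space \<Rightarrow> 'b"
  assumes "open S" and "\<And>x. x \<in> S \<Longrightarrow> linear (A x)" "\<And>x. x \<in> S \<Longrightarrow> inj (A x)"
    and "\<And>i. smooth_on S (\<lambda>x. A x i)" "smooth_on S b" "\<And>x. x \<in> S \<Longrightarrow> A x (w x) = b x"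
  shows "smooth_on S w"
  unfolding smooth_on_def
proof
  show "diff_order_on k S w" for k
    by (rule diff_order_on_linear_solve[OF assms(1-3) _ _ assms(6)])
       (use assms(4,5) in \<open>auto simp: smooth_on_def\<close>)
qed

section \<open>Riemannian geometry in coordinates\<close>

lemma isCont_open_preimage:
  assumes "isCont f x" "open S" "f x \<in> S"
  shows "\<exists>T. open T \<and> x \<in> T \<and> (\<forall>y\<in>T. f y \<in> S)"
  using continuous_at_open[THEN iffD1, OF assms(1), rule_format, of S] assms(2,3) by auto

text \<open>The product rule for a matrix field J along f applied to K. Differentiability of J is
  stated for each fixed vector, which avoids a normed space of linear maps; expanding K in the basis
  reduces the claim to products with scalars.\<close>

lemma has_derivative_linear_family:
  fixes J :: "'e::real_normed_vector \<Rightarrow> 'a::euclidean_space \<Rightarrow> 'b::real_normed_vector"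
  assumes S: "open S" "f x \<in> S" and J: "\<And>y. y \<in> S \<Longrightarrow> linear (J y)"
    "\<And>v. (\<lambda>y. J y v) differentiable (at (f x))"
    and f: "(f has_derivative f') (at x)" and K: "(K has_derivative K') (at x)"
  shows "((\<lambda>x. J (f x) (K x)) has_derivative
    (\<lambda>h. fder (\<lambda>y. J y (K x)) (f x) (f' h) + J (f x) (K' h))) (at x)"
proof -
  have sum: "fder (\<lambda>y. J y v) (f x) u = (\<Sum>i\<in>Basis. (v \<bullet> i) *\<^sub>R fder (\<lambda>y. J y i) (f x) u)" for u v
  proof -
    have "fder (\<lambda>y. J y v) (f x) = fder (\<lambda>y. \<Sum>i\<in>Basis. (v \<bullet> i) *\<^sub>R J y i) (f x)"
      by (rule fder_cong_open[OF S]) (rule linear_sum_basis[OF J(1)])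
    moreover have "((\<lambda>y. \<Sum>i\<in>Basis. (v \<bullet> i) *\<^sub>R J y i) has_derivative
        (\<lambda>u. \<Sum>i\<in>Basis. (v \<bullet> i) *\<^sub>R fder (\<lambda>y. J y i) (f x) u)) (at (f x))"
      by (intro has_derivative_sum has_derivative_scaleR_right fder_works J(2))
    ultimately show ?thesis by (simp add: has_derivative_imp_fder)
  qed
  have "((\<lambda>x. \<Sum>i\<in>Basis. (K x \<bullet> i) *\<^sub>R J (f x) i) has_derivative
    (\<lambda>h. \<Sum>i\<in>Basis. (K x \<bullet> i) *\<^sub>R fder (\<lambda>y. J y i) (f x) (f' h) + (K' h \<bullet> i) *\<^sub>R J (f x) i)) (at x)"
    by (intro has_derivative_sum has_derivative_scaleR has_derivative_inner_left K
        has_derivative_compose[OF f fder_works[OF J(2)]])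
  also have "(\<lambda>h. \<Sum>i\<in>Basis. (K x \<bullet> i) *\<^sub>R fder (\<lambda>y. J y i) (f x) (f' h) + (K' h \<bullet> i) *\<^sub>R J (f x) i) =
    (\<lambda>h. fder (\<lambda>y. J y (K x)) (f x) (f' h) + J (f x) (K' h))"
    by (simp only: sum.distrib sum[of "K x"] linear_sum_basis[OF J(1)[OF S(2)], of "K' h" for h])
  finally have D: "((\<lambda>x. \<Sum>i\<in>Basis. (K x \<bullet> i) *\<^sub>R J (f x) i) has_derivative
    (\<lambda>h. fder (\<lambda>y. J y (K x)) (f x) (f' h) + J (f x) (K' h))) (at x)" .
  obtain T where "open T" "x \<in> T" "\<forall>y\<in>T. f y \<in> S"
    using isCont_open_preimage[OF has_derivative_continuous[OF f] S] by auto
  then have T: "open T" "x \<in> T" "\<And>y. y \<in> T \<Longrightarrow> f y \<in> S" by auto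
  show ?thesis
    by (rule has_derivative_transform_within_open[OF D T(1,2)])
       (simp add: linear_sum_basis[OF J(1)[OF T(3)], symmetric])
qed

lemma has_derivative_bilinear_family:
  fixes G :: "'e::real_normed_vector \<Rightarrow> 'a::euclidean_space \<Rightarrow> 'b::euclidean_space \<Rightarrow> 'c::real_normed_vector"
    and f :: "'x::real_normed_vector \<Rightarrow> 'e"
  assumes S: "open S" "f x \<in> S" and G: "\<And>y. y \<in> S \<Longrightarrow> bilinear (G y)"
    "\<And>u v. (\<lambda>y. G y u v) differentiable (at (f x))"
    and f: "(f has_derivative f') (at x)" and K: "(K has_derivative K') (at x)"
    and L: "(L has_derivative L') (at x)"
  shows "((\<lambda>x. G (f x) (K x) (L x)) has_derivative
    (\<lambda>h. fder (\<lambda>y. G y (K x) (L x)) (f x) (f' h) + G (f x) (K' h) (L x) + G (f x) (K x) (L' h))) (at x)"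
proof -
  obtain T where "open T" "x \<in> T" "\<forall>y\<in>T. f y \<in> S"
    using isCont_open_preimage[OF has_derivative_continuous[OF f] S] by auto
  then have T: "open T" "x \<in> T" "\<And>y. y \<in> T \<Longrightarrow> f y \<in> S" by auto
  have 1: "((\<lambda>x. G (f x) (K x) v) has_derivative
    (\<lambda>h. fder (\<lambda>y. G y (K x) v) (f x) (f' h) + G (f x) (K' h) v)) (at x)" for v
    by (rule has_derivative_linear_family[where J="\<lambda>y u. G y u v", OF S _ G(2) f K])
       (use G(1) in \<open>simp add: bilinear_def\<close>)
  \<comment> \<open>The first argument is absorbed into the linear family
    \<open>G (f y) (K y)\<close> over the identity map; its derivative for a fixed second argument
    is given by \<open>1\<close>.\<close>
  have "((\<lambda>z. G (f z) (K z) (L z)) has_derivative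
    (\<lambda>h. fder (\<lambda>y. G (f y) (K y) (L x)) x h + G (f x) (K x) (L' h))) (at x)"
    by (rule has_derivative_linear_family[where J="\<lambda>y v. G (f y) (K y) v" and f="\<lambda>y. y", OF T(1,2) _ _ has_derivative_ident L])
       (use G(1)[OF T(3)] in \<open>auto simp: bilinear_def differentiable_def intro!: exI 1\<close>)
  then show ?thesis by (simp add: has_derivative_imp_fder[OF 1])
qed

text \<open>Six transpositions, alternately of the first two and of the last two arguments, lead
  back to T X Y Z and change the sign three times. It yields both the uniqueness of the Levi-Civita
  connection and the comparison of M with M'; the predicate P lets the arguments be fields of a
  restricted kind.\<close>

lemma symmetric_antisymmetric_zero:
  fixes T :: "'a \<Rightarrow> 'a \<Rightarrow> 'a \<Rightarrow> real"
  assumes "\<And>X Y Z. P X \<Longrightarrow> P Y \<Longrightarrow> P Z \<Longrightarrow> T X Y Z = T Y X Z"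
    and "\<And>X Y Z. P X \<Longrightarrow> P Y \<Longrightarrow> P Z \<Longrightarrow> T X Y Z = - T X Z Y"
    and "P X" "P Y" "P Z"
  shows "T X Y Z = 0"
proof -
  have "T X Y Z = - T Y Z X" using assms(1)[of X Y Z] assms(2)[of Y X Z] assms(3-5) by simp
  also have "\<dots> = T Z X Y" using assms(1)[of Y Z X] assms(2)[of Z Y X] assms(3-5) by simp
  also have "\<dots> = - T X Y Z" using assms(1)[of Z X Y] assms(2)[of X Z Y] assms(3-5) by simp
  finally show ?thesis by simp
qed

section \<open>Koszul formula and covariant derivatives in one chart\<close>

definition koszul_form ::
  "('e::euclidean_space \<Rightarrow> 'e \<Rightarrow> 'e \<Rightarrow> real) \<Rightarrow> 'e \<Rightarrow> 'e \<Rightarrow> 'e \<Rightarrow> 'e \<Rightarrow> real"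
  where "koszul_form G x u v z =
    (fder (\<lambda>y. G y v z) x u + fder (\<lambda>y. G y u z) x v - fder (\<lambda>y. G y u v) x z) / 2"

text \<open>\<open>koszul_form\<close> is the Koszul formula for constant fields, whose brackets
  vanish, that is, the Christoffel symbol of the first kind. Here its index is raised; a suitable w
  exists by nondegeneracy, see \<open>represent\<close>.\<close>

definition christoffel ::
  "('e::euclidean_space \<Rightarrow> 'e \<Rightarrow> 'e \<Rightarrow> real) \<Rightarrow> 'e \<Rightarrow> 'e \<Rightarrow> 'e \<Rightarrow> 'e"
  where "christoffel G x u v = (SOME w. \<forall>z. G x w z = koszul_form G x u v z)"

text \<open>The connection pulled back by f, acting on fields along f. For the identity map it is
  the Levi-Civita connection itself.\<close>

definition cov_along ::
  "('e::euclidean_space \<Rightarrow> 'e \<Rightarrow> 'e \<Rightarrow> real) \<Rightarrow> ('a::real_normed_vector \<Rightarrow> 'e) \<Rightarrow> ('a \<Rightarrow> 'e) \<Rightarrow> 'a \<Rightarrow> 'a \<Rightarrow> 'e"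
  where "cov_along G f Y x h = fder Y x h + christoffel G (f x) (fder f x h) (Y x)"

text \<open>Coordinate form of the covariant derivative of J: the partial derivative of its matrix
  in the direction u plus the commutator of the Christoffel matrix of u with J.\<close>

definition cov_endo ::
  "('e::euclidean_space \<Rightarrow> 'e \<Rightarrow> 'e \<Rightarrow> real) \<Rightarrow> ('e \<Rightarrow> 'e \<Rightarrow> 'e) \<Rightarrow> 'e \<Rightarrow> 'e \<Rightarrow> 'e \<Rightarrow> 'e"
  where "cov_endo G J y u v =
    fder (\<lambda>y. J y v) y u + christoffel G y u (J y v) - J y (christoffel G y u v)"

locale local_metric =
  fixes S :: "'e::euclidean_space set" and G :: "'e \<Rightarrow> 'e \<Rightarrow> 'e \<Rightarrow> real"
  assumes open_S: "open S"
    and bilinear: "x \<in> S \<Longrightarrow> bilinear (G x)"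
    and sym: "x \<in> S \<Longrightarrow> G x u v = G x v u"
    and nondegenerate: "x \<in> S \<Longrightarrow> (\<And>v. G x u v = 0) \<Longrightarrow> u = 0"
    and smooth: "smooth_on S (\<lambda>x. G x u v)"
begin

lemma differentiable: "x \<in> S \<Longrightarrow> (\<lambda>x. G x u v) differentiable (at x)"
  using smooth by (rule smooth_on_imp_differentiable)

lemma linear_left: "x \<in> S \<Longrightarrow> linear (\<lambda>u. G x u v)"
  and linear_right: "x \<in> S \<Longrightarrow> linear (G x u)"
  using bilinear by (auto simp: bilinear_def)

lemmas left_simps = linear_add[OF linear_left] linear_diff[OF linear_left] linear_scale[OF linear_left]
    linear_neg[OF linear_left] linear_sum[OF linear_left] linear_0[OF linear_left]
  and right_simps = linear_add[OF linear_right] linear_diff[OF linear_right] linear_scale[OF linear_right]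
    linear_neg[OF linear_right] linear_sum[OF linear_right] linear_0[OF linear_right]

lemma eqI: "x \<in> S \<Longrightarrow> (\<And>z. G x u z = G x v z) \<Longrightarrow> u = v"
  using nondegenerate[of x "u - v"] by (simp add: left_simps)

text \<open>Lowers the index by means of the Euclidean inner product. An equation for
  \<open>G x w\<close> thus becomes a linear system with an injective operator, to which
  \<open>smooth_on_linear_solve\<close> applies.\<close>

definition lower :: "'e \<Rightarrow> 'e \<Rightarrow> 'e"
  where "lower x w = (\<Sum>i\<in>Basis. G x w i *\<^sub>R i)"

lemma inner_lower: "x \<in> S \<Longrightarrow> lower x w \<bullet> z = G x w z"
  using linear_sum_basis[OF linear_right, of x w z]
  by (simp add: lower_def inner_sum_left inner_commute[of z] mult.commute)

lemma linear_lower: "x \<in> S \<Longrightarrow> linear (lower x)"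
  unfolding lower_def by (rule linearI) (simp_all add: left_simps scaleR_add_left sum.distrib scaleR_sum_right)

lemma inj_lower: "x \<in> S \<Longrightarrow> inj (lower x)"
  by (rule injI) (metis eqI inner_lower)

lemma represent:
  assumes "x \<in> S" "linear \<phi>"
  obtains w where "\<And>z. G x w z = \<phi> z"
proof -
  have "surj (lower x)"
    by (rule linear_injective_imp_surjective[OF linear_lower inj_lower]) (use assms in auto)
  then obtain w where "lower x w = (\<Sum>i\<in>Basis. \<phi> i *\<^sub>R i)" by (metis surjD)
  then have "G x w z = (\<Sum>i\<in>Basis. \<phi> i *\<^sub>R i) \<bullet> z" for z using inner_lower[OF assms(1)] by metis
  moreover have "(\<Sum>i\<in>Basis. \<phi> i *\<^sub>R i) \<bullet> z = \<phi> z" for z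
    using linear_sum_basis[OF assms(2), of z] by (simp add: inner_sum_left inner_commute[of z] mult.commute)
  ultimately show thesis by (intro that) simp
qed

lemma linear_fder_right:
  assumes "x \<in> S" shows "linear (\<lambda>v. fder (\<lambda>y. G y u v) x w)"
proof -
  have "((\<lambda>y. G y u (a *\<^sub>R v + b *\<^sub>R v')) has_derivative
      (\<lambda>w. a *\<^sub>R fder (\<lambda>y. G y u v) x w + b *\<^sub>R fder (\<lambda>y. G y u v') x w)) (at x)" for a b v v'
  proof (rule has_derivative_transform_within_open[OF _ open_S assms])
    show "((\<lambda>y. a *\<^sub>R G y u v + b *\<^sub>R G y u v') has_derivative
      (\<lambda>w. a *\<^sub>R fder (\<lambda>y. G y u v) x w + b *\<^sub>R fder (\<lambda>y. G y u v') x w)) (at x)"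
      by (intro has_derivative_add has_derivative_scaleR_right fder_works differentiable assms)
  qed (simp add: right_simps)
  from has_derivative_imp_fder[OF this]
  have *: "fder (\<lambda>y. G y u (a *\<^sub>R v + b *\<^sub>R v')) x w = a *\<^sub>R fder (\<lambda>y. G y u v) x w + b *\<^sub>R fder (\<lambda>y. G y u v') x w"
    for a b v v' by simp
  show ?thesis
    using *[of 1 _ 1] *[of _ _ 0] by (intro linearI) simp_all
qed

lemma fder_sym: "x \<in> S \<Longrightarrow> fder (\<lambda>y. G y u v) x w = fder (\<lambda>y. G y v u) x w"
  using fder_cong_open[OF open_S, of x "\<lambda>y. G y u v" "\<lambda>y. G y v u"] sym by simp

lemma linear_fder_left: "x \<in> S \<Longrightarrow> linear (\<lambda>u. fder (\<lambda>y. G y u v) x w)"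
  using linear_fder_right[of x v w] by (simp add: fder_sym)

lemma linear_fder: "x \<in> S \<Longrightarrow> linear (fder (\<lambda>y. G y u v) x)"
  by (rule linear_frechet_derivative[OF differentiable])

lemma linear_koszul_form:
  assumes "x \<in> S"
  shows "linear (koszul_form G x u v)" "linear (\<lambda>v. koszul_form G x u v z)" "linear (\<lambda>u. koszul_form G x u v z)"
proof -
  have *: "koszul_form G x u v = (\<lambda>z. (1/2) *\<^sub>R
      (fder (\<lambda>y. G y v z) x u + fder (\<lambda>y. G y u z) x v - fder (\<lambda>y. G y u v) x z))" for u v
    by (simp add: fun_eq_iff koszul_form_def)
  show "linear (koszul_form G x u v)" "linear (\<lambda>v. koszul_form G x u v z)" "linear (\<lambda>u. koszul_form G x u v z)"
    unfolding *
    by (intro linear_compose_scale_right linear_compose_add linear_compose_sub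
        linear_fder_left linear_fder_right linear_fder assms)+
qed

lemma christoffel: "x \<in> S \<Longrightarrow> G x (christoffel G x u v) z = koszul_form G x u v z"
  unfolding christoffel_def
  by (rule represent[OF _ linear_koszul_form(1)[of x u v]], assumption, assumption)
     (rule someI2[where P="\<lambda>w. \<forall>z. G x w z = koszul_form G x u v z"], auto)

lemma christoffel_sym: "x \<in> S \<Longrightarrow> christoffel G x u v = christoffel G x v u"
  by (rule eqI) (auto simp: christoffel koszul_form_def fder_sym)

lemma christoffel_metric:
  "x \<in> S \<Longrightarrow> fder (\<lambda>y. G y u v) x a = G x (christoffel G x a u) v + G x u (christoffel G x a v)"
  by (simp add: sym[of x u] christoffel koszul_form_def fder_sym[of x v u] field_simps)

lemma linear_christoffel:
  assumes "x \<in> S"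
  shows "linear (christoffel G x u)" "linear (\<lambda>u. christoffel G x u v)"
  by (auto intro!: linearI eqI[OF assms] simp: assms christoffel left_simps
      linear_add[OF linear_koszul_form(2)[OF assms]] linear_add[OF linear_koszul_form(3)[OF assms]]
      linear_scale[OF linear_koszul_form(2)[OF assms]] linear_scale[OF linear_koszul_form(3)[OF assms]])

text \<open>The Christoffel vector solves a linear system with smooth operator
  \<open>lower x\<close> and smooth right side, so the inverse of the metric is not written
  down.\<close>

lemma smooth_christoffel: "smooth_on S (\<lambda>x. christoffel G x u v)"
proof (rule smooth_on_linear_solve[OF open_S linear_lower inj_lower])
  show "smooth_on S (\<lambda>x. lower x i)" for i
    unfolding lower_def by (intro smooth_on_sum smooth_on_scaleR smooth smooth_on_const open_S)
  show "smooth_on S (\<lambda>x. \<Sum>i\<in>Basis. (((fder (\<lambda>y. G y v i) x u + fder (\<lambda>y. G y u i) x v) - fder (\<lambda>y. G y u v) x i) * (1/2)) *\<^sub>R i)"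
    by (intro smooth_on_sum smooth_on_scaleR smooth_on_mult smooth_on_diff smooth_on_add smooth_on_fder
        smooth smooth_on_const open_S)
  show "lower x (christoffel G x u v) = (\<Sum>i\<in>Basis. (((fder (\<lambda>y. G y v i) x u + fder (\<lambda>y. G y u i) x v) - fder (\<lambda>y. G y u v) x i) * (1/2)) *\<^sub>R i)"
    if "x \<in> S" for x using that by (simp add: lower_def christoffel koszul_form_def)
qed

lemma cov_along_metric:
  fixes f :: "'a::real_normed_vector \<Rightarrow> 'e"
  assumes "f x \<in> S" "f differentiable (at x)" "K differentiable (at x)" "L differentiable (at x)"
  shows "((\<lambda>x. G (f x) (K x) (L x)) has_derivative
    (\<lambda>h. G (f x) (cov_along G f K x h) (L x) + G (f x) (K x) (cov_along G f L x h))) (at x)"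
proof -
  have "((\<lambda>x. G (f x) (K x) (L x)) has_derivative
    (\<lambda>h. fder (\<lambda>y. G y (K x) (L x)) (f x) (fder f x h) + G (f x) (fder K x h) (L x) + G (f x) (K x) (fder L x h))) (at x)"
    by (rule has_derivative_bilinear_family[OF open_S assms(1) bilinear differentiable[OF assms(1)]
         fder_works[OF assms(2)] fder_works[OF assms(3)] fder_works[OF assms(4)]])
  then show ?thesis
    by (simp add: cov_along_def christoffel_metric assms(1) left_simps right_simps algebra_simps)
qed

text \<open>The second derivative of f and the Christoffel term are symmetric in X and Y and cancel.
  What is left is the differential of f applied to the coordinate bracket, for a map f that need not
  be a diffeomorphism.\<close>

lemma cov_along_torsion:
  fixes f :: "'a::euclidean_space \<Rightarrow> 'e"
  assumes "open W" "x \<in> W" "smooth_on W f" "f x \<in> S" "X differentiable (at x)" "Y differentiable (at x)"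
  shows "cov_along G f (\<lambda>x. fder f x (Y x)) x (X x) - cov_along G f (\<lambda>x. fder f x (X x)) x (Y x) =
    fder f x (fder Y x (X x) - fder X x (Y x))"
proof -
  have d: "fder (\<lambda>y. fder f y (Y y)) x h = fder (\<lambda>y. fder f y (Y x)) x h + fder f x (fder Y x h)"
    if "Y differentiable (at x)" for Y h
    by (subst has_derivative_imp_fder[OF has_derivative_linear_family[where f="\<lambda>y. y" and J="fder f",
          OF assms(1,2) _ _ has_derivative_ident fder_works[OF that]]])
       (auto intro!: linear_frechet_derivative smooth_on_imp_differentiable[OF assms(3)]
         smooth_on_imp_differentiable[OF smooth_on_fder[OF assms(3)] assms(2)])
  have lin: "linear (fder f x)"
    by (rule linear_frechet_derivative[OF smooth_on_imp_differentiable[OF assms(3,2)]])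
  show ?thesis
    by (simp add: cov_along_def d[OF assms(5)] d[OF assms(6)] linear_diff[OF lin]
       christoffel_sym[OF assms(4), of "fder f x (X x)" "fder f x (Y x)"]
       smooth_on_fder_commute[OF assms(1,3,2), of "X x" "Y x"])
qed

lemma cov_along_endo:
  fixes f :: "'a::euclidean_space \<Rightarrow> 'e"
  assumes "f x \<in> S" "f differentiable (at x)" "K differentiable (at x)"
    "open T" "f x \<in> T" "\<And>y. y \<in> T \<Longrightarrow> linear (J y)" "\<And>v. (\<lambda>y. J y v) differentiable (at (f x))"
  shows "((\<lambda>x. J (f x) (K x)) has_derivative
      (\<lambda>h. fder (\<lambda>y. J y (K x)) (f x) (fder f x h) + J (f x) (fder K x h))) (at x)"
    and "cov_along G f (\<lambda>x. J (f x) (K x)) x h =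
      cov_endo G J (f x) (fder f x h) (K x) + J (f x) (cov_along G f K x h)"
proof -
  show *: "((\<lambda>x. J (f x) (K x)) has_derivative
      (\<lambda>h. fder (\<lambda>y. J y (K x)) (f x) (fder f x h) + J (f x) (fder K x h))) (at x)"
    by (rule has_derivative_linear_family[OF assms(4-7) fder_works[OF assms(2)] fder_works[OF assms(3)]])
  show "cov_along G f (\<lambda>x. J (f x) (K x)) x h =
      cov_endo G J (f x) (fder f x h) (K x) + J (f x) (cov_along G f K x h)"
    by (simp add: cov_along_def cov_endo_def has_derivative_imp_fder[OF *] linear_add[OF assms(6)[OF assms(5)]])
qed

lemma christoffel_sum_basis:
  assumes "x \<in> S"
  shows "christoffel G x u v = (\<Sum>i\<in>Basis. (u \<bullet> i) *\<^sub>R (\<Sum>j\<in>Basis. (v \<bullet> j) *\<^sub>R christoffel G x i j))"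
  using linear_sum_basis[OF linear_christoffel(2)[OF assms], of u v]
  by (simp add: linear_sum_basis[OF linear_christoffel(1)[OF assms], of _ v])

lemma cov_along_id:
  "cov_along G (\<lambda>x. x) Y x h = fder Y x h + christoffel G x h (Y x)"
  by (simp add: cov_along_def)

lemma smooth_cov_along_id:
  assumes "open V" "V \<subseteq> S" "smooth_on V X" "smooth_on V Y"
  shows "smooth_on V (\<lambda>x. cov_along G (\<lambda>x. x) Y x (X x))"
proof -
  have "smooth_on V (\<lambda>x. fder Y x (X x) +
      (\<Sum>i\<in>Basis. (X x \<bullet> i) *\<^sub>R (\<Sum>j\<in>Basis. (Y x \<bullet> j) *\<^sub>R christoffel G x i j)))"
    by (intro smooth_on_add smooth_on_fder_apply smooth_on_sum smooth_on_scaleR smooth_on_inner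
        smooth_on_const smooth_on_subset[OF smooth_christoffel assms(2)] assms(1,3,4))
  moreover have "cov_along G (\<lambda>x. x) Y x (X x) = fder Y x (X x) +
      (\<Sum>i\<in>Basis. (X x \<bullet> i) *\<^sub>R (\<Sum>j\<in>Basis. (Y x \<bullet> j) *\<^sub>R christoffel G x i j))" if "x \<in> V" for x
    using that assms(2) by (auto simp: cov_along_id christoffel_sum_basis[of x "X x" "Y x"])
  ultimately show ?thesis by (subst smooth_on_cong[OF assms(1)]) auto
qed

lemma linear_cov_endo:
  assumes x: "x \<in> S" and T: "open T" "x \<in> T" "\<And>y. y \<in> T \<Longrightarrow> linear (J y)"
    "\<And>v. (\<lambda>y. J y v) differentiable (at x)"
  shows "linear (cov_endo G J x u)"
proof -
  have *: "((\<lambda>y. J y (v + a *\<^sub>R w)) has_derivative (\<lambda>h. fder (\<lambda>y. J y v) x h + a *\<^sub>R fder (\<lambda>y. J y w) x h)) (at x)"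
    for v w a
  proof (rule has_derivative_transform_within_open[OF _ T(1,2)])
    show "((\<lambda>y. J y v + a *\<^sub>R J y w) has_derivative (\<lambda>h. fder (\<lambda>y. J y v) x h + a *\<^sub>R fder (\<lambda>y. J y w) x h)) (at x)"
      by (intro has_derivative_add has_derivative_scaleR_right fder_works T(4))
  qed (simp add: linear_add[OF T(3)] linear_scale[OF T(3)])
  have lin: "cov_endo G J x u (v + a *\<^sub>R w) = cov_endo G J x u v + a *\<^sub>R cov_endo G J x u w" for v w a
    by (simp add: cov_endo_def has_derivative_imp_fder[OF *] linear_add[OF T(3)[OF T(2)]] linear_scale[OF T(3)[OF T(2)]]
      linear_add[OF linear_christoffel(1)[OF x]] linear_scale[OF linear_christoffel(1)[OF x]] algebra_simps)
  have "cov_endo G J x u 0 = 0" using lin[of 0 1 0] by simp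
  then show ?thesis
    by (intro linearI) (use lin[of _ 1] lin[of 0] in simp_all)
qed

end

section \<open>Comparison of the derivatives along \<iota> and along \<pi>\<close>

lemma differentiable_fder_apply:
  fixes f :: "'a::euclidean_space \<Rightarrow> 'b::real_normed_vector"
  assumes "open W" "x \<in> W" "smooth_on W f" "Y differentiable (at x)"
  shows "(\<lambda>y. fder f y (Y y)) differentiable (at x)"
  unfolding differentiable_def
  by (rule exI, rule has_derivative_linear_family[where f="\<lambda>y. y" and J="fder f",
        OF assms(1,2) _ _ has_derivative_ident fder_works[OF assms(4)]])
     (auto intro!: linear_frechet_derivative smooth_on_imp_differentiable[OF assms(3)]
         smooth_on_imp_differentiable[OF smooth_on_fder[OF assms(3)] assms(2)])

text \<open>The maps from N to M and to M' in coordinates, with a common domain W in a chart of N.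
  Whatever gets differentiated at x is required on all of W; the remaining conditions, surjectivity
  on D and orthogonality of the kernel of d\<pi> to D, are required at x.\<close>

locale local_submersion = M: local_metric S G + M': local_metric S' G'
  for S :: "'e::euclidean_space set" and G and S' :: "'h::euclidean_space set" and G' +
  fixes W :: "'f::euclidean_space set" and x :: 'f and \<iota> :: "'f \<Rightarrow> 'e" and \<pi> :: "'f \<Rightarrow> 'h"
    and D :: "'f \<Rightarrow> 'f set"
  assumes W: "open W" "x \<in> W" and smooth: "smooth_on W \<iota>" "smooth_on W \<pi>"
    and image: "\<iota> ` W \<subseteq> S" "\<pi> ` W \<subseteq> S'"
    and extend: "u \<in> D x \<Longrightarrow> \<exists>X. X x = u \<and> X differentiable (at x) \<and> (\<forall>y\<in>W. X y \<in> D y)"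
    and isometry: "y \<in> W \<Longrightarrow> u \<in> D y \<Longrightarrow> v \<in> D y \<Longrightarrow>
      G (\<iota> y) (fder \<iota> y u) (fder \<iota> y v) = G' (\<pi> y) (fder \<pi> y u) (fder \<pi> y v)"
    and onto: "\<exists>v\<in>D x. fder \<pi> x v = u'"
    and vertical: "fder \<pi> x v = 0 \<Longrightarrow> u \<in> D x \<Longrightarrow> G (\<iota> x) (fder \<iota> x v) (fder \<iota> x u) = 0"
begin

definition horizontal :: "('f \<Rightarrow> 'f) \<Rightarrow> bool"
  where "horizontal X \<longleftrightarrow> X differentiable (at x) \<and> (\<forall>y\<in>W. X y \<in> D y)"

lemma inS: "\<iota> x \<in> S" "\<pi> x \<in> S'"
  using image W by auto

lemma diffable: "\<iota> differentiable (at x)" "\<pi> differentiable (at x)"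
  using smooth W by (auto intro: smooth_on_imp_differentiable)

lemma linear_fder: "linear (fder \<iota> x)" "linear (fder \<pi> x)"
  using diffable by (auto intro: linear_frechet_derivative)

text \<open>It suffices that one argument lies in D: v differs from a vector of D with the same
  image under d\<pi> by a vertical vector, which is orthogonal to u. This form is needed for
  brackets, which leave D.\<close>

lemma isometry_right:
  assumes "u \<in> D x"
  shows "G (\<iota> x) (fder \<iota> x v) (fder \<iota> x u) = G' (\<pi> x) (fder \<pi> x v) (fder \<pi> x u)"
proof -
  obtain v' where v': "v' \<in> D x" "fder \<pi> x v' = fder \<pi> x v" using onto by blast
  have "fder \<pi> x (v - v') = 0" by (simp add: linear_diff[OF linear_fder(2)] v')
  from vertical[OF this assms] have "G (\<iota> x) (fder \<iota> x v) (fder \<iota> x u) = G (\<iota> x) (fder \<iota> x v') (fder \<iota> x u)"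
    by (simp add: linear_diff[OF linear_fder(1)] M.left_simps inS)
  then show ?thesis using isometry[OF W(2) v'(1) assms] v'(2) by simp
qed

text \<open>Both sides are the derivative at x of the common function in \<open>eq\<close>, computed
  by compatibility with the respective metric.\<close>

lemma cov_along_isometry_add:
  assumes K: "K differentiable (at x)" "K' differentiable (at x)"
      "L differentiable (at x)" "L' differentiable (at x)"
    and eq: "\<And>y. y \<in> W \<Longrightarrow> G (\<iota> y) (K y) (L y) = G' (\<pi> y) (K' y) (L' y)"
  shows "G (\<iota> x) (cov_along G \<iota> K x h) (L x) + G (\<iota> x) (K x) (cov_along G \<iota> L x h) =
    G' (\<pi> x) (cov_along G' \<pi> K' x h) (L' x) + G' (\<pi> x) (K' x) (cov_along G' \<pi> L' x h)"
proof -
  have "fder (\<lambda>y. G (\<iota> y) (K y) (L y)) x h = fder (\<lambda>y. G' (\<pi> y) (K' y) (L' y)) x h"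
    by (subst fder_cong_open[OF W]) (auto intro: eq)
  then show ?thesis
    by (simp add: has_derivative_imp_fder[OF M.cov_along_metric[OF inS(1) diffable(1) K(1,3)]]
      has_derivative_imp_fder[OF M'.cov_along_metric[OF inS(2) diffable(2) K(2,4)]])
qed

lemma cov_along_projection_fields:
  assumes "horizontal X" "horizontal Y" "horizontal Z"
  shows "G (\<iota> x) (cov_along G \<iota> (\<lambda>y. fder \<iota> y (Y y)) x (X x)) (fder \<iota> x (Z x)) =
    G' (\<pi> x) (cov_along G' \<pi> (\<lambda>y. fder \<pi> y (Y y)) x (X x)) (fder \<pi> x (Z x))"
proof -
  let ?T = "\<lambda>X Y Z. G (\<iota> x) (cov_along G \<iota> (\<lambda>y. fder \<iota> y (Y y)) x (X x)) (fder \<iota> x (Z x)) -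
    G' (\<pi> x) (cov_along G' \<pi> (\<lambda>y. fder \<pi> y (Y y)) x (X x)) (fder \<pi> x (Z x))"
  have "?T X Y Z = 0"
  proof (rule symmetric_antisymmetric_zero[where P=horizontal and T="?T", OF _ _ assms])
    fix X Y Z assume h: "horizontal X" "horizontal Y" "horizontal Z"
    have d: "X differentiable (at x)" "Y differentiable (at x)" "Z differentiable (at x)"
      and Z: "Z x \<in> D x" using h W unfolding horizontal_def by auto
    \<comment> \<open>By the torsion identity both differences are images of one vector, the
      coordinate bracket of X and Y, and they are tested against the vector Z x of D.\<close>
    have "G (\<iota> x) (cov_along G \<iota> (\<lambda>y. fder \<iota> y (Y y)) x (X x) - cov_along G \<iota> (\<lambda>y. fder \<iota> y (X y)) x (Y x)) (fder \<iota> x (Z x))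
      = G' (\<pi> x) (cov_along G' \<pi> (\<lambda>y. fder \<pi> y (Y y)) x (X x) - cov_along G' \<pi> (\<lambda>y. fder \<pi> y (X y)) x (Y x)) (fder \<pi> x (Z x))"
      unfolding M.cov_along_torsion[OF W smooth(1) inS(1) d(1,2)] M'.cov_along_torsion[OF W smooth(2) inS(2) d(1,2)]
      by (rule isometry_right[OF Z])
    then show "?T X Y Z = ?T Y X Z" by (simp add: M.left_simps M'.left_simps inS)
    have "G (\<iota> y) (fder \<iota> y (Y y)) (fder \<iota> y (Z y)) = G' (\<pi> y) (fder \<pi> y (Y y)) (fder \<pi> y (Z y))" if "y \<in> W" for y
      using isometry[OF that] h that unfolding horizontal_def by auto
    from cov_along_isometry_add[OF _ _ _ _ this, of "X x"]
    show "?T X Y Z = - ?T X Z Y"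
      using d W smooth by (simp add: differentiable_fder_apply[of W]
          M.sym[OF inS(1), of "fder \<iota> x (Y x)"] M'.sym[OF inS(2), of "fder \<pi> x (Y x)"])
  qed
  then show ?thesis by simp
qed

text \<open>\<open>K\<close> need not be given as \<open>d\<iota> Y\<close> for a differentiable section \<open>Y\<close> of \<open>D\<close>; compatibility with
  the metrics reduces this case to that of such sections, since only \<open>K x\<close> has to be extended.\<close>

lemma cov_along_projection:
  assumes "horizontal X" "horizontal Z" "K differentiable (at x)" "K' differentiable (at x)"
    and K: "\<And>y. y \<in> W \<Longrightarrow> \<exists>v\<in>D y. K y = fder \<iota> y v \<and> K' y = fder \<pi> y v"
  shows "G (\<iota> x) (cov_along G \<iota> K x (X x)) (fder \<iota> x (Z x)) =
    G' (\<pi> x) (cov_along G' \<pi> K' x (X x)) (fder \<pi> x (Z x))"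
proof -
  obtain v where v: "v \<in> D x" "K x = fder \<iota> x v" "K' x = fder \<pi> x v" using K[OF W(2)] by blast
  obtain V where V: "V x = v" "horizontal V" using extend[OF v(1)] unfolding horizontal_def by blast
  have d: "(\<lambda>y. fder \<iota> y (Z y)) differentiable (at x)" "(\<lambda>y. fder \<pi> y (Z y)) differentiable (at x)"
    using assms(2) W smooth unfolding horizontal_def by (auto intro: differentiable_fder_apply[of W])
  have "G (\<iota> y) (K y) (fder \<iota> y (Z y)) = G' (\<pi> y) (K' y) (fder \<pi> y (Z y))" if "y \<in> W" for y
    using K[OF that] isometry[OF that] assms(2) that unfolding horizontal_def by auto
  from cov_along_isometry_add[OF assms(3,4) d this, of "X x"]
    cov_along_projection_fields[OF assms(1,2) V(2)]
  show ?thesis by (simp add: V(1) v M.sym[OF inS(1), of "fder \<iota> x v"] M'.sym[OF inS(2), of "fder \<pi> x v"])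
qed

text \<open>\<open>cov_along_projection\<close> compares the derivatives of J d\<iota> Y and J'
  d\<pi> Y. By \<open>cov_along_endo\<close> each splits into the derivative of the endomorphism
  applied to Y and the endomorphism applied to the derivative of Y. The latter parts agree when
  tested against Z, so the former do.\<close>

lemma cov_endo_projection:
  fixes J :: "'e \<Rightarrow> 'e \<Rightarrow> 'e" and J' :: "'h \<Rightarrow> 'h \<Rightarrow> 'h" and Q :: "'i::finite \<Rightarrow> 'e \<Rightarrow> 'e"
  assumes T: "open T" "\<iota> x \<in> T" "\<And>y. y \<in> T \<Longrightarrow> linear (J y)" "\<And>v. (\<lambda>y. J y v) differentiable (at (\<iota> x))"
    and T': "open T'" "\<pi> x \<in> T'" "\<And>y. y \<in> T' \<Longrightarrow> linear (J' y)" "\<And>v. (\<lambda>y. J' y v) differentiable (at (\<pi> x))"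
    and proj: "\<And>y v. y \<in> W \<Longrightarrow> v \<in> D y \<Longrightarrow>
      \<exists>w\<in>D y. fder \<iota> y w = J (\<iota> y) (fder \<iota> y v) \<and> fder \<pi> y w = J' (\<pi> y) (fder \<pi> y v)"
    and skew: "\<And>u v. G (\<iota> x) (J (\<iota> x) u) v = - G (\<iota> x) u (J (\<iota> x) v)"
      "\<And>u v. G' (\<pi> x) (J' (\<pi> x) u) v = - G' (\<pi> x) u (J' (\<pi> x) v)"
    and projQ: "\<And>\<beta> v. v \<in> D x \<Longrightarrow>
      \<exists>w\<in>D x. fder \<iota> x w = Q \<beta> (fder \<iota> x v) \<and> fder \<pi> x w = Q' \<beta> (fder \<pi> x v)"
    and Q: "\<And>u. \<exists>\<omega>. \<forall>v. cov_endo G J (\<iota> x) u v = (\<Sum>\<beta>\<in>UNIV. \<omega> \<beta> *\<^sub>R Q \<beta> v)"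
  shows "\<exists>\<omega>. \<forall>v'. cov_endo G' J' (\<pi> x) u' v' = (\<Sum>\<beta>\<in>UNIV. \<omega> \<beta> *\<^sub>R Q' \<beta> v')"
proof -
  have lift: "\<exists>X. horizontal X \<and> fder \<pi> x (X x) = u" for u
    using onto[of u] extend unfolding horizontal_def by blast
  obtain X where X: "horizontal X" "fder \<pi> x (X x) = u'" using lift by blast
  \<comment> \<open>Chosen for a lift of u' before v' is fixed, so the same coefficients serve all
    v'.\<close>
  obtain \<omega> where \<omega>: "\<And>v. cov_endo G J (\<iota> x) (fder \<iota> x (X x)) v = (\<Sum>\<beta>\<in>UNIV. \<omega> \<beta> *\<^sub>R Q \<beta> v)"
    using Q by blast
  have "cov_endo G' J' (\<pi> x) u' v' = (\<Sum>\<beta>\<in>UNIV. \<omega> \<beta> *\<^sub>R Q' \<beta> v')" for v'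
  proof (rule M'.eqI[OF inS(2)])
    fix w'
    obtain Y where Y: "horizontal Y" "fder \<pi> x (Y x) = v'" using lift by blast
    obtain Z where Z: "horizontal Z" "fder \<pi> x (Z x) = w'" using lift by blast
    have D: "Y x \<in> D x" "Z x \<in> D x" using Y Z W unfolding horizontal_def by auto
    have d: "(\<lambda>y. fder \<iota> y (Y y)) differentiable (at x)" "(\<lambda>y. fder \<pi> y (Y y)) differentiable (at x)"
      using Y W smooth unfolding horizontal_def by (auto intro: differentiable_fder_apply[of W])
    note e = M.cov_along_endo[OF inS(1) diffable(1) d(1) T] and e' = M'.cov_along_endo[OF inS(2) diffable(2) d(2) T']
    have "G (\<iota> x) (cov_along G \<iota> (\<lambda>y. J (\<iota> y) (fder \<iota> y (Y y))) x (X x)) (fder \<iota> x (Z x)) =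
      G' (\<pi> x) (cov_along G' \<pi> (\<lambda>y. J' (\<pi> y) (fder \<pi> y (Y y))) x (X x)) (fder \<pi> x (Z x))"
    proof (rule cov_along_projection[OF X(1) Z(1)])
      show "(\<lambda>y. J (\<iota> y) (fder \<iota> y (Y y))) differentiable (at x)"
        "(\<lambda>y. J' (\<pi> y) (fder \<pi> y (Y y))) differentiable (at x)"
        using e(1) e'(1) unfolding differentiable_def by blast+
      fix y assume "y \<in> W"
      moreover have "Y y \<in> D y" using Y(1) \<open>y \<in> W\<close> unfolding horizontal_def by blast
      ultimately obtain w where "w\<in>D y" "fder \<iota> y w = J (\<iota> y) (fder \<iota> y (Y y))" "fder \<pi> y w = J' (\<pi> y) (fder \<pi> y (Y y))"
        using proj by blast
      then show "\<exists>v\<in>D y. J (\<iota> y) (fder \<iota> y (Y y)) = fder \<iota> y v \<and> J' (\<pi> y) (fder \<pi> y (Y y)) = fder \<pi> y v"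
        by (intro bexI[of _ w]) auto
    qed
    then have main: "(\<Sum>\<beta>\<in>UNIV. \<omega> \<beta> * G (\<iota> x) (Q \<beta> (fder \<iota> x (Y x))) (fder \<iota> x (Z x)))
        + G (\<iota> x) (J (\<iota> x) (cov_along G \<iota> (\<lambda>y. fder \<iota> y (Y y)) x (X x))) (fder \<iota> x (Z x)) =
        G' (\<pi> x) (cov_endo G' J' (\<pi> x) u' v') w' + G' (\<pi> x) (J' (\<pi> x) (cov_along G' \<pi> (\<lambda>y. fder \<pi> y (Y y)) x (X x))) w'"
      by (simp add: e(2) e'(2) \<omega> X(2) Y(2) Z(2) M.left_simps M'.left_simps inS)
    \<comment> \<open>The derivative of d\<iota> Y need not lie in d\<iota> D, so
      \<open>proj\<close> cannot be applied to J times it. Skewness shifts J to d\<iota> Z, and z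
      represents J d\<iota> Z in D.\<close>
    obtain z where z: "z \<in> D x" "fder \<iota> x z = J (\<iota> x) (fder \<iota> x (Z x))" "fder \<pi> x z = J' (\<pi> x) w'"
      using proj[OF W(2) D(2)] Z(2) by auto
    \<comment> \<open>Only the value z at x enters, hence any section of D through z will
      do.\<close>
    obtain Z' where Z': "Z' x = z" "horizontal Z'" using extend[OF z(1)] unfolding horizontal_def by blast
    have "G (\<iota> x) (J (\<iota> x) (cov_along G \<iota> (\<lambda>y. fder \<iota> y (Y y)) x (X x))) (fder \<iota> x (Z x)) =
      G' (\<pi> x) (J' (\<pi> x) (cov_along G' \<pi> (\<lambda>y. fder \<pi> y (Y y)) x (X x))) w'"
      using cov_along_projection_fields[OF X(1) Y(1) Z'(2)] by (simp add: skew Z' z)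
    moreover have "G (\<iota> x) (Q \<beta> (fder \<iota> x (Y x))) (fder \<iota> x (Z x)) = G' (\<pi> x) (Q' \<beta> v') w'" for \<beta>
    proof -
      obtain q where q: "q \<in> D x" "fder \<iota> x q = Q \<beta> (fder \<iota> x (Y x))" "fder \<pi> x q = Q' \<beta> v'"
        using projQ[OF D(1)] Y(2) by auto
      show ?thesis using isometry[OF W(2) q(1) D(2)] by (simp add: q Z(2))
    qed
    ultimately show "G' (\<pi> x) (cov_endo G' J' (\<pi> x) u' v') w' = G' (\<pi> x) (\<Sum>\<beta>\<in>UNIV. \<omega> \<beta> *\<^sub>R Q' \<beta> v') w'"
      using main by (simp add: M'.left_simps inS)
  qed
  then show ?thesis by blast
qed

end

section \<open>Tensor calculus in charts\<close>

lemma charts_at_iff: "c \<in> charts_at A p \<longleftrightarrow> c \<in> A \<and> p \<in> fst c"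
  by (simp add: charts_at_def)

text \<open>On the tangent space at p, the inverse of taking the component in c. With u fixed and p
  varying this is a coordinate vector field.\<close>

definition tvec_of ::
  "('m, 'e::euclidean_space) chart set \<Rightarrow> ('m, 'e) chart \<Rightarrow> 'm \<Rightarrow> 'e \<Rightarrow> ('m, 'e) tvec"
  where "tvec_of A c p u =
    (\<lambda>d. if d \<in> charts_at A p then fder (snd d \<circ> chart_inv c) (snd c p) u else 0)"

locale atlas =
  fixes A :: "('m::{t2_space, second_countable_topology}, 'e::euclidean_space) chart set"
  assumes smooth_atlas: "smooth_atlas A"
begin

abbreviation "T \<equiv> tangent_space A"

lemma chart: "c \<in> A \<Longrightarrow> is_chart c"
  using smooth_atlas unfolding smooth_atlas_def by blast

lemma open_dom: "c \<in> A \<Longrightarrow> open (fst c)"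
  using chart unfolding is_chart_def by blast

lemma hom: "c \<in> A \<Longrightarrow> homeomorphism (fst c) (snd c ` fst c) (snd c) (chart_inv c)"
  using chart unfolding is_chart_def by blast

lemma open_image:
  assumes "c \<in> A" "open U"
  shows "open (snd c ` (fst c \<inter> U))"
proof -
  have "openin (top_of_set (snd c ` fst c)) (snd c ` (fst c \<inter> U))"
    by (rule homeomorphism_imp_open_map[OF hom[OF assms(1)]]) (use assms(2) in auto)
  moreover have "open (snd c ` fst c)" using chart[OF assms(1)] unfolding is_chart_def by blast
  ultimately show ?thesis using openin_open_trans by blast
qed

lemma open_image_dom: "c \<in> A \<Longrightarrow> open (snd c ` fst c)"
  using chart unfolding is_chart_def by blast

lemma chart_inv_chart [simp]: "c \<in> A \<Longrightarrow> p \<in> fst c \<Longrightarrow> chart_inv c (snd c p) = p"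
  by (rule homeomorphism_apply1[OF hom])

lemma chart_chart_inv [simp]: "c \<in> A \<Longrightarrow> x \<in> snd c ` fst c \<Longrightarrow> snd c (chart_inv c x) = x"
  by (rule homeomorphism_apply2[OF hom])

lemma chart_inv_in:
  "c \<in> A \<Longrightarrow> x \<in> snd c ` (fst c \<inter> U) \<Longrightarrow> chart_inv c x \<in> fst c \<inter> U"
  by auto

lemma ex_chart: "\<exists>c. c \<in> charts_at A p"
proof -
  have "p \<in> (\<Union>c\<in>A. fst c)" using smooth_atlas unfolding smooth_atlas_def by simp
  then show ?thesis by (auto simp: charts_at_iff)
qed

lemma some_chart: "(SOME c. c \<in> charts_at A p) \<in> charts_at A p"
  using ex_chart by (rule someI_ex)

lemma smooth_transition:
  assumes "c \<in> A" "d \<in> A"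
  shows "smooth_on (snd c ` (fst c \<inter> fst d)) (snd d \<circ> chart_inv c)"
proof -
  have "\<forall>c\<in>A. \<forall>d\<in>A. smooth_on (snd c ` (fst c \<inter> fst d)) (snd d \<circ> chart_inv c)"
    using smooth_atlas unfolding smooth_atlas_def by (elim conjE)
  then show ?thesis using assms by simp
qed

lemma differentiable_transition:
  assumes "c \<in> charts_at A p" "d \<in> charts_at A p"
  shows "(snd d \<circ> chart_inv c) differentiable (at (snd c p))"
  by (rule smooth_on_imp_differentiable[OF smooth_transition]) (use assms in \<open>auto simp: charts_at_iff\<close>)

lemma change_chart:
  assumes c: "c \<in> charts_at A p" and d: "d \<in> charts_at A p"
    and F: "(F \<circ> chart_inv d) differentiable (at (snd d p))"
  shows "((F \<circ> chart_inv c) has_derivative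
    (\<lambda>v. fder (F \<circ> chart_inv d) (snd d p) (fder (snd d \<circ> chart_inv c) (snd c p) v))) (at (snd c p))"
proof (rule has_derivative_transform_within_open[where s="snd c ` (fst c \<inter> fst d)"])
  have [simp]: "(snd d \<circ> chart_inv c) (snd c p) = snd d p"
    using c by (simp add: charts_at_iff)
  show "((\<lambda>x. (F \<circ> chart_inv d) ((snd d \<circ> chart_inv c) x)) has_derivative
    (\<lambda>v. fder (F \<circ> chart_inv d) (snd d p) (fder (snd d \<circ> chart_inv c) (snd c p) v))) (at (snd c p))"
    by (rule has_derivative_compose[OF fder_works[OF differentiable_transition[OF c d]]])
       (simp only: fder_works[OF F] \<open>(snd d \<circ> chart_inv c) (snd c p) = snd d p\<close>)
  show "open (snd c ` (fst c \<inter> fst d))" "snd c p \<in> snd c ` (fst c \<inter> fst d)"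
    using c d by (auto intro!: open_image open_dom simp: charts_at_iff)
  show "(F \<circ> chart_inv d) ((snd d \<circ> chart_inv c) x) = (F \<circ> chart_inv c) x"
    if "x \<in> snd c ` (fst c \<inter> fst d)" for x
    using that c d by (auto simp: charts_at_iff)
qed

lemmas fder_change_chart = change_chart[THEN has_derivative_imp_fder, THEN fun_cong]

lemma fder_same_chart:
  assumes "c \<in> charts_at A p"
  shows "fder (snd c \<circ> chart_inv c) (snd c p) = (\<lambda>v. v)"
proof (subst fder_cong_open)
  show "open (snd c ` fst c)" "snd c p \<in> snd c ` fst c"
    using assms by (auto intro: open_image_dom simp: charts_at_iff)
  show "(snd c \<circ> chart_inv c) y = y" if "y \<in> snd c ` fst c" for y
    using that assms by (auto simp: charts_at_iff)
qed simp

lemma linear_fder_transition: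
  "c \<in> charts_at A p \<Longrightarrow> d \<in> charts_at A p \<Longrightarrow> linear (fder (snd d \<circ> chart_inv c) (snd c p))"
  by (rule linear_frechet_derivative[OF differentiable_transition])

lemma tangent_spaceI:
  assumes "\<And>c. c \<notin> charts_at A p \<Longrightarrow> v c = 0"
    and "\<And>c d. c \<in> charts_at A p \<Longrightarrow> d \<in> charts_at A p \<Longrightarrow>
      v d = fder (snd d \<circ> chart_inv c) (snd c p) (v c)"
  shows "v \<in> T p"
  unfolding tangent_space_def
proof (intro CollectI conjI allI impI ballI)
  show "v c = 0" if "c \<notin> charts_at A p" for c by (rule assms(1)[OF that])
  show "v d = fder (snd d \<circ> chart_inv c) (snd c p) (v c)"
    if "c \<in> charts_at A p" "d \<in> charts_at A p" for c d by (rule assms(2)[OF that])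
qed

lemma tangent_space_outside:
  assumes "v \<in> T p" "c \<notin> charts_at A p"
  shows "v c = 0"
proof -
  have "\<forall>c. c \<notin> charts_at A p \<longrightarrow> v c = 0"
    using assms(1) unfolding tangent_space_def by (elim CollectE conjE)
  from mp[OF spec[OF this] assms(2)] show ?thesis .
qed

lemma tangent_space_change:
  assumes "v \<in> T p" "c \<in> charts_at A p" "d \<in> charts_at A p"
  shows "v d = fder (snd d \<circ> chart_inv c) (snd c p) (v c)"
proof -
  have "\<forall>c\<in>charts_at A p. \<forall>d\<in>charts_at A p. v d = fder (snd d \<circ> chart_inv c) (snd c p) (v c)"
    using assms(1) unfolding tangent_space_def by (elim CollectE conjE)
  from bspec[OF bspec[OF this assms(2)] assms(3)] show ?thesis .
qed

lemma tangent_space_eqI: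
  assumes "v \<in> T p" "w \<in> T p" "c \<in> charts_at A p" "v c = w c"
  shows "v = w"
proof
  show "v d = w d" for d
    using tangent_space_change[OF assms(1,3), of d] tangent_space_change[OF assms(2,3), of d]
      tangent_space_outside[OF assms(1)] tangent_space_outside[OF assms(2)] assms(4)
    by (cases "d \<in> charts_at A p") auto
qed

lemma subspace_tangent_space: "subspace (T p)"
proof (rule subspaceI)
  show "0 \<in> T p"
    by (rule tangent_spaceI) (simp_all add: linear_0[OF linear_fder_transition])
  show "v + w \<in> T p" if "v \<in> T p" "w \<in> T p" for v w
    by (rule tangent_spaceI)
       (simp_all add: tangent_space_outside[OF that(1)] tangent_space_outside[OF that(2)]
         linear_add[OF linear_fder_transition] tangent_space_change[OF that(1), symmetric]
         tangent_space_change[OF that(2), symmetric])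
  show "a *\<^sub>R v \<in> T p" if "v \<in> T p" for a v
    by (rule tangent_spaceI)
       (simp_all add: scaleR_fun_def tangent_space_outside[OF that]
         linear_scale[OF linear_fder_transition] tangent_space_change[OF that, symmetric])
qed

lemmas tangent_space_add = subspace_add[OF subspace_tangent_space]
  and tangent_space_diff = subspace_diff[OF subspace_tangent_space]
  and tangent_space_scale = subspace_scale[OF subspace_tangent_space]
  and tangent_space_0 = subspace_0[OF subspace_tangent_space]

lemma tvec_of_in:
  assumes c: "c \<in> charts_at A p"
  shows "tvec_of A c p u \<in> T p"
proof (rule tangent_spaceI)
  fix d e assume d: "d \<in> charts_at A p" and e: "e \<in> charts_at A p"
  show "tvec_of A c p u e = fder (snd e \<circ> chart_inv d) (snd d p) (tvec_of A c p u d)"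
    using fder_change_chart[OF c d differentiable_transition[OF d e], of u] by (simp add: tvec_of_def d e)
qed (simp add: tvec_of_def)

lemma tvec_of_apply [simp]: "c \<in> charts_at A p \<Longrightarrow> tvec_of A c p u c = u"
  by (simp add: tvec_of_def fder_same_chart)

lemma tvec_of_component:
  "c \<in> charts_at A p \<Longrightarrow> v \<in> T p \<Longrightarrow> tvec_of A c p (v c) = v"
  by (rule tangent_space_eqI[OF tvec_of_in]) auto

lemma tvec_of_linear: "c \<in> charts_at A p \<Longrightarrow> linear (tvec_of A c p)"
  by (rule linearI; rule ext) (simp_all add: tvec_of_def scaleR_fun_def
      linear_add[OF linear_fder_transition] linear_scale[OF linear_fder_transition])

text \<open>Frees \<open>dir_deriv\<close> from the chart picked by \<open>SOME\<close>: the change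
  of v between charts is undone by the chain rule.\<close>

lemma dir_deriv_chart:
  assumes v: "v \<in> T p" and c: "c \<in> charts_at A p" and f: "(f \<circ> chart_inv c) differentiable (at (snd c p))"
  shows "dir_deriv A p v f = fder (f \<circ> chart_inv c) (snd c p) (v c)"
  using fder_change_chart[OF some_chart c f] tangent_space_change[OF v some_chart c]
  by (simp add: dir_deriv_def Let_def)

abbreviation comp :: "('m, 'e) chart \<Rightarrow> ('m \<Rightarrow> ('m, 'e) tvec) \<Rightarrow> 'e \<Rightarrow> 'e"
  where "comp c X \<equiv> (\<lambda>x. X (chart_inv c x) c)"

lemma vector_field_in: "vector_field_on A U X \<Longrightarrow> p \<in> U \<Longrightarrow> X p \<in> T p"
  by (simp add: vector_field_on_def)

lemma vector_field_smooth:
  "vector_field_on A U X \<Longrightarrow> c \<in> A \<Longrightarrow> smooth_on (snd c ` (fst c \<inter> U)) (comp c X)"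
  by (simp add: vector_field_on_def)

lemma vector_field_differentiable:
  "vector_field_on A U X \<Longrightarrow> p \<in> U \<Longrightarrow> c \<in> charts_at A p \<Longrightarrow> comp c X differentiable (at (snd c p))"
  by (rule smooth_on_imp_differentiable[OF vector_field_smooth]) (auto simp: charts_at_iff)

lemma vector_field_subset:
  assumes "vector_field_on A U X" "V \<subseteq> U"
  shows "vector_field_on A V X"
  unfolding vector_field_on_def
proof (intro conjI ballI)
  show "smooth_on (snd c ` (fst c \<inter> V)) (comp c X)" if "c \<in> A" for c
    by (rule smooth_on_subset[OF vector_field_smooth[OF assms(1) that]]) (use assms(2) in auto)
qed (use assms(2) vector_field_in[OF assms(1)] in auto)

lemma vector_field_cong:
  assumes "open U" "vector_field_on A U X" "\<And>p. p \<in> U \<Longrightarrow> Y p = X p"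
  shows "vector_field_on A U Y"
  unfolding vector_field_on_def
proof (intro conjI ballI)
  fix c assume c: "c \<in> A"
  show "smooth_on (snd c ` (fst c \<inter> U)) (comp c Y)"
    by (subst smooth_on_cong[OF open_image[OF c assms(1)], of _ "comp c X"])
       (use chart_inv_in[OF c] vector_field_smooth[OF assms(2) c] in \<open>auto simp: assms(3) c\<close>)
qed (simp add: assms(3) vector_field_in[OF assms(2)])

text \<open>A single chart containing U decides smoothness: the component in d is the derivative of
  the transition map from c to d applied to the component in c, composed with the transition map
  from d to c.\<close>

lemma vector_field_chartI:
  assumes U: "open U" "U \<subseteq> fst c" and c: "c \<in> A"
    and X: "\<And>p. p \<in> U \<Longrightarrow> X p \<in> T p" "smooth_on (snd c ` U) (comp c X)"
  shows "vector_field_on A U X"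
  unfolding vector_field_on_def
proof (intro conjI ballI X(1))
  fix d assume d: "d \<in> A"
  have o: "open (snd d ` (fst d \<inter> U))" "open (snd c ` (fst c \<inter> (fst d \<inter> U)))"
    by (intro open_image open_Int open_dom c d U(1))+
  have eq: "comp d X x = fder (snd d \<circ> chart_inv c) ((snd c \<circ> chart_inv d) x) (comp c X ((snd c \<circ> chart_inv d) x))"
    if x: "x \<in> snd d ` (fst d \<inter> U)" for x
  proof -
    obtain p where p: "p \<in> fst d" "p \<in> U" "x = snd d p" using x by auto
    then have "c \<in> charts_at A p" "d \<in> charts_at A p" using U(2) c d by (auto simp: charts_at_iff)
    then show ?thesis using tangent_space_change[OF X(1)[OF p(2)], of c d] p U(2) c d
      by auto
  qed
  have sm: "smooth_on (snd c ` (fst c \<inter> (fst d \<inter> U))) (\<lambda>y. fder (snd d \<circ> chart_inv c) y (comp c X y))"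
    by (rule smooth_on_fder_apply[OF o(2) smooth_on_subset[OF smooth_transition[OF c d]] smooth_on_subset[OF X(2)]])
       (rule image_mono, blast)+
  show "smooth_on (snd d ` (fst d \<inter> U)) (comp d X)"
  proof (subst smooth_on_cong[OF o(1) eq], assumption)
    show "smooth_on (snd d ` (fst d \<inter> U))
       (\<lambda>x. fder (snd d \<circ> chart_inv c) ((snd c \<circ> chart_inv d) x) (comp c X ((snd c \<circ> chart_inv d) x)))"
    proof (rule smooth_on_compose[OF o(1) smooth_on_subset[OF smooth_transition[OF d c]] sm o(2)])
      show "snd d ` (fst d \<inter> U) \<subseteq> snd d ` (fst d \<inter> fst c)" using U(2) by (intro image_mono) blast
      show "(snd c \<circ> chart_inv d) ` snd d ` (fst d \<inter> U) \<subseteq> snd c ` (fst c \<inter> (fst d \<inter> U))"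
        using U(2) d by (intro image_subsetI) auto
    qed
  qed
qed

lemma vector_field_tvec_of:
  assumes "c \<in> A"
  shows "vector_field_on A (fst c) (\<lambda>p. tvec_of A c p u)"
proof (rule vector_field_chartI[OF open_dom[OF assms] order_refl assms])
  show "tvec_of A c p u \<in> T p" if "p \<in> fst c" for p
    using that assms by (auto intro: tvec_of_in simp: charts_at_iff)
  show "smooth_on (snd c ` fst c) (\<lambda>x. tvec_of A c (chart_inv c x) u c)"
    by (subst smooth_on_cong[OF open_image_dom[OF assms], of _ "\<lambda>x. u"])
       (use assms in \<open>auto simp: charts_at_iff smooth_on_const\<close>)
qed

lemma vector_field_diff:
  assumes "open U" "vector_field_on A U X" "vector_field_on A U Y"
  shows "vector_field_on A U (\<lambda>p. X p - Y p)"
  unfolding vector_field_on_def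
proof (intro conjI ballI)
  show "X p - Y p \<in> T p" if "p \<in> U" for p
    by (rule tangent_space_diff[OF vector_field_in[OF assms(2) that] vector_field_in[OF assms(3) that]])
  show "smooth_on (snd c ` (fst c \<inter> U)) (\<lambda>x. (X (chart_inv c x) - Y (chart_inv c x)) c)" if "c \<in> A" for c
    using smooth_on_diff[OF open_image[OF that assms(1)] vector_field_smooth[OF assms(2) that]
        vector_field_smooth[OF assms(3) that]] by simp
qed

text \<open>Under a transition map each of the two terms of the bracket acquires a second derivative
  of that map; these cancel by symmetry of second derivatives.\<close>

lemma lie_bracket_in:
  assumes U: "open U" "p \<in> U" and X: "vector_field_on A U X" and Y: "vector_field_on A U Y"
  shows "lie_bracket A X Y p \<in> T p"
proof (rule tangent_spaceI)
  show "lie_bracket A X Y p c = 0" if "c \<notin> charts_at A p" for c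
    using that by (simp add: lie_bracket_def)
  fix c d assume c: "c \<in> charts_at A p" and d: "d \<in> charts_at A p"
  define \<tau> where "\<tau> = snd d \<circ> chart_inv c"
  have cd: "c \<in> A" "d \<in> A" "p \<in> fst c" "p \<in> fst d" using c d by (auto simp: charts_at_iff)
  let ?W = "snd c ` (fst c \<inter> (fst d \<inter> U))" and ?x = "snd c p"
  have W: "open ?W" "?x \<in> ?W" using cd U by (auto intro!: open_image open_Int open_dom)
  have \<tau>: "smooth_on ?W \<tau>"
    unfolding \<tau>_def by (rule smooth_on_subset[OF smooth_transition[OF cd(1,2)]]) auto
  have \<tau>x: "\<tau> ?x = snd d p" using cd by (simp add: \<tau>_def)
  \<comment> \<open>Differentiates the transformation law of Z. The first summand on the right is
    the non-tensorial one.\<close>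
  have key: "fder (comp d Z) (snd d p) (fder \<tau> ?x h) =
      fder (\<lambda>x. fder \<tau> x (Z p c)) ?x h + fder \<tau> ?x (fder (comp c Z) ?x h)"
    if Z: "vector_field_on A U Z" for Z h
  proof -
    have "fder (\<lambda>x. comp d Z (\<tau> x)) ?x = fder (\<lambda>x. fder \<tau> x (comp c Z x)) ?x"
    proof (rule fder_cong_open[OF W])
      fix x assume "x \<in> ?W"
      then obtain q where q: "q \<in> fst c" "q \<in> fst d" "q \<in> U" "x = snd c q" by auto
      then have "c \<in> charts_at A q" "d \<in> charts_at A q" using cd by (auto simp: charts_at_iff)
      then show "comp d Z (\<tau> x) = fder \<tau> x (comp c Z x)"
        using tangent_space_change[OF vector_field_in[OF Z q(3)], of c d] q cd
        by (simp add: \<tau>_def)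
    qed
    moreover have "fder (\<lambda>x. comp d Z (\<tau> x)) ?x h = fder (comp d Z) (snd d p) (fder \<tau> ?x h)"
      by (subst fder_compose) (use smooth_on_imp_differentiable[OF \<tau> W(2)] vector_field_differentiable[OF Z U(2) d] \<tau>x in auto)
    moreover have "((\<lambda>x. fder \<tau> x (comp c Z x)) has_derivative
      (\<lambda>h. fder (\<lambda>y. fder \<tau> y (comp c Z ?x)) ?x h + fder \<tau> ?x (fder (comp c Z) ?x h))) (at ?x)"
      by (rule has_derivative_linear_family[where f="\<lambda>y. y" and J="fder \<tau>",
          OF W _ _ has_derivative_ident fder_works[OF vector_field_differentiable[OF Z U(2) c]]])
       (auto intro!: linear_frechet_derivative smooth_on_imp_differentiable[OF \<tau>]
         smooth_on_imp_differentiable[OF smooth_on_fder[OF \<tau>] W(2)])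
    ultimately show ?thesis using cd by (simp add: has_derivative_imp_fder)
  qed
  have XY: "X p d = fder \<tau> ?x (X p c)" "Y p d = fder \<tau> ?x (Y p c)"
    unfolding \<tau>_def by (rule tangent_space_change[OF vector_field_in[OF _ U(2)] c d], fact)+
  have "linear (fder \<tau> ?x)" using linear_fder_transition[OF c d] by (simp add: \<tau>_def)
  from linear_diff[OF this] show "lie_bracket A X Y p d = fder (snd d \<circ> chart_inv c) (snd c p) (lie_bracket A X Y p c)"
    unfolding \<tau>_def[symmetric]
    by (simp add: lie_bracket_def c d XY key X Y smooth_on_fder_commute[OF W(1) \<tau> W(2), of "X p c" "Y p c"])
qed

end

section \<open>Existence and uniqueness of the Levi-Civita connection\<close>

locale semi_riemannian = atlas A
  for A :: "('m::{t2_space, second_countable_topology}, 'e::euclidean_space) chart set" +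
  fixes g :: "('m, 'e) metric_tensor"
  assumes metric: "semi_riemannian_metric A g"
begin

lemma metric_sym: "u \<in> T p \<Longrightarrow> v \<in> T p \<Longrightarrow> g p u v = g p v u"
  using metric unfolding semi_riemannian_metric_def sym_bilinear_on_def by blast

lemma metric_lin:
  "u \<in> T p \<Longrightarrow> v \<in> T p \<Longrightarrow> w \<in> T p \<Longrightarrow> g p (a *\<^sub>R u + v) w = a * g p u w + g p v w"
  using metric unfolding semi_riemannian_metric_def sym_bilinear_on_def by blast

lemma metric_nondegenerate:
  assumes "v \<in> T p" "\<And>w. w \<in> T p \<Longrightarrow> g p v w = 0"
  shows "v = 0"
proof -
  have "nondegenerate_on (T p) (g p)" using metric unfolding semi_riemannian_metric_def by blast
  then show ?thesis using assms unfolding nondegenerate_on_def by blast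
qed

lemma metric_smooth:
  "open U \<Longrightarrow> vector_field_on A U X \<Longrightarrow> vector_field_on A U Y \<Longrightarrow> smooth_function_on A U (\<lambda>p. g p (X p) (Y p))"
  using metric unfolding semi_riemannian_metric_def by blast

lemma metric_diff:
  assumes "u \<in> T p" "v \<in> T p" "w \<in> T p"
  shows "g p (u - v) w = g p u w - g p v w"
  using metric_lin[OF assms(2,1,3), of "-1"] by simp

lemma metric_add:
  "u \<in> T p \<Longrightarrow> v \<in> T p \<Longrightarrow> w \<in> T p \<Longrightarrow> g p (u + v) w = g p u w + g p v w"
  using metric_lin[of u p v w 1] by simp

lemma metric_scale:
  assumes "u \<in> T p" "w \<in> T p"
  shows "g p (a *\<^sub>R u) w = a * g p u w"
proof -
  have "g p 0 w = 0" using metric_lin[OF tangent_space_0 tangent_space_0 assms(2), of 1] by simp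
  then show ?thesis using metric_lin[OF assms(1) tangent_space_0 assms(2), of a] by simp
qed

lemma metric_eqI:
  assumes "u \<in> T p" "v \<in> T p" "\<And>w. w \<in> T p \<Longrightarrow> g p u w = g p v w"
  shows "u = v"
proof -
  have "u - v = 0"
    by (rule metric_nondegenerate[of _ p]) (simp_all add: tangent_space_diff metric_diff assms)
  then show ?thesis by simp
qed

definition gram :: "('m, 'e) chart \<Rightarrow> 'e \<Rightarrow> 'e \<Rightarrow> 'e \<Rightarrow> real"
  where "gram c x u v = g (chart_inv c x) (tvec_of A c (chart_inv c x) u) (tvec_of A c (chart_inv c x) v)"

lemma gram_chart:
  assumes "c \<in> charts_at A p"
  shows "gram c (snd c p) u v = g p (tvec_of A c p u) (tvec_of A c p v)"
  using assms by (simp add: gram_def charts_at_iff)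

lemma metric_gram:
  "c \<in> charts_at A p \<Longrightarrow> v \<in> T p \<Longrightarrow> w \<in> T p \<Longrightarrow> g p v w = gram c (snd c p) (v c) (w c)"
  by (simp add: gram_chart tvec_of_component)

lemma local_metric_gram:
  assumes c: "c \<in> A"
  shows "local_metric (snd c ` fst c) (gram c)"
proof
  show "open (snd c ` fst c)" by (rule open_image_dom[OF c])
next
  fix x u v assume "x \<in> snd c ` fst c"
  then obtain p where p: "x = snd c p" "c \<in> charts_at A p" using c by (auto simp: charts_at_iff)
  note [simp] = gram_chart[OF p(2)] tvec_of_in[OF p(2)]
    linear_add[OF tvec_of_linear[OF p(2)]] linear_scale[OF tvec_of_linear[OF p(2)]] linear_0[OF tvec_of_linear[OF p(2)]]
  have lin: "linear (\<lambda>u. gram c x u v)" for v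
    by (rule linearI) (simp_all add: p(1) metric_add metric_scale)
  have sym: "gram c x u v = gram c x v u" for u v
    by (simp add: p(1) metric_sym[of "tvec_of A c p u"])
  show "gram c x u v = gram c x v u" by (rule sym)
  show "bilinear (gram c x)"
    unfolding bilinear_def using lin by (simp add: sym[of _ v for v])
  show "u = 0" if "\<And>v. gram c x u v = 0"
  proof -
    have "tvec_of A c p u = 0"
    proof (rule metric_nondegenerate)
      fix w assume w: "w \<in> T p"
      show "g p (tvec_of A c p u) w = 0"
        using that[of "w c"] by (simp add: p(1) tvec_of_component[OF p(2) w])
    qed simp
    then have "tvec_of A c p u c = 0" by simp
    then show ?thesis using p(2) by simp
  qed
next
  fix u v
  \<comment> \<open>Smoothness of g is known through its action on vector fields; the constant
    vectors u and v enter as coordinate fields.\<close>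
  have "smooth_function_on A (fst c) (\<lambda>p. g p (tvec_of A c p u) (tvec_of A c p v))"
    by (rule metric_smooth[OF open_dom[OF c] vector_field_tvec_of[OF c] vector_field_tvec_of[OF c]])
  then have "smooth_on (snd c ` (fst c \<inter> fst c)) ((\<lambda>p. g p (tvec_of A c p u) (tvec_of A c p v)) \<circ> chart_inv c)"
    using c unfolding smooth_function_on_def by (rule bspec)
  then show "smooth_on (snd c ` fst c) (\<lambda>x. gram c x u v)"
    by (simp add: gram_def o_def)
qed

definition chart_cov where
  "chart_cov c X Y p = tvec_of A c p (cov_along (gram c) (\<lambda>x. x) (comp c Y) (snd c p) (X p c))"

lemma chart_cov_in: "c \<in> charts_at A p \<Longrightarrow> chart_cov c X Y p \<in> T p"
  by (simp add: chart_cov_def tvec_of_in)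

lemma chart_cov_component:
  "c \<in> charts_at A p \<Longrightarrow> chart_cov c X Y p c = cov_along (gram c) (\<lambda>x. x) (comp c Y) (snd c p) (X p c)"
  by (simp add: chart_cov_def)

lemma in_chart_image:
  "open U \<Longrightarrow> p \<in> U \<Longrightarrow> c \<in> charts_at A p \<Longrightarrow>
    open (snd c ` (fst c \<inter> U)) \<and> snd c p \<in> snd c ` (fst c \<inter> U)"
  by (auto simp: charts_at_iff open_image)

lemma chart_cov_metric:
  assumes U: "open U" "p \<in> U" "c \<in> charts_at A p"
    and X: "vector_field_on A U X" and Y: "vector_field_on A U Y" and Z: "vector_field_on A U Z"
  shows "((\<lambda>q. g q (Y q) (Z q)) \<circ> chart_inv c) differentiable (at (snd c p))"
    and "dir_deriv A p (X p) (\<lambda>q. g q (Y q) (Z q)) = g p (chart_cov c X Y p) (Z p) + g p (Y p) (chart_cov c X Z p)"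
proof -
  have c: "c \<in> A" "p \<in> fst c" using U(3) by (auto simp: charts_at_iff)
  interpret L: local_metric "snd c ` fst c" "gram c" by (rule local_metric_gram[OF c(1)])
  let ?D = "\<lambda>h. gram c (snd c p) (cov_along (gram c) (\<lambda>x. x) (comp c Y) (snd c p) h) (Z p c) +
      gram c (snd c p) (Y p c) (cov_along (gram c) (\<lambda>x. x) (comp c Z) (snd c p) h)"
  have "((\<lambda>x. gram c x (comp c Y x) (comp c Z x)) has_derivative ?D) (at (snd c p))"
    using L.cov_along_metric[of "\<lambda>x. x" "snd c p" "comp c Y" "comp c Z"]
      vector_field_differentiable[OF Y U(2,3)] vector_field_differentiable[OF Z U(2,3)] c by simp
  then have D: "((\<lambda>q. g q (Y q) (Z q)) \<circ> chart_inv c has_derivative ?D) (at (snd c p))"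
  proof (rule has_derivative_transform_within_open)
    show "open (snd c ` (fst c \<inter> U))" "snd c p \<in> snd c ` (fst c \<inter> U)"
      using in_chart_image[OF U] by auto
    fix x assume "x \<in> snd c ` (fst c \<inter> U)"
    then obtain q where q: "x = snd c q" "q \<in> fst c" "q \<in> U" by auto
    then have cq: "c \<in> charts_at A q" using c by (simp add: charts_at_iff)
    show "gram c x (comp c Y x) (comp c Z x) = ((\<lambda>q. g q (Y q) (Z q)) \<circ> chart_inv c) x"
      using metric_gram[OF cq vector_field_in[OF Y q(3)] vector_field_in[OF Z q(3)]] q c by simp
  qed
  show diff: "((\<lambda>q. g q (Y q) (Z q)) \<circ> chart_inv c) differentiable (at (snd c p))"
    unfolding differentiable_def by (intro exI[where x="?D"] D)
  have "dir_deriv A p (X p) (\<lambda>q. g q (Y q) (Z q)) = ?D (X p c)"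
    unfolding dir_deriv_chart[OF vector_field_in[OF X U(2)] U(3) diff] has_derivative_imp_fder[OF D] ..
  then show "dir_deriv A p (X p) (\<lambda>q. g q (Y q) (Z q)) = g p (chart_cov c X Y p) (Z p) + g p (Y p) (chart_cov c X Z p)"
    by (simp add: metric_gram[OF U(3)] chart_cov_in[OF U(3)] chart_cov_component[OF U(3)]
        vector_field_in[OF Y U(2)] vector_field_in[OF Z U(2)])
qed

lemma chart_cov_torsion:
  assumes U: "open U" "p \<in> U" "c \<in> charts_at A p"
    and X: "vector_field_on A U X" and Y: "vector_field_on A U Y"
  shows "chart_cov c X Y p - chart_cov c Y X p = lie_bracket A X Y p"
proof (rule tangent_space_eqI[OF _ lie_bracket_in[OF U(1,2) X Y] U(3)])
  show "chart_cov c X Y p - chart_cov c Y X p \<in> T p"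
    by (simp add: tangent_space_diff chart_cov_in U(3))
  have c: "c \<in> A" "p \<in> fst c" using U(3) by (auto simp: charts_at_iff)
  interpret L: local_metric "snd c ` fst c" "gram c" by (rule local_metric_gram[OF c(1)])
  have "snd c p \<in> snd c ` fst c" using c by simp
  from L.christoffel_sym[OF this, of "X p c" "Y p c"]
  show "(chart_cov c X Y p - chart_cov c Y X p) c = lie_bracket A X Y p c"
    using c by (simp add: chart_cov_component[OF U(3)] L.cov_along_id lie_bracket_def U(3))
qed

text \<open>The operators are evaluated at the single point p, and only torsion and metric
  compatibility are assumed of them. So the lemma applies to connections and also to the formulas in
  two different charts. As U lies in one chart domain, every tangent vector w at p extends to a
  coordinate field on U.\<close>

lemma koszul_unique:
  assumes U: "p \<in> U" "U \<subseteq> fst c" "c \<in> A"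
    and X: "vector_field_on A U X" and Y: "vector_field_on A U Y"
    and n: "\<And>X Y. vector_field_on A U X \<Longrightarrow> vector_field_on A U Y \<Longrightarrow> n X Y \<in> T p"
    and n': "\<And>X Y. vector_field_on A U X \<Longrightarrow> vector_field_on A U Y \<Longrightarrow> n' X Y \<in> T p"
    and torsion: "\<And>X Y. vector_field_on A U X \<Longrightarrow> vector_field_on A U Y \<Longrightarrow> n X Y - n Y X = n' X Y - n' Y X"
    and metric: "\<And>X Y Z. vector_field_on A U X \<Longrightarrow> vector_field_on A U Y \<Longrightarrow> vector_field_on A U Z \<Longrightarrow>
      g p (n X Y) (Z p) + g p (Y p) (n X Z) = g p (n' X Y) (Z p) + g p (Y p) (n' X Z)"
  shows "n X Y = n' X Y"
proof (rule metric_eqI[OF n[OF X Y] n'[OF X Y]])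
  fix w assume w: "w \<in> T p"
  let ?P = "vector_field_on A U"
  let ?t = "\<lambda>X Y Z. g p (n X Y) (Z p) - g p (n' X Y) (Z p)"
  have c: "c \<in> charts_at A p" using U by (auto simp: charts_at_iff)
  have Z: "?P (\<lambda>q. tvec_of A c q (w c))"
    by (rule vector_field_subset[OF vector_field_tvec_of[OF U(3)] U(2)])
  have "?t X Y (\<lambda>q. tvec_of A c q (w c)) = 0"
  proof (rule symmetric_antisymmetric_zero[where P="?P" and T="?t", OF _ _ X Y Z])
    fix X Y Z assume v: "?P X" "?P Y" "?P Z"
    have z: "Z p \<in> T p" "Y p \<in> T p" using vector_field_in[OF v(3) U(1)] vector_field_in[OF v(2) U(1)] by auto
    have "g p (n X Y - n Y X) (Z p) = g p (n' X Y - n' Y X) (Z p)" by (simp only: torsion[OF v(1,2)])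
    then show "?t X Y Z = ?t Y X Z" by (simp add: metric_diff n n' v z)
    show "?t X Y Z = - ?t X Z Y"
      using metric[OF v] metric_sym[OF z(2) n[OF v(1,3)]] metric_sym[OF z(2) n'[OF v(1,3)]] by simp
  qed
  then show "g p (n X Y) w = g p (n' X Y) w" by (simp add: tvec_of_component[OF c w])
qed

text \<open>This replaces the transformation law of the Christoffel symbols: the formulas in both
  charts have the torsion and the metric property that determine the derivative.\<close>

lemma chart_cov_independent:
  assumes U: "open U" "p \<in> U" and c: "c \<in> charts_at A p" and d: "d \<in> charts_at A p"
    and X: "vector_field_on A U X" and Y: "vector_field_on A U Y"
  shows "chart_cov c X Y p = chart_cov d X Y p"
proof -
  have cA: "c \<in> A" "p \<in> fst c" using c by (auto simp: charts_at_iff)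
  have V: "open (U \<inter> fst c)" "p \<in> U \<inter> fst c" using U cA by (auto intro: open_Int open_dom)
  show ?thesis
  proof (rule koszul_unique[where U="U \<inter> fst c" and n="\<lambda>X Y. chart_cov c X Y p" and n'="\<lambda>X Y. chart_cov d X Y p",
        OF V(2) _ cA(1) vector_field_subset[OF X] vector_field_subset[OF Y] chart_cov_in[OF c] chart_cov_in[OF d]])
    fix X Y Z assume X: "vector_field_on A (U \<inter> fst c) X" and Y: "vector_field_on A (U \<inter> fst c) Y"
    show "chart_cov c X Y p - chart_cov c Y X p = chart_cov d X Y p - chart_cov d Y X p"
      by (simp only: chart_cov_torsion[OF V c X Y] chart_cov_torsion[OF V d X Y])
    assume Z: "vector_field_on A (U \<inter> fst c) Z"
    show "g p (chart_cov c X Y p) (Z p) + g p (Y p) (chart_cov c X Z p) =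
        g p (chart_cov d X Y p) (Z p) + g p (Y p) (chart_cov d X Z p)"
      using chart_cov_metric(2)[OF V c X Y Z] chart_cov_metric(2)[OF V d X Y Z] by simp
  qed auto
qed

text \<open>The chart is chosen separately at each point. For smooth fields the choice is immaterial
  by \<open>chart_cov_independent\<close>, so in a neighbourhood one fixed chart may be used, see
  \<open>nabla_chart\<close>.\<close>

definition nabla where
  "nabla X Y p = chart_cov (SOME c. c \<in> charts_at A p) X Y p"

lemma nabla_chart:
  "open U \<Longrightarrow> p \<in> U \<Longrightarrow> c \<in> charts_at A p \<Longrightarrow> vector_field_on A U X \<Longrightarrow> vector_field_on A U Y \<Longrightarrow>
    nabla X Y p = chart_cov c X Y p"
  unfolding nabla_def by (rule chart_cov_independent[OF _ _ some_chart])

lemma nabla_in: "nabla X Y p \<in> T p"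
  unfolding nabla_def by (rule chart_cov_in[OF some_chart])

lemma vector_field_nabla:
  assumes U: "open U" and X: "vector_field_on A U X" and Y: "vector_field_on A U Y"
  shows "vector_field_on A U (nabla X Y)"
  unfolding vector_field_on_def
proof (intro conjI ballI nabla_in)
  fix c assume c: "c \<in> A"
  interpret L: local_metric "snd c ` fst c" "gram c" by (rule local_metric_gram[OF c])
  show "smooth_on (snd c ` (fst c \<inter> U)) (comp c (nabla X Y))"
  proof (subst smooth_on_cong[OF open_image[OF c U]])
    fix x assume "x \<in> snd c ` (fst c \<inter> U)"
    then obtain q where q: "x = snd c q" "q \<in> fst c" "q \<in> U" by auto
    then have cq: "c \<in> charts_at A q" using c by (simp add: charts_at_iff)
    show "comp c (nabla X Y) x = cov_along (gram c) (\<lambda>x. x) (comp c Y) x (comp c X x)"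
      using nabla_chart[OF U q(3) cq X Y] q(2) c by (simp add: q(1) chart_cov_component[OF cq])
  next
    show "smooth_on (snd c ` (fst c \<inter> U)) (\<lambda>x. cov_along (gram c) (\<lambda>x. x) (comp c Y) x (comp c X x))"
      by (rule L.smooth_cov_along_id[OF open_image[OF c U] _ vector_field_smooth[OF X c] vector_field_smooth[OF Y c]]) auto
  qed
qed

lemma nabla_cong:
  assumes "open U" "p \<in> U" "\<And>q. q \<in> U \<Longrightarrow> X' q = X q" "\<And>q. q \<in> U \<Longrightarrow> Y' q = Y q"
  shows "nabla X' Y' p = nabla X Y p"
proof -
  define c where "c = (SOME c. c \<in> charts_at A p)"
  have c: "c \<in> charts_at A p" unfolding c_def by (rule some_chart)
  then have cA: "c \<in> A" "p \<in> fst c" by (auto simp: charts_at_iff)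
  have "fder (comp c Y') (snd c p) = fder (comp c Y) (snd c p)"
  proof (rule fder_cong_open)
    show "open (snd c ` (fst c \<inter> U))" "snd c p \<in> snd c ` (fst c \<inter> U)"
      using in_chart_image[OF assms(1,2) c] by auto
    show "comp c Y' x = comp c Y x" if x: "x \<in> snd c ` (fst c \<inter> U)" for x
      using chart_inv_in[OF cA(1) x] by (simp add: assms(4))
  qed
  then show ?thesis
    unfolding nabla_def c_def[symmetric] using assms cA by (simp add: chart_cov_def cov_along_def)
qed

text \<open>Provides the connection on M'. Except for smoothness and locality, all requirements are
  identities at a point p and are verified in the chart chosen at p.\<close>

lemma levi_civita_nabla: "levi_civita_connection A g nabla"
  unfolding levi_civita_connection_def affine_connection_def
proof (intro conjI allI impI ballI)
  fix U X Y assume U: "open U" and X: "vector_field_on A U X" and Y: "vector_field_on A U Y"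
  show "vector_field_on A U (nabla X Y)" by (rule vector_field_nabla[OF U X Y])
  show "nabla X' Y' p = nabla X Y p" if "\<forall>p\<in>U. X' p = X p \<and> Y' p = Y p" "p \<in> U" for X' Y' p
    by (rule nabla_cong[OF U that(2)]) (use that(1) in auto)
  show "nabla X Y p - nabla Y X p = lie_bracket A X Y p" if "p \<in> U" for p
    unfolding nabla_def by (rule chart_cov_torsion[OF U that some_chart X Y])
  show "dir_deriv A p (X p) (\<lambda>q. g q (Y q) (Z q)) = g p (nabla X Y p) (Z p) + g p (Y p) (nabla X Z p)"
    if "vector_field_on A U Z" "p \<in> U" for Z p
    unfolding nabla_def by (rule chart_cov_metric(2)[OF U that(2) some_chart X Y that(1)])
  fix Z f p assume Z: "vector_field_on A U Z" and f: "smooth_function_on A U f" and p: "p \<in> U"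
  define c where "c = (SOME c. c \<in> charts_at A p)"
  have c: "c \<in> charts_at A p" unfolding c_def by (rule some_chart)
  then have cA: "c \<in> A" "p \<in> fst c" by (auto simp: charts_at_iff)
  interpret L: local_metric "snd c ` fst c" "gram c" by (rule local_metric_gram[OF cA(1)])
  have x: "snd c p \<in> snd c ` fst c" using cA by simp
  note tl = linear_add[OF tvec_of_linear[OF c], symmetric] linear_scale[OF tvec_of_linear[OF c], symmetric]
  have dY: "comp c Y differentiable (at (snd c p))" by (rule vector_field_differentiable[OF Y p c])
  have dZ: "comp c Z differentiable (at (snd c p))" by (rule vector_field_differentiable[OF Z p c])
  have "smooth_on (snd c ` (fst c \<inter> U)) (f \<circ> chart_inv c)"
    using f cA(1) unfolding smooth_function_on_def by (rule bspec)
  then have df: "(f \<circ> chart_inv c) differentiable (at (snd c p))"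
    by (rule smooth_on_imp_differentiable) (use cA p in auto)
  show "nabla (\<lambda>q. f q *\<^sub>R X q + Z q) Y p = f p *\<^sub>R nabla X Y p + nabla Z Y p"
    unfolding nabla_def c_def[symmetric] chart_cov_def tl L.cov_along_id
    by (simp add: linear_add[OF linear_frechet_derivative[OF dY]] linear_scale[OF linear_frechet_derivative[OF dY]]
      linear_add[OF L.linear_christoffel(2)[OF x]] linear_scale[OF L.linear_christoffel(2)[OF x]]
      scaleR_fun_def algebra_simps)
  have D: "((\<lambda>x. (f \<circ> chart_inv c) x *\<^sub>R comp c Y x + comp c Z x) has_derivative
     (\<lambda>h. ((f \<circ> chart_inv c) (snd c p) *\<^sub>R fder (comp c Y) (snd c p) h
        + fder (f \<circ> chart_inv c) (snd c p) h *\<^sub>R comp c Y (snd c p)) + fder (comp c Z) (snd c p) h)) (at (snd c p))"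
    by (intro has_derivative_add has_derivative_scaleR fder_works dY dZ df)
  have "chart_cov c X (\<lambda>q. f q *\<^sub>R Y q + Z q) p c =
      (dir_deriv A p (X p) f *\<^sub>R Y p + f p *\<^sub>R chart_cov c X Y p + chart_cov c X Z p) c"
    using has_derivative_imp_fder[OF D] cA
    by (simp add: chart_cov_component[OF c] L.cov_along_id dir_deriv_chart[OF vector_field_in[OF X p] c df]
      scaleR_fun_def linear_add[OF L.linear_christoffel(1)[OF x]] linear_scale[OF L.linear_christoffel(1)[OF x]]
      algebra_simps)
  then have "chart_cov c X (\<lambda>q. f q *\<^sub>R Y q + Z q) p =
      dir_deriv A p (X p) f *\<^sub>R Y p + f p *\<^sub>R chart_cov c X Y p + chart_cov c X Z p"
    by (intro tangent_space_eqI[OF chart_cov_in[OF c] _ c] tangent_space_add tangent_space_scale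
        vector_field_in[OF Y p] chart_cov_in[OF c])
  then show "nabla X (\<lambda>q. f q *\<^sub>R Y q + Z q) p =
      dir_deriv A p (X p) f *\<^sub>R Y p + f p *\<^sub>R nabla X Y p + nabla X Z p"
    unfolding nabla_def c_def[symmetric] .
qed

text \<open>Translates the hypothesis on M, which concerns some abstract connection, into the chart
  formula. The fields are restricted to a chart domain so that \<open>koszul_unique\<close>
  applies.\<close>

lemma levi_civita_unique:
  assumes nab: "levi_civita_connection A g nab" and U: "open U" "p \<in> U"
    and X: "vector_field_on A U X" and Y: "vector_field_on A U Y"
  shows "nab X Y p = nabla X Y p"
proof -
  obtain c where c: "c \<in> charts_at A p" using ex_chart by blast
  have cA: "c \<in> A" "p \<in> fst c" using c by (auto simp: charts_at_iff)
  have V: "open (U \<inter> fst c)" "p \<in> U \<inter> fst c" using U cA by (auto intro: open_Int open_dom)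
  have tors: "n X Y p - n Y X p = lie_bracket A X Y p"
    if "levi_civita_connection A g n" "vector_field_on A (U \<inter> fst c) X" "vector_field_on A (U \<inter> fst c) Y" for n X Y
    using that V unfolding levi_civita_connection_def by blast
  have met: "dir_deriv A p (X p) (\<lambda>q. g q (Y q) (Z q)) = g p (n X Y p) (Z p) + g p (Y p) (n X Z p)"
    if "levi_civita_connection A g n" "vector_field_on A (U \<inter> fst c) X" "vector_field_on A (U \<inter> fst c) Y"
      "vector_field_on A (U \<inter> fst c) Z" for n X Y Z
    using that V unfolding levi_civita_connection_def by blast
  have "vector_field_on A (U \<inter> fst c) (nab X Y)"
    if "vector_field_on A (U \<inter> fst c) X" "vector_field_on A (U \<inter> fst c) Y" for X Y
    using nab that V(1) unfolding levi_civita_connection_def affine_connection_def by blast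
  then have nabT: "nab X Y p \<in> T p"
    if "vector_field_on A (U \<inter> fst c) X" "vector_field_on A (U \<inter> fst c) Y" for X Y
    using that V(2) by (blast intro: vector_field_in)
  show ?thesis
  proof (rule koszul_unique[where U="U \<inter> fst c" and n="\<lambda>X Y. nab X Y p" and n'="\<lambda>X Y. nabla X Y p",
        OF V(2) _ cA(1) vector_field_subset[OF X] vector_field_subset[OF Y] nabT nabla_in])
    fix X Y Z assume X: "vector_field_on A (U \<inter> fst c) X" and Y: "vector_field_on A (U \<inter> fst c) Y"
    show "nab X Y p - nab Y X p = nabla X Y p - nabla Y X p"
      by (simp only: tors[OF nab X Y] tors[OF levi_civita_nabla X Y])
    assume Z: "vector_field_on A (U \<inter> fst c) Z"
    show "g p (nab X Y p) (Z p) + g p (Y p) (nab X Z p) = g p (nabla X Y p) (Z p) + g p (Y p) (nabla X Z p)"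
      using met[OF nab X Y Z] met[OF levi_civita_nabla X Y Z] by simp
  qed auto
qed

end

section \<open>Endomorphism fields\<close>

lemma sum_fun_apply: "(\<Sum>i\<in>I. f i) x = (\<Sum>i\<in>I. f i x)"
  for f :: "'i \<Rightarrow> 'a \<Rightarrow> 'b::comm_monoid_add"
  by (induction I rule: infinite_finite_induct) auto

lemma scaleR_fun_apply: "(a *\<^sub>R f) x = a *\<^sub>R f x"
  by (simp add: scaleR_fun_def)

text \<open>The sum runs over the indices and not over the image, so f may take a value
  repeatedly.\<close>

lemma span_image_finite_sum:
  fixes f :: "'i \<Rightarrow> 'a::real_vector"
  assumes "v \<in> span (f ` I)" "finite I"
  shows "\<exists>a. v = (\<Sum>i\<in>I. a i *\<^sub>R f i)"
  using assms(1)
proof (induction rule: span_induct_alt)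
  case base
  show ?case by (rule exI[of _ "\<lambda>_. 0"]) simp
next
  case (step c x y)
  then obtain j a where j: "j \<in> I" "x = f j" and "y = (\<Sum>i\<in>I. a i *\<^sub>R f i)" by blast
  then have "c *\<^sub>R x + y = (\<Sum>i\<in>I. (if i = j then c else 0) *\<^sub>R f i + a i *\<^sub>R f i)"
    using assms(2) by (simp add: sum.distrib if_distrib[of "\<lambda>c. c *\<^sub>R _"] cong: if_cong)
  also have "\<dots> = (\<Sum>i\<in>I. ((if i = j then c else 0) + a i) *\<^sub>R f i)"
    by (simp add: scaleR_add_left)
  finally show ?case by (intro exI[of _ "\<lambda>i. (if i = j then c else 0) + a i"])
qed

definition endo_comp ::
  "('m, 'e::euclidean_space) chart set \<Rightarrow> ('m, 'e) chart \<Rightarrow> ('m, 'e) endo_field \<Rightarrow> 'e \<Rightarrow> 'e \<Rightarrow> 'e"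
  where "endo_comp A c J x u = J (chart_inv c x) (tvec_of A c (chart_inv c x) u) c"

context atlas
begin

lemma endo_comp_chart:
  "c \<in> charts_at A p \<Longrightarrow> endo_comp A c J (snd c p) u = J p (tvec_of A c p u) c"
  by (simp add: endo_comp_def charts_at_iff)

lemma endo_apply:
  "c \<in> charts_at A p \<Longrightarrow> v \<in> T p \<Longrightarrow> J p v c = endo_comp A c J (snd c p) (v c)"
  by (simp add: endo_comp_chart tvec_of_component)

lemma endo_tangent: "endo_field_on A U J \<Longrightarrow> p \<in> U \<Longrightarrow> J p \<in> tangent_endo A p"
  by (simp add: endo_field_on_def)

lemma endo_in: "endo_field_on A U J \<Longrightarrow> p \<in> U \<Longrightarrow> v \<in> T p \<Longrightarrow> J p v \<in> T p"
  using endo_tangent unfolding tangent_endo_def by blast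

lemma endo_lin:
  assumes "endo_field_on A U J" "p \<in> U" "u \<in> T p" "v \<in> T p"
  shows "J p (a *\<^sub>R u + v) = a *\<^sub>R J p u + J p v"
  using endo_tangent[OF assms(1,2)] assms(3,4) unfolding tangent_endo_def by blast

lemma endo_outside: "F \<in> tangent_endo A p \<Longrightarrow> v \<notin> T p \<Longrightarrow> F v = 0"
  unfolding tangent_endo_def by blast

lemma vector_field_endo:
  "endo_field_on A U J \<Longrightarrow> open V \<Longrightarrow> V \<subseteq> U \<Longrightarrow> vector_field_on A V X \<Longrightarrow> vector_field_on A V (\<lambda>p. J p (X p))"
  unfolding endo_field_on_def by blast

lemma endo_field_subset: "endo_field_on A U J \<Longrightarrow> V \<subseteq> U \<Longrightarrow> endo_field_on A V J"
  unfolding endo_field_on_def by (meson subsetD subset_trans)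

lemma linear_endo_comp:
  assumes J: "endo_field_on A U J" and c: "c \<in> A" and x: "x \<in> snd c ` (fst c \<inter> U)"
  shows "linear (endo_comp A c J x)"
proof -
  obtain p where p: "x = snd c p" "p \<in> fst c" "p \<in> U" using x by auto
  then have cp: "c \<in> charts_at A p" using c by (simp add: charts_at_iff)
  have l: "endo_comp A c J x (a *\<^sub>R u + v) = a *\<^sub>R endo_comp A c J x u + endo_comp A c J x v" for a u v
    by (simp add: p(1) endo_comp_chart[OF cp] linear_add[OF tvec_of_linear[OF cp]] scaleR_fun_def
        linear_scale[OF tvec_of_linear[OF cp], unfolded scaleR_fun_def]
        endo_lin[OF J p(3) tvec_of_in[OF cp] tvec_of_in[OF cp], unfolded scaleR_fun_def])
  have "endo_comp A c J x 0 = 0" using l[of 1 0 0] by simp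
  then show ?thesis by (intro linearI) (use l[of 1] l[of _ _ 0] in simp_all)
qed

lemma smooth_endo_comp:
  assumes U: "open U" and J: "endo_field_on A U J" and c: "c \<in> A"
  shows "smooth_on (snd c ` (fst c \<inter> U)) (\<lambda>x. endo_comp A c J x u)"
proof -
  have "vector_field_on A (fst c \<inter> U) (\<lambda>p. J p (tvec_of A c p u))"
    by (rule vector_field_endo[OF J]) (auto intro!: open_Int open_dom c U vector_field_subset[OF vector_field_tvec_of[OF c]])
  from vector_field_smooth[OF this c] show ?thesis by (simp add: endo_comp_def Int_left_absorb)
qed

lemma differentiable_endo_comp:
  assumes "open U" "endo_field_on A U J" "p \<in> U" "c \<in> charts_at A p"
  shows "(\<lambda>x. endo_comp A c J x u) differentiable (at (snd c p))"
  by (rule smooth_on_imp_differentiable[OF smooth_endo_comp[OF assms(1,2)]])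
     (use assms in \<open>auto simp: charts_at_iff\<close>)

end

section \<open>Covariant derivatives of endomorphism fields\<close>

context semi_riemannian
begin

text \<open>The right side involves X and Y only through their values at p: the derivative of J is a
  tensor, although the two terms on the left depend on derivatives of Y.\<close>

lemma nabla_endo_component:
  assumes U: "open U" and J: "endo_field_on A U J" and V: "open V" "V \<subseteq> U" "p \<in> V"
    and X: "vector_field_on A V X" and Y: "vector_field_on A V Y" and c: "c \<in> charts_at A p"
  shows "(nabla X (\<lambda>q. J q (Y q)) p - J p (nabla X Y p)) c =
    cov_endo (gram c) (endo_comp A c J) (snd c p) (X p c) (Y p c)"
proof -
  have cA: "c \<in> A" "p \<in> fst c" using c by (auto simp: charts_at_iff)
  interpret L: local_metric "snd c ` fst c" "gram c" by (rule local_metric_gram[OF cA(1)])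
  have W: "open (snd c ` (fst c \<inter> V))" "snd c p \<in> snd c ` (fst c \<inter> V)"
    using in_chart_image[OF V(1,3) c] by auto
  have JY: "vector_field_on A V (\<lambda>q. J q (Y q))" by (rule vector_field_endo[OF J V(1,2) Y])
  have eq: "comp c (\<lambda>q. J q (Y q)) x = endo_comp A c J x (comp c Y x)" if x: "x \<in> snd c ` (fst c \<inter> V)" for x
  proof -
    obtain q where q: "x = snd c q" "q \<in> fst c" "q \<in> V" using x by auto
    then have cq: "c \<in> charts_at A q" using cA by (simp add: charts_at_iff)
    show ?thesis using endo_apply[OF cq vector_field_in[OF Y q(3)], of J] q cA by simp
  qed
  have "cov_along (gram c) (\<lambda>x. x) (comp c (\<lambda>q. J q (Y q))) (snd c p) (X p c) =
    cov_along (gram c) (\<lambda>x. x) (\<lambda>x. endo_comp A c J x (comp c Y x)) (snd c p) (X p c)"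
    unfolding L.cov_along_id eq[OF W(2)] using fder_cong_open[OF W eq] by simp
  also have "\<dots> = cov_endo (gram c) (endo_comp A c J) (snd c p) (fder (\<lambda>x. x) (snd c p) (X p c)) (comp c Y (snd c p))
     + endo_comp A c J (snd c p) (cov_along (gram c) (\<lambda>x. x) (comp c Y) (snd c p) (X p c))"
  proof (rule L.cov_along_endo(2)[where f="\<lambda>x. x"])
    show "open (snd c ` (fst c \<inter> V))" "snd c p \<in> snd c ` (fst c \<inter> V)" "snd c p \<in> snd c ` fst c"
      using W cA by auto
    show "comp c Y differentiable (at (snd c p))" by (rule vector_field_differentiable[OF Y V(3) c])
    show "linear (endo_comp A c J y)" if "y \<in> snd c ` (fst c \<inter> V)" for y
      by (rule linear_endo_comp[OF endo_field_subset[OF J V(2)] cA(1) that])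
    show "(\<lambda>y. endo_comp A c J y v) differentiable (at (snd c p))" for v
      by (rule differentiable_endo_comp[OF V(1) endo_field_subset[OF J V(2)] V(3) c])
  qed simp
  finally have main: "cov_along (gram c) (\<lambda>x. x) (comp c (\<lambda>q. J q (Y q))) (snd c p) (X p c) =
     cov_endo (gram c) (endo_comp A c J) (snd c p) (X p c) (Y p c)
     + endo_comp A c J (snd c p) (cov_along (gram c) (\<lambda>x. x) (comp c Y) (snd c p) (X p c))"
    using cA by simp
  have "J p (nabla X Y p) c = endo_comp A c J (snd c p) (chart_cov c X Y p c)"
    using endo_apply[OF c nabla_in, of J X Y] nabla_chart[OF V(1,3) c X Y] by simp
  then show ?thesis
    using main nabla_chart[OF V(1,3) c X JY] by (simp add: chart_cov_component[OF c])
qed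

text \<open>Being defined by the chart formula, it needs no extension of v to a field. The value 0
  outside the tangent space is what \<open>tangent_endo\<close> demands.\<close>

definition endo_deriv ::
  "('m \<Rightarrow> ('m, 'e) tvec) \<Rightarrow> ('m, 'e) endo_field \<Rightarrow> ('m, 'e) endo_field"
  where "endo_deriv X J p v = (let c = (SOME c. c \<in> charts_at A p) in
    if v \<in> T p then tvec_of A c p (cov_endo (gram c) (endo_comp A c J) (snd c p) (X p c) (v c)) else 0)"

lemma endo_deriv_in: "v \<in> T p \<Longrightarrow> endo_deriv X J p v \<in> T p"
  by (simp add: endo_deriv_def Let_def tvec_of_in[OF some_chart])

lemma endo_deriv_apply:
  assumes U: "open U" and J: "endo_field_on A U J" and V: "open V" "V \<subseteq> U" "p \<in> V"
    and X: "vector_field_on A V X" and Y: "vector_field_on A V Y"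
  shows "endo_deriv X J p (Y p) = nabla X (\<lambda>q. J q (Y q)) p - J p (nabla X Y p)"
proof (rule tangent_space_eqI[OF endo_deriv_in[OF vector_field_in[OF Y V(3)]] _ some_chart])
  show "nabla X (\<lambda>q. J q (Y q)) p - J p (nabla X Y p) \<in> T p"
    using endo_in[OF J _ nabla_in] V by (intro tangent_space_diff nabla_in) auto
  show "endo_deriv X J p (Y p) (SOME c. c \<in> charts_at A p) =
    (nabla X (\<lambda>q. J q (Y q)) p - J p (nabla X Y p)) (SOME c. c \<in> charts_at A p)"
    unfolding nabla_endo_component[OF U J V X Y some_chart]
    by (simp add: endo_deriv_def Let_def vector_field_in[OF Y V(3)] tvec_of_apply[OF some_chart])
qed

lemma endo_deriv_component:
  assumes U: "open U" "p \<in> U" and J: "endo_field_on A U J" and X: "vector_field_on A U X"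
    and v: "v \<in> T p" and c: "c \<in> charts_at A p"
  shows "endo_deriv X J p v c = cov_endo (gram c) (endo_comp A c J) (snd c p) (X p c) (v c)"
proof -
  have cA: "c \<in> A" "p \<in> fst c" using c by (auto simp: charts_at_iff)
  have V: "open (U \<inter> fst c)" "U \<inter> fst c \<subseteq> U" "p \<in> U \<inter> fst c" using U cA by (auto intro: open_Int open_dom)
  have X': "vector_field_on A (U \<inter> fst c) X" and Y: "vector_field_on A (U \<inter> fst c) (\<lambda>q. tvec_of A c q (v c))"
    by (auto intro: vector_field_subset[OF X] vector_field_subset[OF vector_field_tvec_of[OF cA(1)]])
  show ?thesis
    using nabla_endo_component[OF U(1) J V X' Y c] endo_deriv_apply[OF U(1) J V X' Y] c
    by (simp add: tvec_of_component[OF c v])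
qed

text \<open>Linearity at a point is read off the chart formula, smoothness off the expression in
  terms of \<open>nabla\<close>.\<close>

lemma covariant_derivative_endo_deriv:
  assumes U: "open U" and J: "endo_field_on A U J" and X: "vector_field_on A U X"
  shows "covariant_derivative_endo_on A nabla U X J (endo_deriv X J)"
  unfolding covariant_derivative_endo_on_def endo_field_on_def
proof (intro conjI ballI allI impI)
  fix p assume p: "p \<in> U"
  obtain c where c: "c \<in> charts_at A p" using ex_chart by blast
  have cA: "c \<in> A" "p \<in> fst c" using c by (auto simp: charts_at_iff)
  interpret L: local_metric "snd c ` fst c" "gram c" by (rule local_metric_gram[OF cA(1)])
  have lin: "linear (cov_endo (gram c) (endo_comp A c J) (snd c p) (X p c))"
  proof (rule L.linear_cov_endo)
    show "open (snd c ` (fst c \<inter> U))" "snd c p \<in> snd c ` (fst c \<inter> U)" "snd c p \<in> snd c ` fst c"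
      using in_chart_image[OF U p c] cA by auto
  qed (auto intro: linear_endo_comp[OF J cA(1)] differentiable_endo_comp[OF U J p c])
  have "endo_deriv X J p (a *\<^sub>R u + v) = a *\<^sub>R endo_deriv X J p u + endo_deriv X J p v"
    if uv: "u \<in> T p" "v \<in> T p" for u v a
  proof (rule tangent_space_eqI[OF _ _ c])
    have uv': "a *\<^sub>R u + v \<in> T p" by (intro tangent_space_add tangent_space_scale uv)
    then show "endo_deriv X J p (a *\<^sub>R u + v) \<in> T p" by (rule endo_deriv_in)
    show "a *\<^sub>R endo_deriv X J p u + endo_deriv X J p v \<in> T p"
      by (intro tangent_space_add tangent_space_scale endo_deriv_in uv)
    show "endo_deriv X J p (a *\<^sub>R u + v) c = (a *\<^sub>R endo_deriv X J p u + endo_deriv X J p v) c"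
      by (simp add: endo_deriv_component[OF U p J X uv' c] endo_deriv_component[OF U p J X uv(1) c]
          endo_deriv_component[OF U p J X uv(2) c] scaleR_fun_apply linear_add[OF lin] linear_scale[OF lin])
  qed
  then show "endo_deriv X J p \<in> tangent_endo A p"
    unfolding tangent_endo_def by (auto simp: endo_deriv_in) (simp add: endo_deriv_def Let_def)
next
  fix V Y p assume V: "open V" "V \<subseteq> U" and Y: "vector_field_on A V Y" and p: "p \<in> V"
  show "endo_deriv X J p (Y p) = nabla X (\<lambda>q. J q (Y q)) p - J p (nabla X Y p)"
    by (rule endo_deriv_apply[OF U J V p vector_field_subset[OF X V(2)] Y])
next
  fix V Y assume V: "open V" "V \<subseteq> U" and Y: "vector_field_on A V Y"
  have X': "vector_field_on A V X" by (rule vector_field_subset[OF X V(2)])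
  have "vector_field_on A V (\<lambda>p. nabla X (\<lambda>q. J q (Y q)) p - J p (nabla X Y p))"
    by (intro vector_field_diff vector_field_nabla vector_field_endo[OF J V] V(1) X' Y)
  then show "vector_field_on A V (\<lambda>p. endo_deriv X J p (Y p))"
    by (rule vector_field_cong[OF V(1)]) (rule endo_deriv_apply[OF U J V _ X' Y])
qed

end

section \<open>Paraquaternionic bundles\<close>

text \<open>Modulo 3 two indices are equal or neighbours, so the relations between \<alpha> and
  \<alpha> + 1 determine all anticommutators.\<close>

lemma index3_cases: "\<beta> = \<alpha> \<or> \<beta> = \<alpha> + 1 \<or> \<alpha> = \<beta> + (1 :: 3)"
  using exhaust_3[of \<alpha>] exhaust_3[of \<beta>] by auto

context atlas
begin

lemma canonical_local_basisD:
  assumes "canonical_local_basis A \<sigma> U J"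
  shows "open U" "endo_field_on A U (J \<alpha>)" "p \<in> U \<Longrightarrow> \<sigma> p = span (range (\<lambda>\<alpha>. J \<alpha> p))"
    "p \<in> U \<Longrightarrow> v \<in> T p \<Longrightarrow> J \<alpha> p (J \<alpha> p v) = - eps \<alpha> *\<^sub>R v"
    "p \<in> U \<Longrightarrow> v \<in> T p \<Longrightarrow> J \<alpha> p (J (\<alpha> + 1) p v) = - J (\<alpha> + 1) p (J \<alpha> p v)"
  using assms unfolding canonical_local_basis_def by auto

lemma canonical_anticommute:
  assumes J: "canonical_local_basis A \<sigma> U J" and p: "p \<in> U" "v \<in> T p"
  shows "J \<alpha> p (J \<beta> p v) + J \<beta> p (J \<alpha> p v) = (if \<alpha> = \<beta> then (- 2 * eps \<alpha>) *\<^sub>R v else 0)"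
proof -
  have n: "\<alpha> + 1 \<noteq> \<alpha>" "\<beta> + 1 \<noteq> \<beta>" by auto
  consider "\<beta> = \<alpha>" | "\<beta> = \<alpha> + 1" | "\<alpha> = \<beta> + 1" using index3_cases by blast
  then show ?thesis
  proof cases
    case 1
    have "(- 2 * eps \<alpha>) *\<^sub>R v = - eps \<alpha> *\<^sub>R v + - eps \<alpha> *\<^sub>R v"
      by (simp only: scaleR_left_distrib[symmetric]) simp
    then show ?thesis using canonical_local_basisD(4)[OF J p, of \<alpha>] 1 by simp
  next
    case 2
    then show ?thesis using canonical_local_basisD(5)[OF J p, of \<alpha>] n by simp
  next
    case 3
    then show ?thesis using canonical_local_basisD(5)[OF J p, of \<beta>] n by simp
  qed
qed

lemma canonical_anticommute_comp:
  assumes J: "canonical_local_basis A \<sigma> U J" and c: "c \<in> A" and x: "x \<in> snd c ` (fst c \<inter> U)"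
  shows "endo_comp A c (J \<alpha>) x (endo_comp A c (J \<beta>) x v) + endo_comp A c (J \<beta>) x (endo_comp A c (J \<alpha>) x v) =
    (if \<alpha> = \<beta> then (- 2 * eps \<alpha>) *\<^sub>R v else 0)"
proof -
  obtain p where p: "x = snd c p" "p \<in> fst c" "p \<in> U" using x by auto
  then have cp: "c \<in> charts_at A p" using c by (simp add: charts_at_iff)
  let ?v = "tvec_of A c p v"
  have in1: "J \<alpha> p ?v \<in> T p" for \<alpha>
    by (rule endo_in[OF canonical_local_basisD(2)[OF J] p(3) tvec_of_in[OF cp]])
  have "endo_comp A c (J \<alpha>) x (endo_comp A c (J \<beta>) x v) = J \<alpha> p (J \<beta> p ?v) c" for \<alpha> \<beta>
    using endo_apply[OF cp in1, of "J \<alpha>" \<beta>] endo_comp_chart[OF cp, of "J \<beta>" v] by (simp add: p(1))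
  then have "endo_comp A c (J \<alpha>) x (endo_comp A c (J \<beta>) x v) + endo_comp A c (J \<beta>) x (endo_comp A c (J \<alpha>) x v) =
      (J \<alpha> p (J \<beta> p ?v) + J \<beta> p (J \<alpha> p ?v)) c" by simp
  also have "\<dots> = (if \<alpha> = \<beta> then (- 2 * eps \<alpha>) *\<^sub>R v else 0)"
    unfolding canonical_anticommute[OF J p(3) tvec_of_in[OF cp]] using cp by (simp add: scaleR_fun_def)
  finally show ?thesis .
qed

end

section \<open>Parallel bundles and hermitian structures in charts\<close>

context semi_riemannian
begin

text \<open>Parallelism, applied to the coordinate fields around p, becomes a matrix identity at p.
  The coefficients depend on p and u and come from the span of the basis at p.\<close>

lemma parallel_cov_endo:
  assumes LC: "levi_civita_connection A g nab" and par: "parallel_bundle A nab \<sigma>"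
    and J: "canonical_local_basis A \<sigma> U J" and p: "p \<in> U" and c: "c \<in> charts_at A p"
  shows "\<exists>\<omega>. \<forall>v. cov_endo (gram c) (endo_comp A c (J \<alpha>)) (snd c p) u v =
    (\<Sum>\<beta>\<in>UNIV. \<omega> \<beta> *\<^sub>R endo_comp A c (J \<beta>) (snd c p) v)"
proof -
  have cA: "c \<in> A" "p \<in> fst c" using c by (auto simp: charts_at_iff)
  note U = canonical_local_basisD(1)[OF J] and E = canonical_local_basisD(2)[OF J, of \<alpha>]
  define V where "V = U \<inter> fst c"
  have V: "open V" "V \<subseteq> U" "p \<in> V" using U cA p by (auto simp: V_def intro: open_Int open_dom)
  define X where "X = (\<lambda>u q. tvec_of A c q u)"
  have X: "vector_field_on A V (X u)" for u
    unfolding X_def by (rule vector_field_subset[OF vector_field_tvec_of[OF cA(1)]]) (simp add: V_def)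
  have "section_on A \<sigma> V (J \<alpha>)"
    unfolding section_on_def
  proof (intro conjI ballI endo_field_subset[OF E V(2)])
    show "J \<alpha> p \<in> \<sigma> p" if "p \<in> V" for p
      using canonical_local_basisD(3)[OF J, of p] that V(2) by (auto intro: span_base)
  qed
  then obtain S where S: "covariant_derivative_endo_on A nab V (X u) (J \<alpha>) S" "section_on A \<sigma> V S"
    using par V(1) X unfolding parallel_bundle_def by blast
  have "S p \<in> span (range (\<lambda>\<beta>. J \<beta> p))"
    using S(2) V(3) canonical_local_basisD(3)[OF J p] unfolding section_on_def by auto
  then obtain \<omega> where \<omega>: "S p = (\<Sum>\<beta>\<in>UNIV. \<omega> \<beta> *\<^sub>R J \<beta> p)" using span_image_finite_sum[OF _ finite] by blast
  have "cov_endo (gram c) (endo_comp A c (J \<alpha>)) (snd c p) u v =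
    (\<Sum>\<beta>\<in>UNIV. \<omega> \<beta> *\<^sub>R endo_comp A c (J \<beta>) (snd c p) v)" for v
  proof -
    have JY: "vector_field_on A V (\<lambda>q. J \<alpha> q (X v q))" by (rule vector_field_endo[OF E V(1,2) X])
    have "S p (X v p) = nab (X u) (\<lambda>q. J \<alpha> q (X v q)) p - J \<alpha> p (nab (X u) (X v) p)"
      using S(1) V(1,3) X unfolding covariant_derivative_endo_on_def by blast
    also have "\<dots> = nabla (X u) (\<lambda>q. J \<alpha> q (X v q)) p - J \<alpha> p (nabla (X u) (X v) p)"
      by (simp only: levi_civita_unique[OF LC V(1,3) X JY] levi_civita_unique[OF LC V(1,3) X X])
    finally have "S p (X v p) c = cov_endo (gram c) (endo_comp A c (J \<alpha>)) (snd c p) u v"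
      using nabla_endo_component[OF U E V X X c, of u v] c by (simp add: X_def)
    then show ?thesis
      by (simp add: \<omega> sum_fun_apply scaleR_fun_def X_def endo_comp_chart[OF c])
  qed
  then show ?thesis by blast
qed

text \<open>Insert u and J v into the hermitian identity. Since J squares to -
  \<open>eps \<alpha>\<close>, the factor \<open>eps \<alpha>\<close> occurs on both sides and
  cancels: each J is skew, also the two that reverse the sign of the metric.\<close>

lemma hermitian_skew:
  assumes J: "canonical_local_basis A \<sigma> U J" and p: "p \<in> U" and c: "c \<in> charts_at A p"
    and herm: "\<And>v w. v \<in> T p \<Longrightarrow> w \<in> T p \<Longrightarrow> g p (J \<alpha> p v) (J \<alpha> p w) = eps \<alpha> * g p v w"
  shows "gram c (snd c p) (endo_comp A c (J \<alpha>) (snd c p) u) v = - gram c (snd c p) u (endo_comp A c (J \<alpha>) (snd c p) v)"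
proof -
  have cA: "c \<in> A" using c by (auto simp: charts_at_iff)
  let ?u = "tvec_of A c p u" and ?v = "tvec_of A c p v" and ?j = "J \<alpha> p"
  have t: "?u \<in> T p" "?v \<in> T p" by (rule tvec_of_in[OF c])+
  have jt: "?j w \<in> T p" if "w \<in> T p" for w
    by (rule endo_in[OF canonical_local_basisD(2)[OF J] p that])
  have jc: "endo_comp A c (J \<alpha>) (snd c p) u = ?j (tvec_of A c p u) c" for u by (rule endo_comp_chart[OF c])
  have "g p (?j ?u) (?j (?j ?v)) = eps \<alpha> * g p ?u (?j ?v)" by (rule herm[OF t(1) jt[OF t(2)]])
  also have "?j (?j ?v) = - eps \<alpha> *\<^sub>R ?v" by (rule canonical_local_basisD(4)[OF J p t(2)])
  also have "g p (?j ?u) (- eps \<alpha> *\<^sub>R ?v) = - eps \<alpha> * g p (?j ?u) ?v"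
    using metric_sym[OF jt[OF t(1)] tangent_space_scale[OF t(2)], of "- eps \<alpha>"]
      metric_scale[OF t(2) jt[OF t(1)], of "- eps \<alpha>"] metric_sym[OF jt[OF t(1)] t(2)] by simp
  finally have "g p (?j ?u) ?v = - g p ?u (?j ?v)"
    by (cases "\<alpha> = 1") (simp_all add: eps_def)
  then show ?thesis
    by (simp add: jc metric_gram[OF c] jt t tvec_of_apply[OF c])
qed

lemma endo_deriv_in_bundle:
  assumes J: "canonical_local_basis A \<sigma> U J" and V: "open V" and X: "vector_field_on A V X"
    and I: "section_on A \<sigma> V I" and p: "p \<in> U" "p \<in> V" and c: "c \<in> charts_at A p"
    and par: "\<And>\<alpha> u. \<exists>\<omega>. \<forall>v. cov_endo (gram c) (endo_comp A c (J \<alpha>)) (snd c p) u v =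
      (\<Sum>\<beta>\<in>UNIV. \<omega> \<beta> *\<^sub>R endo_comp A c (J \<beta>) (snd c p) v)"
  shows "endo_deriv X I p \<in> \<sigma> p"
proof -
  have cA: "c \<in> A" "p \<in> fst c" using c by (auto simp: charts_at_iff)
  interpret L: local_metric "snd c ` fst c" "gram c" by (rule local_metric_gram[OF cA(1)])
  note JU = canonical_local_basisD(1)[OF J] and JE = canonical_local_basisD(2)[OF J]
  have IE: "endo_field_on A V I" using I unfolding section_on_def by blast
  define W where "W = snd c ` (fst c \<inter> (U \<inter> V))"
  define x where "x = snd c p"
  have W: "open W" "x \<in> W" using in_chart_image[OF open_Int[OF JU V] _ c] p unfolding W_def x_def by auto
  have xS: "x \<in> snd c ` fst c" using cA by (simp add: x_def)
  define K where "K \<alpha> = endo_comp A c (J \<alpha>)" for \<alpha>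
  define Q where "Q = endo_comp A c I"
  have linK: "linear (K \<alpha> y)" and linQ: "linear (Q y)" if "y \<in> W" for y \<alpha>
    using that unfolding K_def Q_def W_def
    by (auto intro!: linear_endo_comp[OF JE cA(1)] linear_endo_comp[OF IE cA(1)])
  have dK: "(\<lambda>y. K \<alpha> y v) differentiable (at x)" and dQ: "(\<lambda>y. Q y v) differentiable (at x)" for \<alpha> v
    unfolding K_def Q_def x_def
    by (auto intro: differentiable_endo_comp[OF JU JE p(1) c] differentiable_endo_comp[OF V IE p(2) c])
  \<comment> \<open>The coefficients come from the span at each point separately, so nothing is
    known yet about how they vary.\<close>
  have "\<exists>f. \<forall>v. Q y v = (\<Sum>\<alpha>\<in>UNIV. f \<alpha> *\<^sub>R K \<alpha> y v)" if y: "y \<in> W" for y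
  proof -
    obtain q where q: "y = snd c q" "q \<in> fst c" "q \<in> U" "q \<in> V" using y unfolding W_def by auto
    have "I q \<in> span (range (\<lambda>\<alpha>. J \<alpha> q))"
      using I q canonical_local_basisD(3)[OF J q(3)] unfolding section_on_def by auto
    then obtain f where "I q = (\<Sum>\<alpha>\<in>UNIV. f \<alpha> *\<^sub>R J \<alpha> q)" using span_image_finite_sum[OF _ finite] by blast
    then have "Q y v = (\<Sum>\<alpha>\<in>UNIV. f \<alpha> *\<^sub>R K \<alpha> y v)" for v
      using q cA by (simp add: Q_def K_def endo_comp_def sum_fun_apply scaleR_fun_def)
    then show ?thesis by blast
  qed
  then obtain f where f: "\<And>y v. y \<in> W \<Longrightarrow> Q y v = (\<Sum>\<alpha>\<in>UNIV. f y \<alpha> *\<^sub>R K \<alpha> y v)" by metis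
  have "(\<lambda>y. f y \<alpha>) differentiable (at x)" for \<alpha>
  proof -
    obtain e :: 'e where e: "e \<in> Basis" using nonempty_Basis by blast
    \<comment> \<open>The anticommutator of J with index \<alpha> and I is - 2 *
      \<open>eps \<alpha>\<close> * f times the identity. As \<open>eps \<alpha>\<close> is its own
      inverse, the factor - \<open>eps \<alpha>\<close> / 2 recovers f from the component along a
      unit vector e.\<close>
    have "f y \<alpha> = - eps \<alpha> / 2 * ((K \<alpha> y (Q y e) + Q y (K \<alpha> y e)) \<bullet> e)" if y: "y \<in> W" for y
    proof -
      have "K \<alpha> y (Q y e) + Q y (K \<alpha> y e) =
          (\<Sum>\<beta>\<in>UNIV. f y \<beta> *\<^sub>R (K \<alpha> y (K \<beta> y e) + K \<beta> y (K \<alpha> y e)))"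
        by (simp add: f[OF y] linear_sum[OF linK[OF y]] linear_scale[OF linK[OF y]] scaleR_add_right sum.distrib)
      also have "\<dots> = (\<Sum>\<beta>\<in>UNIV. if \<alpha> = \<beta> then f y \<beta> *\<^sub>R (- 2 * eps \<alpha>) *\<^sub>R e else 0)"
      proof (rule sum.cong[OF refl])
        fix \<beta>
        have "y \<in> snd c ` (fst c \<inter> U)" using y unfolding W_def by auto
        from canonical_anticommute_comp[OF J cA(1) this, of \<alpha> \<beta> e]
        show "f y \<beta> *\<^sub>R (K \<alpha> y (K \<beta> y e) + K \<beta> y (K \<alpha> y e)) = (if \<alpha> = \<beta> then f y \<beta> *\<^sub>R (- 2 * eps \<alpha>) *\<^sub>R e else 0)"
          by (simp add: K_def)
      qed
      also have "\<dots> = f y \<alpha> *\<^sub>R (- 2 * eps \<alpha>) *\<^sub>R e" by simp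
      finally show ?thesis using e by (cases "\<alpha> = 1") (simp_all add: eps_def inner_Basis)
    qed
    moreover have "(\<lambda>y. - eps \<alpha> / 2 * ((K \<alpha> y (Q y e) + Q y (K \<alpha> y e)) \<bullet> e)) differentiable (at x)"
    proof -
      have 1: "((\<lambda>y. K \<alpha> y (Q y e)) has_derivative (\<lambda>h. fder (\<lambda>y. K \<alpha> y (Q x e)) x h + K \<alpha> x (fder (\<lambda>y. Q y e) x h))) (at x)"
        by (rule has_derivative_linear_family[where f="\<lambda>y. y" and J="K \<alpha>", OF W linK dK has_derivative_ident fder_works[OF dQ]])
      have 2: "((\<lambda>y. Q y (K \<alpha> y e)) has_derivative (\<lambda>h. fder (\<lambda>y. Q y (K \<alpha> x e)) x h + Q x (fder (\<lambda>y. K \<alpha> y e) x h))) (at x)"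
        by (rule has_derivative_linear_family[where f="\<lambda>y. y" and J="Q", OF W linQ dQ has_derivative_ident fder_works[OF dK]])
      show ?thesis
        unfolding differentiable_def
        by (rule exI, rule has_derivative_mult_right, rule has_derivative_inner_left, rule has_derivative_add[OF 1 2])
    qed
    ultimately show ?thesis by (subst differentiable_cong_open[OF W]) auto
  qed
  note df = this
  have "\<forall>\<alpha>. \<exists>\<omega>. \<forall>v. cov_endo (gram c) (K \<alpha>) x (X p c) v = (\<Sum>\<beta>\<in>UNIV. \<omega> \<beta> *\<^sub>R K \<beta> x v)"
    using par unfolding K_def x_def by blast
  then obtain \<omega> where \<omega>: "\<And>\<alpha> v. cov_endo (gram c) (K \<alpha>) x (X p c) v = (\<Sum>\<beta>\<in>UNIV. \<omega> \<alpha> \<beta> *\<^sub>R K \<beta> x v)"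
    by metis
  \<comment> \<open>Leibniz rule for a combination of the basis: the derivative of the coefficient,
    plus the old coefficients multiplied by the connection matrix \<omega>.\<close>
  define \<theta> where "\<theta> \<beta> = fder (\<lambda>y. f y \<beta>) x (X p c) + (\<Sum>\<alpha>\<in>UNIV. f x \<alpha> * \<omega> \<alpha> \<beta>)" for \<beta>
  have cov: "cov_endo (gram c) Q x (X p c) v = (\<Sum>\<beta>\<in>UNIV. \<theta> \<beta> *\<^sub>R K \<beta> x v)" for v
  proof -
    let ?u = "X p c"
    have "fder (\<lambda>y. Q y v) x = fder (\<lambda>y. \<Sum>\<alpha>\<in>UNIV. f y \<alpha> *\<^sub>R K \<alpha> y v) x"
      by (rule fder_cong_open[OF W f])
    moreover have "((\<lambda>y. \<Sum>\<alpha>\<in>UNIV. f y \<alpha> *\<^sub>R K \<alpha> y v) has_derivative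
      (\<lambda>h. \<Sum>\<alpha>\<in>UNIV. f x \<alpha> *\<^sub>R fder (\<lambda>y. K \<alpha> y v) x h + fder (\<lambda>y. f y \<alpha>) x h *\<^sub>R K \<alpha> x v)) (at x)"
      by (intro has_derivative_sum has_derivative_scaleR fder_works df dK)
    ultimately have "fder (\<lambda>y. Q y v) x ?u =
      (\<Sum>\<alpha>\<in>UNIV. f x \<alpha> *\<^sub>R fder (\<lambda>y. K \<alpha> y v) x ?u + fder (\<lambda>y. f y \<alpha>) x ?u *\<^sub>R K \<alpha> x v)"
      by (simp add: has_derivative_imp_fder)
    then have "cov_endo (gram c) Q x ?u v =
      (\<Sum>\<alpha>\<in>UNIV. fder (\<lambda>y. f y \<alpha>) x ?u *\<^sub>R K \<alpha> x v + f x \<alpha> *\<^sub>R cov_endo (gram c) (K \<alpha>) x ?u v)"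
      by (simp add: cov_endo_def f[OF W(2)] linear_sum[OF L.linear_christoffel(1)[OF xS]]
        linear_scale[OF L.linear_christoffel(1)[OF xS]] sum.distrib sum_subtractf algebra_simps)
    also have "\<dots> = (\<Sum>\<beta>\<in>UNIV. fder (\<lambda>y. f y \<beta>) x ?u *\<^sub>R K \<beta> x v) +
      (\<Sum>\<alpha>\<in>UNIV. \<Sum>\<beta>\<in>UNIV. (f x \<alpha> * \<omega> \<alpha> \<beta>) *\<^sub>R K \<beta> x v)"
      by (simp add: \<omega> sum.distrib scaleR_sum_right)
    also have "(\<Sum>\<alpha>\<in>UNIV. \<Sum>\<beta>\<in>UNIV. (f x \<alpha> * \<omega> \<alpha> \<beta>) *\<^sub>R K \<beta> x v) =
      (\<Sum>\<beta>\<in>UNIV. \<Sum>\<alpha>\<in>UNIV. (f x \<alpha> * \<omega> \<alpha> \<beta>) *\<^sub>R K \<beta> x v)" by (rule sum.swap)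
    finally show ?thesis by (simp add: \<theta>_def scaleR_add_left sum.distrib scaleR_sum_left)
  qed
  have "endo_deriv X I p = (\<Sum>\<beta>\<in>UNIV. \<theta> \<beta> *\<^sub>R J \<beta> p)"
  proof
    fix v
    show "endo_deriv X I p v = (\<Sum>\<beta>\<in>UNIV. \<theta> \<beta> *\<^sub>R J \<beta> p) v"
    \<comment> \<open>Membership in the span is an equality of functions on all families v, so the
      zero extensions outside the tangent space have to agree as well.\<close>
    proof (cases "v \<in> T p")
      case True
      show ?thesis
      proof (rule tangent_space_eqI[OF endo_deriv_in[OF True] _ c])
        have "(\<Sum>\<beta>\<in>UNIV. \<theta> \<beta> *\<^sub>R (J \<beta> p v)) \<in> T p"
          by (intro subspace_sum[OF subspace_tangent_space] tangent_space_scale endo_in[OF JE p(1) True])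
        moreover have "(\<Sum>\<beta>\<in>UNIV. \<theta> \<beta> *\<^sub>R J \<beta> p) v = (\<Sum>\<beta>\<in>UNIV. \<theta> \<beta> *\<^sub>R (J \<beta> p v))"
          by (simp add: sum_fun_apply scaleR_fun_def)
        ultimately show "(\<Sum>\<beta>\<in>UNIV. \<theta> \<beta> *\<^sub>R J \<beta> p) v \<in> T p" by simp
        show "endo_deriv X I p v c = (\<Sum>\<beta>\<in>UNIV. \<theta> \<beta> *\<^sub>R J \<beta> p) v c"
          using endo_deriv_component[OF V p(2) IE X True c] cov[of "v c"]
          by (simp add: Q_def K_def x_def sum_fun_apply scaleR_fun_def endo_apply[OF c True])
      qed
    next
      case False
      then show ?thesis
        using endo_outside[OF endo_tangent[OF JE p(1)] False]
        by (simp add: endo_deriv_def Let_def sum_fun_apply scaleR_fun_apply)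
    qed
  qed
  then show ?thesis
    unfolding canonical_local_basisD(3)[OF J p(1)]
    by (auto intro!: span_sum span_scale intro: span_base)
qed

end

section \<open>Smooth maps and paraquaternionic CR-submersions\<close>

locale smooth_mapping = source: atlas B + target: atlas A
  for B :: "('n::{t2_space, second_countable_topology}, 'f::euclidean_space) chart set"
    and A :: "('m::{t2_space, second_countable_topology}, 'e::euclidean_space) chart set" +
  fixes f :: "'n \<Rightarrow> 'm"
  assumes smooth_map: "smooth_map B A f"
begin

lemma open_preimage: "open U \<Longrightarrow> open (f -` U)"
  using smooth_map unfolding smooth_map_def by (elim conjE) (rule open_vimage)

lemma smooth_chart:
  assumes "b \<in> B" "c \<in> A"
  shows "smooth_on (snd b ` (fst b \<inter> f -` fst c)) (snd c \<circ> f \<circ> chart_inv b)"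
proof -
  have "\<forall>b\<in>B. \<forall>c\<in>A. smooth_on (snd b ` (fst b \<inter> f -` fst c)) (snd c \<circ> f \<circ> chart_inv b)"
    using smooth_map unfolding smooth_map_def by (elim conjE)
  then show ?thesis using assms by simp
qed

lemma differentiable_chart:
  assumes "b \<in> charts_at B p" "c \<in> charts_at A (f p)"
  shows "(snd c \<circ> f \<circ> chart_inv b) differentiable (at (snd b p))"
  by (rule smooth_on_imp_differentiable[OF smooth_chart]) (use assms in \<open>auto simp: charts_at_iff\<close>)

lemma differential_component:
  assumes v: "v \<in> source.T p" and b: "b \<in> charts_at B p" and c: "c \<in> charts_at A (f p)"
  shows "differential B A f p v c = fder (snd c \<circ> f \<circ> chart_inv b) (snd b p) (v b)"
proof -
  define b' where "b' = (SOME b. b \<in> charts_at B p)"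
  have b': "b' \<in> charts_at B p" unfolding b'_def by (rule source.some_chart)
  have "differential B A f p v c = fder (snd c \<circ> f \<circ> chart_inv b') (snd b' p) (v b')"
    by (simp add: differential_def Let_def c b'_def)
  also have "\<dots> = fder (snd c \<circ> f \<circ> chart_inv b) (snd b p) (fder (snd b \<circ> chart_inv b') (snd b' p) (v b'))"
    by (rule source.fder_change_chart[OF b' b differentiable_chart[OF b c]])
  also have "fder (snd b \<circ> chart_inv b') (snd b' p) (v b') = v b"
    by (rule source.tangent_space_change[OF v b' b, symmetric])
  finally show ?thesis .
qed

lemma differential_in:
  assumes v: "v \<in> source.T p"
  shows "differential B A f p v \<in> target.T (f p)"
proof (rule target.tangent_spaceI)
  show "differential B A f p v c = 0" if "c \<notin> charts_at A (f p)" for c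
    using that by (simp add: differential_def)
  fix c d assume c: "c \<in> charts_at A (f p)" and d: "d \<in> charts_at A (f p)"
  obtain b where b: "b \<in> charts_at B p" using source.ex_chart by blast
  have cA: "c \<in> A" "f p \<in> fst c" "d \<in> A" "f p \<in> fst d" and bB: "b \<in> B" "p \<in> fst b"
    using b c d by (auto simp: charts_at_iff)
  let ?F = "snd c \<circ> f \<circ> chart_inv b" and ?\<tau> = "snd d \<circ> chart_inv c"
  have Fp: "?F (snd b p) = snd c (f p)" using bB by simp
  have "fder (snd d \<circ> f \<circ> chart_inv b) (snd b p) = fder (\<lambda>y. ?\<tau> (?F y)) (snd b p)"
  proof (rule fder_cong_open)
    have "open (f -` fst c)" using open_preimage target.open_dom cA by blast
    then show "open (snd b ` (fst b \<inter> f -` fst c))" by (rule source.open_image[OF bB(1)])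
    show "snd b p \<in> snd b ` (fst b \<inter> f -` fst c)" using bB cA by auto
    show "(snd d \<circ> f \<circ> chart_inv b) y = ?\<tau> (?F y)" if "y \<in> snd b ` (fst b \<inter> f -` fst c)" for y
      using source.chart_inv_in[OF bB(1) that] cA by simp
  qed
  moreover have "fder (\<lambda>y. ?\<tau> (?F y)) (snd b p) w = fder ?\<tau> (snd c (f p)) (fder ?F (snd b p) w)" for w
    using fder_compose[OF differentiable_chart[OF b c], of ?\<tau> w] target.differentiable_transition[OF c d]
    unfolding Fp by simp
  ultimately show "differential B A f p v d = fder ?\<tau> (snd c (f p)) (differential B A f p v c)"
    by (simp add: differential_component[OF v b c] differential_component[OF v b d])
qed

end

text \<open>Reads all data at q in charts of N, M and M' and verifies the assumptions of
  \<open>local_submersion\<close>. The conclusion mentions only the point \<pi> q of M'.\<close>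

lemma CR_submersion_cov_endo:
  fixes A :: "('m::{t2_space, second_countable_topology}, 'e::euclidean_space) chart set"
    and B :: "('n::{t2_space, second_countable_topology}, 'f::euclidean_space) chart set"
    and A' :: "('k::{t2_space, second_countable_topology}, 'h::euclidean_space) chart set"
  assumes kahler: "paraquaternionic_kahler A \<sigma> g"
    and CR: "paraquaternionic_CR_submanifold B A \<iota> \<sigma> g D"
    and hermitian': "almost_paraquaternionic_hermitian A' \<sigma>' g'"
    and subm: "paraquaternionic_CR_submersion B A \<iota> \<sigma> g D A' \<sigma>' g' \<pi>"
    and J': "canonical_local_basis A' \<sigma>' U' J'" and q: "\<pi> q \<in> U'" and a: "a \<in> charts_at A' (\<pi> q)"
  shows "\<exists>\<omega>. \<forall>v. cov_endo (semi_riemannian.gram A' g' a) (endo_comp A' a (J' \<alpha>)) (snd a (\<pi> q)) u v =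
      (\<Sum>\<beta>\<in>UNIV. \<omega> \<beta> *\<^sub>R endo_comp A' a (J' \<beta>) (snd a (\<pi> q)) v)"
proof -
  have hermitian: "almost_paraquaternionic_hermitian A \<sigma> g"
    using kahler unfolding paraquaternionic_kahler_def by blast
  obtain nab where nab: "levi_civita_connection A g nab" "parallel_bundle A nab \<sigma>"
    using kahler unfolding paraquaternionic_kahler_def by blast
  interpret M: semi_riemannian A g
    using hermitian unfolding almost_paraquaternionic_hermitian_def by unfold_locales auto
  interpret M': semi_riemannian A' g'
    using hermitian' unfolding almost_paraquaternionic_hermitian_def by unfold_locales auto
  define h where "h = induced_metric B A \<iota> g"
  have sr: "semi_riemannian_submersion B h A' g' \<pi>"
    and vert: "\<And>x. vertical_space B A' \<pi> x = ortho_distribution B h D x"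
    and bij: "\<And>x. bij_betw (differential B A' \<pi> x) (D x) (tangent_space A' (\<pi> x))"
    and iso: "\<And>x v w. v \<in> D x \<Longrightarrow> w \<in> D x \<Longrightarrow> g' (\<pi> x) (differential B A' \<pi> x v) (differential B A' \<pi> x w) = h x v w"
    and tw: "\<And>x U' J'. canonical_local_basis A' \<sigma>' U' J' \<Longrightarrow> \<pi> x \<in> U' \<Longrightarrow>
         (\<exists>U J W. canonical_local_basis A \<sigma> U J \<and> open W \<and> x \<in> W \<and> \<iota> ` W \<subseteq> U \<and> \<pi> ` W \<subseteq> U' \<and>
           (\<forall>q\<in>W. \<forall>\<alpha>. \<forall>v\<in>D q. \<exists>w\<in>D q.
              differential B A \<iota> q w = J \<alpha> (\<iota> q) (differential B A \<iota> q v) \<and>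
              differential B A' \<pi> q w = J' \<alpha> (\<pi> q) (differential B A' \<pi> q v)))"
    using subm unfolding paraquaternionic_CR_submersion_def Let_def h_def by blast+
  have atlas: "smooth_atlas B" and \<iota>: "smooth_map B A \<iota>" and dist: "distribution B D"
    using CR unfolding paraquaternionic_CR_submanifold_def nondegenerate_submanifold_def immersion_def by blast+
  have \<pi>: "smooth_map B A' \<pi>" using sr unfolding semi_riemannian_submersion_def by (elim conjE)
  interpret N: atlas B by unfold_locales (rule atlas)
  interpret \<iota>: smooth_mapping B A \<iota> by unfold_locales (rule \<iota>)
  interpret \<pi>: smooth_mapping B A' \<pi> by unfold_locales (rule \<pi>)
  \<comment> \<open>The submersion provides a basis J matched to the given J' near q; with an
    unmatched basis the coefficients on M could not be compared with those on M'.\<close>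
  obtain U J W where J: "canonical_local_basis A \<sigma> U J" and W: "open W" "q \<in> W" "\<iota> ` W \<subseteq> U" "\<pi> ` W \<subseteq> U'"
    and twist: "\<And>s \<alpha> v. s \<in> W \<Longrightarrow> v \<in> D s \<Longrightarrow> \<exists>w\<in>D s.
      differential B A \<iota> s w = J \<alpha> (\<iota> s) (differential B A \<iota> s v) \<and>
      differential B A' \<pi> s w = J' \<alpha> (\<pi> s) (differential B A' \<pi> s v)"
    using tw[OF J' q] by metis
  from dist[unfolded distribution_def] obtain r :: nat where
    "\<forall>p. \<exists>Z X. open Z \<and> p \<in> Z \<and> (\<forall>i<r. vector_field_on B Z (X i)) \<and>
      (\<forall>s\<in>Z. D s = span ((\<lambda>i. X i s) ` {..<r}) \<and> dim (D s) = r)" ..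
  from spec[OF this, of q] obtain Z X where "open Z \<and> q \<in> Z \<and> (\<forall>i<r. vector_field_on B Z (X i)) \<and>
      (\<forall>s\<in>Z. D s = span ((\<lambda>i. X i s) ` {..<r}) \<and> dim (D s) = r)" by (elim exE)
  then have Z: "open Z" "q \<in> Z" and X: "\<And>i. i < r \<Longrightarrow> vector_field_on B Z (X i)"
    and D: "\<And>s. s \<in> Z \<Longrightarrow> D s = span ((\<lambda>i. X i s) ` {..<r})" by simp_all
  obtain b where b: "b \<in> charts_at B q" using N.ex_chart by blast
  obtain c where c: "c \<in> charts_at A (\<iota> q)" using M.ex_chart by blast
  have bB: "b \<in> B" "q \<in> fst b" and cA: "c \<in> A" "\<iota> q \<in> fst c" and aA: "a \<in> A'" "\<pi> q \<in> fst a"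
    using a b c by (auto simp: charts_at_iff)
  \<comment> \<open>A neighbourhood of q on which the matching of J and J', a local frame of D and
    all three charts are available.\<close>
  define V where "V = W \<inter> Z \<inter> fst b \<inter> \<iota> -` fst c \<inter> \<pi> -` fst a"
  have V: "open V" "q \<in> V"
    unfolding V_def using W Z bB cA aA
    by (auto intro!: open_Int \<iota>.open_preimage \<pi>.open_preimage N.open_dom M.open_dom M'.open_dom)
  have Vb: "fst b \<inter> V = V" by (auto simp: V_def)
  have at: "b \<in> charts_at B s" "c \<in> charts_at A (\<iota> s)" "a \<in> charts_at A' (\<pi> s)" "s \<in> fst b" if "s \<in> V" for s
    using that bB cA aA by (auto simp: V_def charts_at_iff)
  have DT: "D s \<subseteq> N.T s" if "s \<in> V" for s
  proof -
    have s: "s \<in> Z" using that by (simp add: V_def)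
    show ?thesis unfolding D[OF s]
      by (rule span_minimal[OF _ N.subspace_tangent_space]) (use N.vector_field_in[OF X s] in auto)
  qed
  define f where "f = snd c \<circ> \<iota> \<circ> chart_inv b"
  define p where "p = snd a \<circ> \<pi> \<circ> chart_inv b"
  have fs: "f (snd b s) = snd c (\<iota> s)" and ps: "p (snd b s) = snd a (\<pi> s)" if "s \<in> V" for s
    using at[OF that] bB by (auto simp: f_def p_def)
  have df: "fder f (snd b s) (v b) = differential B A \<iota> s v c"
    and dp: "fder p (snd b s) (v b) = differential B A' \<pi> s v a" if "s \<in> V" "v \<in> N.T s" for s v
    using \<iota>.differential_component[OF that(2) at(1,2)[OF that(1)]]
      \<pi>.differential_component[OF that(2) at(1,3)[OF that(1)]] by (simp_all add: f_def p_def)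
  define E where "E y = (\<lambda>v. v b) ` D (chart_inv b y)" for y
  have E: "E (snd b s) = (\<lambda>v. v b) ` D s" if "s \<in> V" for s
    using at(4)[OF that] bB by (simp add: E_def)
  have gf: "M.gram c (f (snd b s)) (fder f (snd b s) (v b)) (fder f (snd b s) (w b)) = h s v w"
    if s: "s \<in> V" and "v \<in> N.T s" "w \<in> N.T s" for s v w
    using M.metric_gram[OF at(2)[OF s] \<iota>.differential_in[OF that(2)] \<iota>.differential_in[OF that(3)]]
    by (simp add: df that fs h_def induced_metric_def)
  \<comment> \<open>Unlike \<open>gf\<close>, this is restricted to D, where \<pi> is
    isometric.\<close>
  have gp: "M'.gram a (p (snd b s)) (fder p (snd b s) (v b)) (fder p (snd b s) (w b)) = h s v w"
    if s: "s \<in> V" and "v \<in> D s" "w \<in> D s" for s v w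
  proof -
    have t: "v \<in> N.T s" "w \<in> N.T s" using DT[OF s] that by auto
    show ?thesis
      using M'.metric_gram[OF at(3)[OF s] \<pi>.differential_in[OF t(1)] \<pi>.differential_in[OF t(2)]]
      by (simp add: dp t s ps iso that)
  qed
  interpret L: local_submersion "snd c ` fst c" "M.gram c" "snd a ` fst a" "M'.gram a" "snd b ` V" "snd b q" f p E
  proof (intro local_submersion.intro local_submersion_axioms.intro M.local_metric_gram M'.local_metric_gram cA(1) aA(1))
    show "open (snd b ` V)" using N.open_image[OF bB(1) V(1)] by (simp add: Vb)
    show "snd b q \<in> snd b ` V" using V(2) by (rule imageI)
    show "smooth_on (snd b ` V) f" unfolding f_def
      by (rule smooth_on_subset[OF \<iota>.smooth_chart[OF bB(1) cA(1)]]) (rule image_mono, auto simp: V_def)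
    show "smooth_on (snd b ` V) p" unfolding p_def
      by (rule smooth_on_subset[OF \<pi>.smooth_chart[OF bB(1) aA(1)]]) (rule image_mono, auto simp: V_def)
    show "f ` snd b ` V \<subseteq> snd c ` fst c"
      by (intro image_subsetI, elim imageE) (use at in \<open>auto simp: fs charts_at_iff\<close>)
    show "p ` snd b ` V \<subseteq> snd a ` fst a"
      by (intro image_subsetI, elim imageE) (use at in \<open>auto simp: ps charts_at_iff\<close>)
  next
    fix u assume "u \<in> E (snd b q)"
    then obtain v where v: "v \<in> D q" "u = v b" using E[OF V(2)] by auto
    then have "v \<in> span ((\<lambda>i. X i q) ` {..<r})" using D[OF Z(2)] by simp
    then obtain k where k: "v = (\<Sum>i<r. k i *\<^sub>R X i q)"
      using span_image_finite_sum[OF _ finite_lessThan] by blast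
    \<comment> \<open>A vector of D at q is extended to a section of D with constant coefficients in
      the local frame.\<close>
    define Y where "Y s = (\<Sum>i<r. k i *\<^sub>R X i s)" for s
    have Yb: "Y s b = (\<Sum>i<r. k i *\<^sub>R X i s b)" for s
      by (simp add: Y_def sum_fun_apply scaleR_fun_apply)
    have "(\<lambda>y. Y (chart_inv b y) b) differentiable (at (snd b q))"
      unfolding Yb
      by (intro differentiable_sum differentiable_scaleR differentiable_const finite_lessThan ballI
          N.vector_field_differentiable[OF X Z(2) b]) simp
    moreover have "\<forall>y\<in>snd b ` V. Y (chart_inv b y) b \<in> E y"
    proof (intro ballI, elim imageE)
      fix y s assume s: "y = snd b s" "s \<in> V"
      then have "s \<in> Z" by (simp add: V_def)
      then have "Y s \<in> D s" unfolding Y_def D[OF \<open>s \<in> Z\<close>] by (auto intro!: span_sum span_scale intro: span_base)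
      then show "Y (chart_inv b y) b \<in> E y" using at(4)[OF s(2)] bB E[OF s(2)] s(1) by auto
    qed
    moreover have "Y (chart_inv b (snd b q)) b = u" using bB v k by (simp add: Y_def)
    ultimately show "\<exists>X. X (snd b q) = u \<and> X differentiable (at (snd b q)) \<and> (\<forall>y\<in>snd b ` V. X y \<in> E y)"
      by (intro exI[of _ "\<lambda>y. Y (chart_inv b y) b"] conjI)
  next
    fix y u v assume "y \<in> snd b ` V" "u \<in> E y" "v \<in> E y"
    then obtain s u' v' where s: "y = snd b s" "s \<in> V" "u' \<in> D s" "v' \<in> D s" "u = u' b" "v = v' b"
      using E by auto
    have "u' \<in> N.T s" "v' \<in> N.T s" using DT[OF s(2)] s by auto
    then show "M.gram c (f y) (fder f y u) (fder f y v) = M'.gram a (p y) (fder p y u) (fder p y v)"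
      using gf[OF s(2)] gp[OF s(2-4)] by (simp add: s)
  next
    fix u'
    have "M'.T (\<pi> q) = differential B A' \<pi> q ` D q" using bij[of q] by (simp add: bij_betw_def)
    then obtain v where v: "v \<in> D q" "tvec_of A' a (\<pi> q) u' = differential B A' \<pi> q v"
      using M'.tvec_of_in[OF a, of u'] by auto
    have "fder p (snd b q) (v b) = u'"
      using dp[OF V(2), of v] DT[OF V(2)] v M'.tvec_of_apply[OF a, of u'] by auto
    then show "\<exists>v\<in>E (snd b q). fder p (snd b q) v = u'" using v(1) E[OF V(2)] by auto
  next
    fix v u assume v: "fder p (snd b q) v = 0" and "u \<in> E (snd b q)"
    then obtain w where w: "w \<in> D q" "u = w b" using E[OF V(2)] by auto
    let ?v = "tvec_of B b q v"
    have t: "?v \<in> N.T q" "w \<in> N.T q" using N.tvec_of_in[OF b] DT[OF V(2)] w by auto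
    have "differential B A' \<pi> q ?v = 0"
      by (rule M'.tangent_space_eqI[OF \<pi>.differential_in[OF t(1)] M'.tangent_space_0 a])
         (use dp[OF V(2) t(1)] v b in simp)
    then have "?v \<in> vertical_space B A' \<pi> q" using t by (simp add: vertical_space_def)
    \<comment> \<open>Here the vertical space enters as the orthogonal complement of D in the
      tangent space of N.\<close>
    then have "h q ?v w = 0" using vert[of q] w(1) by (simp add: ortho_distribution_def orthogonal_in_def)
    then show "M.gram c (f (snd b q)) (fder f (snd b q) v) (fder f (snd b q) u) = 0"
      using gf[OF V(2) t] b by (simp add: w(2))
  qed
  have inU: "\<iota> s \<in> U" "\<pi> s \<in> U'" if "s \<in> V" for s using that W by (auto simp: V_def)
  have proj: "\<exists>w\<in>E y. fder f y w = endo_comp A c (J \<beta>) (f y) (fder f y v) \<and>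
      fder p y w = endo_comp A' a (J' \<beta>) (p y) (fder p y v)"
    if y: "y \<in> snd b ` V" "v \<in> E y" for y v \<beta>
  proof -
    obtain s v' where s: "y = snd b s" "s \<in> V" "v' \<in> D s" "v = v' b" using y E by auto
    have "s \<in> W" using s by (simp add: V_def)
    then obtain w where w: "w \<in> D s" "differential B A \<iota> s w = J \<beta> (\<iota> s) (differential B A \<iota> s v')"
      "differential B A' \<pi> s w = J' \<beta> (\<pi> s) (differential B A' \<pi> s v')" using twist s(3) by blast
    have t: "v' \<in> N.T s" "w \<in> N.T s" using DT[OF s(2)] s(3) w(1) by auto
    have "fder f y (w b) = endo_comp A c (J \<beta>) (f y) (fder f y v)"
      using M.endo_apply[OF at(2)[OF s(2)] \<iota>.differential_in[OF t(1)], of "J \<beta>"]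
      by (simp add: s(1,4) df[OF s(2)] t fs[OF s(2)] w(2))
    moreover have "fder p y (w b) = endo_comp A' a (J' \<beta>) (p y) (fder p y v)"
      using M'.endo_apply[OF at(3)[OF s(2)] \<pi>.differential_in[OF t(1)], of "J' \<beta>"]
      by (simp add: s(1,4) dp[OF s(2)] t ps[OF s(2)] w(3))
    moreover have "w b \<in> E y" using w(1) E[OF s(2)] s(1) by auto
    ultimately show ?thesis by blast
  qed
  have fq: "f (snd b q) = snd c (\<iota> q)" and pq: "p (snd b q) = snd a (\<pi> q)" using fs ps V(2) by auto
  note U = M.canonical_local_basisD(1,2)[OF J] and U'o = M'.canonical_local_basisD(1,2)[OF J']
  have "\<exists>\<omega>. \<forall>v. cov_endo (M'.gram a) (endo_comp A' a (J' \<alpha>)) (p (snd b q)) u v =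
      (\<Sum>\<beta>\<in>UNIV. \<omega> \<beta> *\<^sub>R endo_comp A' a (J' \<beta>) (snd a (\<pi> q)) v)"
  proof (rule L.cov_endo_projection[where J="endo_comp A c (J \<alpha>)" and Q="\<lambda>\<beta>. endo_comp A c (J \<beta>) (snd c (\<iota> q))"])
    show "open (snd c ` (fst c \<inter> U))" "f (snd b q) \<in> snd c ` (fst c \<inter> U)"
      using M.in_chart_image[OF U(1) inU(1)[OF V(2)] c] fq by auto
    show "open (snd a ` (fst a \<inter> U'))" "p (snd b q) \<in> snd a ` (fst a \<inter> U')"
      using M'.in_chart_image[OF U'o(1) inU(2)[OF V(2)] a] pq by auto
    show "linear (endo_comp A c (J \<alpha>) y)" if "y \<in> snd c ` (fst c \<inter> U)" for y
      by (rule M.linear_endo_comp[OF U(2) cA(1) that])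
    show "linear (endo_comp A' a (J' \<alpha>) y)" if "y \<in> snd a ` (fst a \<inter> U')" for y
      by (rule M'.linear_endo_comp[OF U'o(2) aA(1) that])
    show "(\<lambda>y. endo_comp A c (J \<alpha>) y v) differentiable (at (f (snd b q)))" for v
      unfolding fq by (rule M.differentiable_endo_comp[OF U inU(1)[OF V(2)] c])
    show "(\<lambda>y. endo_comp A' a (J' \<alpha>) y v) differentiable (at (p (snd b q)))" for v
      unfolding pq by (rule M'.differentiable_endo_comp[OF U'o inU(2)[OF V(2)] a])
    show "\<exists>w\<in>E y. fder f y w = endo_comp A c (J \<alpha>) (f y) (fder f y v) \<and>
        fder p y w = endo_comp A' a (J' \<alpha>) (p y) (fder p y v)"
      if "y \<in> snd b ` V" "v \<in> E y" for y v by (rule proj[OF that])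
    show "\<exists>w\<in>E (snd b q). fder f (snd b q) w = endo_comp A c (J \<beta>) (snd c (\<iota> q)) (fder f (snd b q) v) \<and>
        fder p (snd b q) w = endo_comp A' a (J' \<beta>) (snd a (\<pi> q)) (fder p (snd b q) v)"
      if "v \<in> E (snd b q)" for \<beta> v
      using proj[OF imageI[OF V(2)] that, of \<beta>] unfolding fq pq .
    show "M.gram c (f (snd b q)) (endo_comp A c (J \<alpha>) (f (snd b q)) v) w =
        - M.gram c (f (snd b q)) v (endo_comp A c (J \<alpha>) (f (snd b q)) w)" for v w
      unfolding fq
      by (rule M.hermitian_skew[OF J inU(1)[OF V(2)] c])
         (use hermitian J inU(1)[OF V(2)] in \<open>auto simp: almost_paraquaternionic_hermitian_def\<close>)
    show "M'.gram a (p (snd b q)) (endo_comp A' a (J' \<alpha>) (p (snd b q)) v) w =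
        - M'.gram a (p (snd b q)) v (endo_comp A' a (J' \<alpha>) (p (snd b q)) w)" for v w
      unfolding pq
      by (rule M'.hermitian_skew[OF J' inU(2)[OF V(2)] a])
         (use hermitian' J' inU(2)[OF V(2)] in \<open>auto simp: almost_paraquaternionic_hermitian_def\<close>)
    show "\<exists>\<omega>. \<forall>v. cov_endo (M.gram c) (endo_comp A c (J \<alpha>)) (f (snd b q)) u v =
        (\<Sum>\<beta>\<in>UNIV. \<omega> \<beta> *\<^sub>R endo_comp A c (J \<beta>) (snd c (\<iota> q)) v)" for u
      unfolding fq by (rule M.parallel_cov_endo[OF nab J inU(1)[OF V(2)] c])
  qed
  then show ?thesis unfolding pq .
qed

theorem theorem6p7:
  fixes A :: "('m::{t2_space, second_countable_topology}, 'e::euclidean_space) chart set"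
    and \<sigma> :: "'m \<Rightarrow> (('m, 'e) tvec \<Rightarrow> ('m, 'e) tvec) set"
    and g :: "('m, 'e) metric_tensor"
    and B :: "('n::{t2_space, second_countable_topology}, 'f::euclidean_space) chart set"
    and \<iota> :: "'n \<Rightarrow> 'm"
    and D :: "'n \<Rightarrow> ('n, 'f) tvec set"
    and A' :: "('k::{t2_space, second_countable_topology}, 'h::euclidean_space) chart set"
    and \<sigma>' :: "'k \<Rightarrow> (('k, 'h) tvec \<Rightarrow> ('k, 'h) tvec) set"
    and g' :: "('k, 'h) metric_tensor"
    and \<pi> :: "'n \<Rightarrow> 'k"
  assumes "paraquaternionic_kahler A \<sigma> g"
    and "paraquaternionic_CR_submanifold B A \<iota> \<sigma> g D"
    and "almost_paraquaternionic_hermitian A' \<sigma>' g'"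
    and "paraquaternionic_CR_submersion B A \<iota> \<sigma> g D A' \<sigma>' g' \<pi>"
  shows "paraquaternionic_kahler A' \<sigma>' g'"
proof -
  interpret M': semi_riemannian A' g'
    using assms(3) unfolding almost_paraquaternionic_hermitian_def by unfold_locales auto
  have surj: "surj \<pi>"
    using assms(4) unfolding paraquaternionic_CR_submersion_def semi_riemannian_submersion_def Let_def by (elim conjE)
  have bases: "\<forall>y. \<exists>U' J'. y \<in> U' \<and> canonical_local_basis A' \<sigma>' U' J'"
    using assms(3) unfolding almost_paraquaternionic_hermitian_def almost_paraquaternionic_def by (elim conjE)
  have "parallel_bundle A' M'.nabla \<sigma>'"
    unfolding parallel_bundle_def
  proof (intro allI impI)
    fix U X I assume U: "open U" and X: "vector_field_on A' U X" and I: "section_on A' \<sigma>' U I"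
    have E: "endo_field_on A' U I" using I unfolding section_on_def by blast
    \<comment> \<open>The derivative of I exists as a smooth endomorphism field for any I; what is
      left is a condition at each point.\<close>
    have cov: "covariant_derivative_endo_on A' M'.nabla U X I (M'.endo_deriv X I)"
      by (rule M'.covariant_derivative_endo_deriv[OF U E X])
    have "M'.endo_deriv X I y \<in> \<sigma>' y" if y: "y \<in> U" for y
    proof -
      obtain U' J' where J': "y \<in> U'" "canonical_local_basis A' \<sigma>' U' J'"
        using bases by blast
      obtain a where a: "a \<in> charts_at A' y" using M'.ex_chart by blast
      \<comment> \<open>Any single point of the fibre over y will do, since the transferred identity
        concerns M' at y.\<close>
      obtain q where q: "y = \<pi> q" using surj by auto
      show ?thesis
        using CR_submersion_cov_endo[OF assms J'(2)] J'(1) a unfolding q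
        by (intro M'.endo_deriv_in_bundle[OF J'(2) U X I J'(1)[unfolded q] y[unfolded q] a[unfolded q]]) auto
    qed
    then have "section_on A' \<sigma>' U (M'.endo_deriv X I)"
      using cov unfolding section_on_def covariant_derivative_endo_on_def by blast
    with cov show "\<exists>S. covariant_derivative_endo_on A' M'.nabla U X I S \<and> section_on A' \<sigma>' U S" by blast
  qed
  then show ?thesis
    unfolding paraquaternionic_kahler_def using assms(3) M'.levi_civita_nabla by blast
qed

end
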